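(* Let $\tau=u+iv\in\mathbb{H}$ and $\Lambda_\tau:=\mathbb{Z}+\mathbb{Z}\tau$. For $s>0$ let $\Lambda_\tau(s):=\{\omega^2|\omega|^{2s}:\omega\in\Lambda_\tau\setminus\{0\}\}$ (a set), and for $k\in\mathbb{N}$ let \[e_k(\Lambda_\tau(s)):=\sum_{\substack{\omega_1,\ldots,\omega_k\in\Lambda_\tau(s)\\ \text{distinct}}}\frac{1}{\omega_1\cdots\omega_k}\] (the $k$-th elementary symmetric function of the reciprocals of the elements of $\Lambda_\tau(s)$), and $e_k(\Lambda_\tau(0)):=\lim_{s\to0^+}e_k(\Lambda_\tau(s))$. Let $k\in\mathbb{N}$. Then: (1) $e_k(\Lambda_\tau(0))$ is an almost holomorphic modular form of weight $2k$ and depth $k$. (2) With the convention $e_0(\Lambda_\tau(0))=1$, one has $L\big(e_k(\Lambda_\tau(0))\big)=\frac{\pi}{2}e_{k-1}(\Lambda_\tau(0))$, where $L:=-2iv^2\frac{\partial}{\partial\overline{\tau}}$ is the lowering operator. (3) The function \[\phi(z;\tau):=e^{-\frac{\pi z^2}{2v}}\sum_{k\ge0}(-1)^k e_k(\Lambda_\tau(0))\,z^{2k+1}\] is a Jacobi form of weight $-1$ and index $\frac12$.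
   Context: Throughout $\tau=u+iv$ with $v>0$, $q:=e^{2\pi i\tau}$, $\zeta:=e^{2\pi i z}$. An almost holomorphic modular form of weight $k$ (for $\mathrm{SL}_2(\mathbb{Z})$) is a function $f$ on $\mathbb{H}$ satisfying $f\big(\frac{a\tau+b}{c\tau+d}\big)=(c\tau+d)^k f(\tau)$ for all $\begin{psmallmatrix}a&b\\c&d\end{psmallmatrix}\in\mathrm{SL}_2(\mathbb{Z})$ which is a polynomial in $\frac1v$ with holomorphic coefficients; the degree of this polynomial is its depth. A (meromorphic) Jacobi form of weight $k$ and index $m\in\frac12\mathbb{N}$ is a function $\phi:\mathbb{C}\times\mathbb{H}\to\mathbb{C}$ (meromorphic, $k$ allowed to be non-positive) such that for all $\begin{psmallmatrix}a&b\\c&d\end{psmallmatrix}\in\mathrm{SL}_2(\mathbb{Z})$ and $\lambda,\mu\in\mathbb{Z}$: (i) $\phi\big(\frac{z}{c\tau+d};\frac{a\tau+b}{c\tau+d}\big)=(c\tau+d)^k e^{\frac{2\pi i m c z^2}{c\tau+d}}\phi(z;\tau)$; (ii) $\phi(z+\lambda\tau+\mu;\tau)=(-1)^{2m\mu+\lambda\varepsilon}e^{-2\pi i m(\lambda^2\tau+2\lambda z)}\phi(z;\tau)$ for some fixed $\varepsilon\in\{0,1\}$; and (iii) it has a Fourier expansion $\sum c(n,r)q^n\zeta^r$, allowing finite-order poles in $\tau$ at the cusps. *)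

theory Defs
  imports "HOL-Analysis.Analysis"
begin

abbreviation upper_half_plane :: "complex set" where
  "upper_half_plane \<equiv> {\<tau>. Im \<tau> > 0}"

definition period_lattice :: "complex \<Rightarrow> complex set" where
  "period_lattice \<tau> = {of_int m + of_int n * \<tau> | m n. True}"

text \<open>Since this is a set, the points \<open>\<omega>\<close> and \<open>-\<omega>\<close> of the lattice contribute one element only.\<close>

definition deformed_lattice :: "complex \<Rightarrow> real \<Rightarrow> complex set" where
  "deformed_lattice \<tau> s =
     {\<omega>\<^sup>2 * of_real (cmod \<omega> powr (2 * s)) | \<omega>. \<omega> \<in> period_lattice \<tau> - {0}}"

text \<open>
  The elementary symmetric functions of the reciprocals of a possibly infinite set: as usual, each
  monomial is counted once, so the (unconditional) sum runs over unordered \<open>k\<close>-tuples of distinct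
  elements, that is, over subsets of cardinality \<open>k\<close>.
\<close>

definition recip_subsets :: "nat \<Rightarrow> complex set \<Rightarrow> complex set set" where
  "recip_subsets k X = {A. A \<subseteq> X \<and> finite A \<and> card A = k}"

definition elem_sym_recip :: "nat \<Rightarrow> complex set \<Rightarrow> complex" where
  "elem_sym_recip k X = (\<Sum>\<^sub>\<infinity>A\<in>recip_subsets k X. \<Prod>\<omega>\<in>A. 1 / \<omega>)"

definition elem_sym_lattice :: "nat \<Rightarrow> complex \<Rightarrow> complex" where
  "elem_sym_lattice k \<tau> =
     Lim (at_right 0) (\<lambda>s. elem_sym_recip k (deformed_lattice \<tau> s))"

text \<open>The convention for \<open>k = 0\<close> is a consequence of the general definition.\<close>

lemma elem_sym_recip_0: "elem_sym_recip 0 X = 1"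
proof -
  have "recip_subsets 0 X = {{}}"
    by (auto simp: recip_subsets_def)
  then show ?thesis
    by (simp add: elem_sym_recip_def)
qed

lemma elem_sym_lattice_0: "elem_sym_lattice 0 \<tau> = 1"
  unfolding elem_sym_lattice_def elem_sym_recip_0
  by (intro tendsto_Lim) auto

text \<open>The last conjunct says that the degree in \<open>1 / Im \<tau>\<close> is exactly \<open>p\<close>.\<close>

definition almost_holomorphic_modular_form ::
    "int \<Rightarrow> nat \<Rightarrow> (complex \<Rightarrow> complex) \<Rightarrow> bool" where
  "almost_holomorphic_modular_form k p f \<longleftrightarrow>
     (\<forall>a b c d :: int. a * d - b * c = 1 \<longrightarrow>
        (\<forall>\<tau>\<in>upper_half_plane.
           f ((of_int a * \<tau> + of_int b) / (of_int c * \<tau> + of_int d)) =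
             (of_int c * \<tau> + of_int d) powi k * f \<tau>)) \<and>
     (\<exists>h :: nat \<Rightarrow> complex \<Rightarrow> complex.
        (\<forall>j\<le>p. h j holomorphic_on upper_half_plane) \<and>
        (\<forall>\<tau>\<in>upper_half_plane. f \<tau> = (\<Sum>j\<le>p. h j \<tau> * (1 / of_real (Im \<tau>)) ^ j)) \<and>
        (\<exists>\<tau>\<in>upper_half_plane. h p \<tau> \<noteq> 0))"

definition wirtinger_bar :: "(complex \<Rightarrow> complex) \<Rightarrow> complex \<Rightarrow> complex" where
  "wirtinger_bar f \<tau> =
     (frechet_derivative f (at \<tau>) 1 + \<i> * frechet_derivative f (at \<tau>) \<i>) / 2"

definition lowering_operator :: "(complex \<Rightarrow> complex) \<Rightarrow> complex \<Rightarrow> complex" where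
  "lowering_operator f \<tau> = - 2 * \<i> * of_real (Im \<tau>) ^ 2 * wirtinger_bar f \<tau>"

definition holomorphic2_on :: "(complex \<Rightarrow> complex \<Rightarrow> complex) \<Rightarrow> (complex \<times> complex) set \<Rightarrow> bool" where
  "holomorphic2_on \<phi> S \<longleftrightarrow>
     (\<forall>p\<in>S. \<exists>a b. ((\<lambda>(z, \<tau>). \<phi> z \<tau>) has_derivative (\<lambda>(x, y). a * x + b * y)) (at p within S))"

text \<open>
  The exponents of \<open>\<zeta>\<close> in the Fourier expansion lie in \<open>m + \<int>\<close> because of the factor
  \<open>(-1) ^ (2 * m * \<mu>)\<close> in the elliptic transformation law. A finite-order pole in \<open>\<tau>\<close> at the cusp
  means that the expansion starts at some \<open>n\<^sub>0\<close>, possibly negative. These are the Jacobi forms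
  without poles in \<open>\<complex> \<times> \<H>\<close>; there a Fourier expansion is valid for all \<open>z\<close> and \<open>\<tau>\<close>.
\<close>

definition jacobi_form :: "int \<Rightarrow> real \<Rightarrow> (complex \<Rightarrow> complex \<Rightarrow> complex) \<Rightarrow> bool" where
  "jacobi_form k m \<phi> \<longleftrightarrow>
     m > 0 \<and> 2 * m \<in> \<nat> \<and>
     holomorphic2_on \<phi> (UNIV \<times> upper_half_plane) \<and>
     (\<forall>a b c d :: int. a * d - b * c = 1 \<longrightarrow>
        (\<forall>z. \<forall>\<tau>\<in>upper_half_plane.
           \<phi> (z / (of_int c * \<tau> + of_int d))
             ((of_int a * \<tau> + of_int b) / (of_int c * \<tau> + of_int d)) =
             (of_int c * \<tau> + of_int d) powi k *
             exp (2 * of_real pi * \<i> * of_real m * of_int c * z\<^sup>2 / (of_int c * \<tau> + of_int d)) * \<phi> z \<tau>)) \<and>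
     (\<exists>\<epsilon>\<in>{0, 1 :: int}. \<forall>l \<mu> :: int. \<forall>z. \<forall>\<tau>\<in>upper_half_plane.
        \<phi> (z + of_int l * \<tau> + of_int \<mu>) \<tau> =
          (- 1) powi (\<lfloor>2 * m\<rfloor> * \<mu> + l * \<epsilon>) *
          exp (- 2 * of_real pi * \<i> * of_real m * ((of_int l)\<^sup>2 * \<tau> + 2 * of_int l * z)) * \<phi> z \<tau>) \<and>
     (\<exists>(c :: int \<Rightarrow> real \<Rightarrow> complex) n\<^sub>0. \<forall>z. \<forall>\<tau>\<in>upper_half_plane.
        ((\<lambda>(n, r). c n r * exp (2 * of_real pi * \<i> * (of_int n * \<tau> + of_real r * z)))
           has_sum \<phi> z \<tau>) ({n\<^sub>0..} \<times> {r. r - m \<in> \<int>}))"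

definition lattice_jacobi :: "complex \<Rightarrow> complex \<Rightarrow> complex" where
  "lattice_jacobi z \<tau> =
     exp (- (of_real pi * z\<^sup>2) / (2 * of_real (Im \<tau>))) *
     (\<Sum>k. (- 1) ^ k * elem_sym_lattice k \<tau> * z ^ (2 * k + 1))"

end

theory Submission
  imports Defs "HOL-Complex_Analysis.Complex_Analysis"
begin

text \<open>
  Write \<open>p\<^sub>j(s)\<close> for the power sums of the reciprocals of \<open>\<Lambda>\<^sub>\<tau>(s)\<close>. As \<open>\<omega>\<close> and \<open>-\<omega>\<close> give the same
  element, these are sums over a half lattice. For \<open>j \<ge> 2\<close> the limit \<open>s \<rightarrow> 0\<close> is the holomorphic
  Eisenstein sum; for \<open>j = 1\<close> Hecke's trick gives the Eisenstein-ordered sum \<open>E\<close> minus \<open>\<pi> / (2 v)\<close>.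
  Newton's identities, which make \<open>e\<^sub>k\<close> a polynomial in the power sums, transport the limit to
  \<open>e\<^sub>k\<close>, and the shift of \<open>p\<^sub>1\<close> by \<open>- \<pi> / (2 v)\<close> multiplies the generating function of the \<open>e\<^sub>k\<close> by
  an exponential; this exhibits \<open>e\<^sub>k\<close> as a polynomial in \<open>1 / v\<close> and yields the action of the
  lowering operator. The exponential prefactor of \<open>\<phi>\<close> cancels this shift, so that \<open>\<phi>(z; \<tau>) = z exp
  (- E z\<^sup>2 - \<Sum>\<^sub>j\<^sub>\<ge>\<^sub>2 p\<^sub>j(0) z\<^sup>2\<^sup>j / j)\<close>, which is the Eisenstein-ordered product of the factors \<open>1 -
  z\<^sup>2 / \<omega>\<^sup>2\<close> and hence, by Euler's product row by row, equal to \<open>sin (\<pi> z) / \<pi> \<Prod>\<^sub>m\<^sub>\<ge>\<^sub>1 (1 - sin\<^sup>2 (\<pi>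
  z) / sin\<^sup>2 (\<pi> m \<tau>))\<close>. The elliptic law is read off from the product, the Fourier expansion from
  its expansion in powers of \<open>sin\<^sup>2 (\<pi> z)\<close> with coefficients holomorphic in \<open>q\<close>, and the modular law
  from the homogeneity of the \<open>e\<^sub>k\<close>.
\<close>

subsection \<open>Elementary symmetric functions of summable families\<close>

text \<open>At \<open>s = 0\<close> the reciprocals of the squared lattice points are not absolutely
  summable, so the limit of e_k cannot be taken term by term. Newton's identities confine this
  failure to the first power sum; every other one is dominated. For that one, each row is compared
  with an integral: row \<open>m\<close> leaves a multiple of \<open>s (m v)^(-1-2s)\<close>, and
  the sum over \<open>m\<close> is \<open>s zeta(1+2s)\<close>, with limit 1/2, times twice an
  integral over a half line with limit \<open>pi / 2\<close>. The logarithms of the factors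
  \<open>1 - z^2 / w^2\<close> have convergent series only for \<open>z\<close> smaller than all
  nonzero lattice points, so product and exponential are compared near \<open>z = 0\<close>; as the
  product is entire in \<open>z\<close>, its Taylor coefficients carry the identity to all
  \<open>z\<close>. The comparison is also used backwards: its \<open>z^3\<close> coefficient writes
  \<open>E\<close> as a Lambert series and so shows that \<open>E\<close> is holomorphic in
  \<open>\<tau>\<close>. One estimate recurs: a sum over finite subsets is at most the product of
  the \<open>1 + |f|\<close>, hence at most the exponential of the sum of the \<open>|f|\<close>. It
  yields summability, entire generating functions and the bounds for the Fourier
  coefficients.\<close>

lemma tendsto_infsum_dominated:
  fixes f :: "'a \<Rightarrow> 'b \<Rightarrow> 'c :: banach"
  assumes lim: "\<And>x. x \<in> X \<Longrightarrow> ((\<lambda>s. f x s) \<longlongrightarrow> g x) F"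
    and bound: "\<forall>\<^sub>F s in F. \<forall>x\<in>X. norm (f x s) \<le> M x"
    and M: "M summable_on X" and F: "F \<noteq> bot"
  shows "((\<lambda>x. norm (g x)) summable_on X) \<and> ((\<lambda>s. \<Sum>\<^sub>\<infinity>x\<in>X. f x s) \<longlongrightarrow> (\<Sum>\<^sub>\<infinity>x\<in>X. g x)) F"
proof -
  have gM: "norm (g x) \<le> M x" if "x \<in> X" for x
    by (rule tendsto_upperbound[OF tendsto_norm[OF lim[OF that]]])
       (use bound that F in \<open>auto elim: eventually_mono\<close>)
  have gs: "(\<lambda>x. norm (g x)) summable_on X"
    by (rule Infinite_Sum.abs_summable_on_comparison_test'[OF M gM])
  have "((\<lambda>s. \<Sum>\<^sub>\<infinity>x\<in>X. f x s) \<longlongrightarrow> (\<Sum>\<^sub>\<infinity>x\<in>X. g x)) F"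
  proof (rule tendstoI)
    fix e :: real assume e: "e > 0"
    \<comment> \<open>The majorant is valid only eventually in \<open>s\<close>, so the M-test runs
      over the set of those functions that obey it, with the limit \<open>g\<close> adjoined,
      instead of over the values of \<open>s\<close>.\<close>
    define G where "G = insert g {f' s |s f'. f' = (\<lambda>s x. f x s) \<and> (\<forall>x\<in>X. norm (f x s) \<le> M x)}"
    have "uniform_limit G (\<lambda>Y h. \<Sum>x\<in>Y. h x) (\<lambda>h. \<Sum>\<^sub>\<infinity>x\<in>X. h x) (finite_subsets_at_top X)"
      by (rule Weierstrass_m_test_general[OF _ M]) (auto simp: G_def gM)
    then have "\<forall>\<^sub>F Y in finite_subsets_at_top X. \<forall>h\<in>G. dist (\<Sum>x\<in>Y. h x) (\<Sum>\<^sub>\<infinity>x\<in>X. h x) < e/3"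
      using e unfolding uniform_limit_iff by (meson zero_less_divide_iff zero_less_numeral)
    then obtain Y where Y: "finite Y" "Y \<subseteq> X" and
      d: "\<And>h. h \<in> G \<Longrightarrow> dist (\<Sum>x\<in>Y. h x) (\<Sum>\<^sub>\<infinity>x\<in>X. h x) < e/3"
      unfolding eventually_finite_subsets_at_top by (metis order_refl)
    have "((\<lambda>s. \<Sum>x\<in>Y. f x s) \<longlongrightarrow> (\<Sum>x\<in>Y. g x)) F"
      using Y by (intro tendsto_sum lim) auto
    then have "\<forall>\<^sub>F s in F. dist (\<Sum>x\<in>Y. f x s) (\<Sum>x\<in>Y. g x) < e/3"
      using e by (intro tendstoD) auto
    with bound show "\<forall>\<^sub>F s in F. dist (\<Sum>\<^sub>\<infinity>x\<in>X. f x s) (\<Sum>\<^sub>\<infinity>x\<in>X. g x) < e"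
    proof eventually_elim
      case (elim s)
      have "(\<lambda>x. f x s) \<in> G" using elim(1) by (auto simp: G_def)
      from d[OF this] have "dist (\<Sum>\<^sub>\<infinity>x\<in>X. f x s) (\<Sum>x\<in>Y. f x s) < e/3"
        by (simp add: dist_commute)
      moreover have "dist (\<Sum>x\<in>Y. g x) (\<Sum>\<^sub>\<infinity>x\<in>X. g x) < e/3"
        by (rule d) (simp add: G_def)
      ultimately show ?case using elim(2) by (blast intro: dist_triangle_third)
    qed
  qed
  with gs show ?thesis by blast
qed

text \<open>A polymorphic \<open>recip_subsets\<close>: the Lambert terms are indexed by natural
  numbers. Correspondingly \<open>esym\<close> takes a family, in which values may repeat.\<close>

definition k_subsets :: "nat \<Rightarrow> 'a set \<Rightarrow> 'a set set" where
  "k_subsets k I = {A. A \<subseteq> I \<and> finite A \<and> card A = k}"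

definition esym :: "nat \<Rightarrow> ('a \<Rightarrow> complex) \<Rightarrow> 'a set \<Rightarrow> complex" where
  "esym k f I = (\<Sum>\<^sub>\<infinity>A\<in>k_subsets k I. \<Prod>i\<in>A. f i)"

lemma recip_subsets_eq_k_subsets: "recip_subsets = k_subsets"
  by (auto simp: recip_subsets_def k_subsets_def fun_eq_iff)

lemma elem_sym_recip_eq_esym: "elem_sym_recip k X = esym k (\<lambda>x. 1 / x) X"
  by (simp add: elem_sym_recip_def esym_def recip_subsets_eq_k_subsets)

lemma finite_k_subsets: "finite I \<Longrightarrow> finite (k_subsets k I)"
  unfolding k_subsets_def by (rule finite_subset[of _ "Pow I"]) auto

lemma k_subsets_0: "k_subsets 0 I = {{}}"
  by (auto simp: k_subsets_def)

lemma esym_0: "esym 0 f I = 1"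
  by (simp add: esym_def k_subsets_0)

lemma esym_finite: "finite I \<Longrightarrow> esym k f I = (\<Sum>A\<in>k_subsets k I. \<Prod>i\<in>A. f i)"
  by (simp add: esym_def finite_k_subsets)

text \<open>Every product over a subset occurs in the expansion of the product of the
  \<open>norm (f i) + 1\<close>, and \<open>1 + x \<le> exp x\<close>. The bound covers all
  cardinalities at once.\<close>

lemma sum_prod_subsets_le_exp:
  fixes f :: "'a \<Rightarrow> complex"
  assumes "(\<lambda>x. norm (f x)) summable_on I" "finite \<A>" "\<A> \<subseteq> {A. A \<subseteq> I \<and> finite A}"
  shows "(\<Sum>A\<in>\<A>. norm (\<Prod>i\<in>A. f i)) \<le> exp (\<Sum>\<^sub>\<infinity>i\<in>I. norm (f i))"
proof -
  define Y where "Y = \<Union>\<A>"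
  have Y: "finite Y" "Y \<subseteq> I" using assms by (auto simp: Y_def)
  have "(\<Sum>A\<in>\<A>. norm (\<Prod>i\<in>A. f i)) \<le> (\<Sum>A\<in>Pow Y. \<Prod>i\<in>A. norm (f i))"
    unfolding prod_norm[symmetric] using Y assms(2)
    by (intro sum_mono2) (auto simp: Y_def intro!: prod_nonneg)
  also have "\<dots> = (\<Prod>i\<in>Y. norm (f i) + 1)"
    using prod_add[OF Y(1), of "\<lambda>i. norm (f i)" "\<lambda>_. 1"] by simp
  also have "\<dots> \<le> (\<Prod>i\<in>Y. exp (norm (f i)))"
    by (intro prod_mono) (auto simp: add.commute intro: add_nonneg_nonneg)
  also have "\<dots> = exp (\<Sum>i\<in>Y. norm (f i))"
    using Y by (simp add: exp_sum)
  also have "\<dots> \<le> exp (\<Sum>\<^sub>\<infinity>i\<in>I. norm (f i))"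
    using finite_sum_le_infsum[OF assms(1) Y] by simp
  finally show ?thesis .
qed

lemma k_subsets_abs_summable:
  fixes f :: "'a \<Rightarrow> complex"
  assumes "(\<lambda>x. norm (f x)) summable_on I"
  shows "(\<lambda>A. norm (\<Prod>i\<in>A. f i)) summable_on k_subsets k I"
proof (rule nonneg_bdd_above_summable_on)
  show "bdd_above (sum (\<lambda>A. norm (\<Prod>i\<in>A. f i)) ` {F. F \<subseteq> k_subsets k I \<and> finite F})"
    by (rule bdd_aboveI2, rule sum_prod_subsets_le_exp[OF assms]) (auto simp: k_subsets_def)
qed auto

lemma norm_esym_le_exp:
  assumes "(\<lambda>x. norm (f x)) summable_on I"
  shows "norm (esym k f I) \<le> exp (\<Sum>\<^sub>\<infinity>i\<in>I. norm (f i))"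
proof -
  have "norm (esym k f I) \<le> (\<Sum>\<^sub>\<infinity>A\<in>k_subsets k I. norm (\<Prod>i\<in>A. f i))"
    unfolding esym_def by (rule norm_infsum_bound[OF k_subsets_abs_summable[OF assms]])
  also have "\<dots> \<le> exp (\<Sum>\<^sub>\<infinity>i\<in>I. norm (f i))"
    by (rule infsum_le_finite_sums[OF k_subsets_abs_summable[OF assms]])
       (auto simp: k_subsets_def intro!: sum_prod_subsets_le_exp[OF assms])
  finally show ?thesis .
qed

text \<open>Monotonicity in the moduli. The right-hand side is again an \<open>esym\<close>, so that
  the geometric bound applies to it when \<open>f\<close> is a Lambert family on a circle and
  \<open>g\<close> its majorant.\<close>

lemma norm_esym_le_esym_norm:
  assumes "\<And>i. i \<in> I \<Longrightarrow> norm (f i) \<le> g i" "g summable_on I"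
  shows "norm (esym k f I) \<le> norm (esym k (\<lambda>i. complex_of_real (g i)) I)"
proof -
  have nn: "0 \<le> g i" if "i \<in> I" for i using assms(1)[OF that] norm_ge_zero order.trans by blast
  have f: "(\<lambda>x. norm (f x)) summable_on I" by (rule Infinite_Sum.abs_summable_on_comparison_test'[OF assms(2,1)])
  have g: "(\<lambda>i. norm (complex_of_real (g i))) summable_on I"
    using Infinite_Sum.abs_summable_on_comparison_test'[OF assms(2), of "\<lambda>i. complex_of_real (g i)"] nn by simp
  have eq: "norm (\<Prod>i\<in>A. complex_of_real (g i)) = (\<Prod>i\<in>A. g i)" if "A \<in> k_subsets k I" for A
    using nn that by (auto simp: k_subsets_def prod_norm[symmetric] subset_iff intro!: prod.cong)
  have gsum: "(\<lambda>A. \<Prod>i\<in>A. g i) summable_on k_subsets k I"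
    using k_subsets_abs_summable[OF g, of k] by (simp add: eq cong: summable_on_cong)
  have "norm (esym k f I) \<le> (\<Sum>\<^sub>\<infinity>A\<in>k_subsets k I. norm (\<Prod>i\<in>A. f i))"
    unfolding esym_def by (rule norm_infsum_bound[OF k_subsets_abs_summable[OF f]])
  also have "\<dots> \<le> (\<Sum>\<^sub>\<infinity>A\<in>k_subsets k I. norm (\<Prod>i\<in>A. complex_of_real (g i)))"
    using nn assms(1)
    by (intro infsum_mono k_subsets_abs_summable f g)
       (auto simp: k_subsets_def prod_norm[symmetric] subset_iff intro!: prod_mono)
  also have "\<dots> = (\<Sum>\<^sub>\<infinity>A\<in>k_subsets k I. (\<Prod>i\<in>A. g i))"
    by (intro infsum_cong eq)
  also have "\<dots> = norm (complex_of_real (\<Sum>\<^sub>\<infinity>A\<in>k_subsets k I. (\<Prod>i\<in>A. g i)))"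
    unfolding norm_of_real using nn
    by (intro abs_of_nonneg[symmetric] infsum_nonneg prod_nonneg) (auto simp: k_subsets_def)
  also have "complex_of_real (\<Sum>\<^sub>\<infinity>A\<in>k_subsets k I. (\<Prod>i\<in>A. g i)) = esym k (\<lambda>i. complex_of_real (g i)) I"
    unfolding esym_def of_real_prod[symmetric]
    by (rule infsumI[OF has_sum_of_real[OF has_sum_infsum[OF gsum]], symmetric])
  finally show ?thesis .
qed

lemma esym_scale: "esym k (\<lambda>i. c * f i) I = c ^ k * esym k f I"
proof -
  have "esym k (\<lambda>i. c * f i) I = (\<Sum>\<^sub>\<infinity>A\<in>k_subsets k I. c ^ k * (\<Prod>i\<in>A. f i))"
    unfolding esym_def by (intro infsum_cong) (auto simp: k_subsets_def prod.distrib)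
  then show ?thesis by (simp add: esym_def infsum_cmult_right')
qed

text \<open>By homogeneity the exponential bound may be used for the family scaled by
  \<open>Y\<close>. As \<open>Y\<close> is arbitrary, the power series with coefficients
  \<open>esym k f I\<close> is entire.\<close>

lemma norm_esym_power_le_exp:
  assumes "(\<lambda>x. norm (f x)) summable_on I" "Y \<ge> 0"
  shows "norm (esym k f I) * Y ^ k \<le> exp (Y * (\<Sum>\<^sub>\<infinity>i\<in>I. norm (f i)))"
proof -
  have "(\<lambda>i. norm (of_real Y * f i)) summable_on I"
    using summable_on_cmult_right[OF assms(1), of Y] assms(2) by (simp add: norm_mult)
  from norm_esym_le_exp[OF this, of k] assms(2) show ?thesis
    by (simp add: esym_scale norm_mult norm_power infsum_cmult_right' mult.commute)
qed

text \<open>Reduces identities between elementary symmetric functions to finite families: finitely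
  many \<open>k\<close>-subsets of \<open>I\<close> all lie in one finite subset of
  \<open>I\<close>, namely their union.\<close>

lemma tendsto_esym_finite_subsets:
  assumes "(\<lambda>x. norm (f x)) summable_on I"
  shows "((\<lambda>Y. esym k f Y) \<longlongrightarrow> esym k f I) (finite_subsets_at_top I)"
proof -
  have "((\<lambda>Y. \<Sum>A\<in>k_subsets k Y. \<Prod>i\<in>A. f i) \<longlongrightarrow> esym k f I) (finite_subsets_at_top I)"
  proof (rule filterlim_compose[of "sum (\<lambda>A. \<Prod>i\<in>A. f i)" _ "finite_subsets_at_top (k_subsets k I)"])
    have "(\<lambda>A. \<Prod>i\<in>A. f i) summable_on k_subsets k I"
      by (rule abs_summable_summable[OF k_subsets_abs_summable[OF assms]])
    then show "(sum (\<lambda>A. \<Prod>i\<in>A. f i) \<longlongrightarrow> esym k f I) (finite_subsets_at_top (k_subsets k I))"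
      unfolding esym_def by (rule infsum_tendsto)
    show "filterlim (k_subsets k) (finite_subsets_at_top (k_subsets k I)) (finite_subsets_at_top I)"
      unfolding filterlim_finite_subsets_at_top
    proof (intro allI impI)
      fix X assume X: "finite X \<and> X \<subseteq> k_subsets k I"
      then have "finite (\<Union>X)" "\<Union>X \<subseteq> I" by (auto simp: k_subsets_def)
      then show "\<forall>\<^sub>F Y in finite_subsets_at_top I. finite (k_subsets k Y) \<and> X \<subseteq> k_subsets k Y
        \<and> k_subsets k Y \<subseteq> k_subsets k I"
        using X unfolding eventually_finite_subsets_at_top
        by (intro exI[of _ "\<Union>X"]) (auto simp: finite_k_subsets, auto simp: k_subsets_def)
    qed
  qed
  then show ?thesis
    by (rule Lim_transform_eventually)
       (auto simp: esym_finite intro!: eventually_finite_subsets_at_top_weakI)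
qed

lemma esym_insert:
  assumes "finite I" "a \<notin> I"
  shows "esym (Suc k) f (insert a I) = esym (Suc k) f I + f a * esym k f I"
proof -
  have eq: "k_subsets (Suc k) (insert a I) = k_subsets (Suc k) I \<union> insert a ` k_subsets k I"
  proof (intro equalityI subsetI)
    fix A assume A: "A \<in> k_subsets (Suc k) (insert a I)"
    show "A \<in> k_subsets (Suc k) I \<union> insert a ` k_subsets k I"
    proof (cases "a \<in> A")
      case True
      then have "A = insert a (A - {a})" "A - {a} \<in> k_subsets k I"
        using A by (auto simp: k_subsets_def)
      then show ?thesis by blast
    qed (use A in \<open>auto simp: k_subsets_def\<close>)
  qed (use assms in \<open>auto simp: k_subsets_def card_insert_if subset_iff\<close>)
  have "esym (Suc k) f (insert a I) = esym (Suc k) f I + (\<Sum>A\<in>insert a ` k_subsets k I. \<Prod>i\<in>A. f i)"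
    using assms unfolding esym_finite[OF assms(1)] esym_finite[OF finite.insertI[OF assms(1)]] eq
    by (intro sum.union_disjoint) (auto simp: finite_k_subsets, auto simp: k_subsets_def)
  also have "(\<Sum>A\<in>insert a ` k_subsets k I. \<Prod>i\<in>A. f i) = (\<Sum>A\<in>k_subsets k I. \<Prod>i\<in>insert a A. f i)"
    using assms by (intro sum.reindex[unfolded o_def]) (auto simp: inj_on_def k_subsets_def)
  also have "\<dots> = (\<Sum>A\<in>k_subsets k I. f a * (\<Prod>i\<in>A. f i))"
    using assms by (intro sum.cong refl prod.insert) (auto simp: k_subsets_def)
  finally show ?thesis using assms by (simp add: esym_finite sum_distrib_left)
qed

lemma prod_one_plus_eq_sum_esym:
  assumes "finite I"
  shows "(\<Prod>i\<in>I. 1 + y * f i) = (\<Sum>k. esym k f I * y ^ k)"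
    and "(\<lambda>k. esym k f I * y ^ k) sums (\<Prod>i\<in>I. 1 + y * f i)"
proof -
  have fin: "finite (Pow I)" using assms by simp
  have z: "esym k f I = 0" if "k \<notin> {..card I}" for k
  proof -
    have "k_subsets k I = {}" using that assms by (auto simp: k_subsets_def dest: card_mono[OF assms])
    then show ?thesis by (simp add: esym_def)
  qed
  have "(\<Prod>i\<in>I. 1 + y * f i) = (\<Sum>A\<in>Pow I. \<Prod>i\<in>A. y * f i)"
    using prod_add[OF assms, of "\<lambda>i. y * f i" "\<lambda>_. 1"] by (simp add: add.commute)
  also have "\<dots> = (\<Sum>k\<in>{..card I}. \<Sum>A\<in>{A\<in>Pow I. card A = k}. \<Prod>i\<in>A. y * f i)"
    using assms by (intro sum.group[symmetric]) (auto intro: card_mono)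
  also have "\<dots> = (\<Sum>k\<in>{..card I}. esym k f I * y ^ k)"
  proof (intro sum.cong refl)
    fix k
    have "{A\<in>Pow I. card A = k} = k_subsets k I"
      using assms by (auto simp: k_subsets_def intro: finite_subset)
    then show "(\<Sum>A\<in>{A\<in>Pow I. card A = k}. \<Prod>i\<in>A. y * f i) = esym k f I * y ^ k"
      using assms esym_scale[of k y f I] by (simp add: esym_finite mult.commute)
  qed
  finally have eq: "(\<Prod>i\<in>I. 1 + y * f i) = (\<Sum>k\<in>{..card I}. esym k f I * y ^ k)" .
  show s: "(\<lambda>k. esym k f I * y ^ k) sums (\<Prod>i\<in>I. 1 + y * f i)"
    unfolding eq by (rule sums_finite) (auto simp: z)
  then show "(\<Prod>i\<in>I. 1 + y * f i) = (\<Sum>k. esym k f I * y ^ k)" by (simp add: sums_iff)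
qed

text \<open>
  Replacing \<open>Y\<close> by \<open>2 Y\<close> in the exponential bound gives geometric decay.
\<close>

lemma norm_esym_power_le_geometric:
  assumes "(\<lambda>x. norm (f x)) summable_on I" "norm y \<le> Y"
  shows "norm (esym k f I * y ^ k) \<le> exp (2 * Y * (\<Sum>\<^sub>\<infinity>i\<in>I. norm (f i))) * (1/2) ^ k"
proof -
  have Y: "0 \<le> Y" using assms(2) norm_ge_zero order.trans by blast
  have "norm (esym k f I * y ^ k) \<le> norm (esym k f I) * Y ^ k"
    using assms(2) by (auto simp: norm_mult norm_power intro!: mult_left_mono power_mono)
  also have "\<dots> = norm (esym k f I) * (2 * Y) ^ k * (1/2) ^ k"
    by (simp add: power_mult_distrib power_divide)
  also have "\<dots> \<le> exp (2 * Y * (\<Sum>\<^sub>\<infinity>i\<in>I. norm (f i))) * (1/2) ^ k"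
    using norm_esym_power_le_exp[OF assms(1), of "2 * Y" k] Y by (intro mult_right_mono) auto
  finally show ?thesis .
qed

text \<open>Tannery's theorem: the geometric majorant, taken with the sum of norms over all of
  \<open>{1..}\<close>, bounds the terms of every partial product.\<close>

lemma prod_one_plus_tendsto_esym_series:
  fixes f :: "nat \<Rightarrow> complex"
  assumes f: "(\<lambda>x. norm (f x)) summable_on {1..}"
  shows "(\<lambda>M. \<Prod>m=1..M. 1 + y * f m) \<longlonglongrightarrow> (\<Sum>k. esym k f {1..} * y ^ k)"
proof -
  have lim: "filterlim (\<lambda>M. {1..M}) (finite_subsets_at_top {1..}) (sequentially :: nat filter)"
    unfolding filterlim_finite_subsets_at_top
  proof (intro allI impI)
    fix X :: "nat set" assume "finite X \<and> X \<subseteq> {1..}"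
    then show "\<forall>\<^sub>F M in sequentially. finite {1..M} \<and> X \<subseteq> {1..M} \<and> {1..M} \<subseteq> {1..}"
      by (intro eventually_mono[OF eventually_ge_at_top[of "Max (insert 0 X)"]]) auto
  qed
  let ?C = "exp (2 * norm y * (\<Sum>\<^sub>\<infinity>i\<in>{1..}. norm (f i)))"
  have b: "norm (esym k f {1..M} * y ^ k) \<le> ?C * (1/2) ^ k" for k M
  proof -
    have "norm (esym k f {1..M} * y ^ k) \<le> exp (2 * norm y * (\<Sum>\<^sub>\<infinity>i\<in>{1..M}. norm (f i))) * (1/2) ^ k"
      by (rule norm_esym_power_le_geometric) auto
    also have "\<dots> \<le> ?C * (1/2)^k"
      using finite_sum_le_infsum[OF f, of "{1..M}"] by (intro mult_right_mono) (auto intro!: mult_left_mono)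
    finally show ?thesis .
  qed
  have "(\<lambda>M. \<Sum>k. esym k f {1..M} * y ^ k) \<longlonglongrightarrow> (\<Sum>k. esym k f {1..} * y ^ k)"
    by (intro conjunct2[OF conjunct2[OF tannerys_theorem[where M = "\<lambda>k. ?C * (1/2)^k"]]])
       (use b in \<open>auto intro!: tendsto_intros summable_mult summable_geometric always_eventually
          filterlim_compose[OF tendsto_esym_finite_subsets[OF f] lim, simplified]\<close>)
  then show ?thesis by (simp add: prod_one_plus_eq_sum_esym)
qed

subsection \<open>Newton's identities\<close>

text \<open>Newton's identities as a recursion; the summand \<open>i\<close> carries the power sum
  of index \<open>i + 1\<close>. The value at \<open>k\<close> is a polynomial in the first
  \<open>k\<close> power sums, which is why limits and holomorphy pass to it by induction.\<close>

fun newton :: "(nat \<Rightarrow> complex) \<Rightarrow> nat \<Rightarrow> complex" where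
  "newton p 0 = 1"
| "newton p (Suc k) = (\<Sum>i\<le>k. (-1) ^ i * p (Suc i) * newton p (k - i)) / of_nat (Suc k)"

declare newton.simps [simp del]

lemma newton_Suc: "of_nat (Suc k) * newton p (Suc k) = (\<Sum>i\<le>k. (-1) ^ i * p (Suc i) * newton p (k - i))"
  unfolding newton.simps(2) by (simp del: of_nat_Suc)

lemma newton_unique:
  assumes "c 0 = 1"
    and "\<And>k. of_nat (Suc k) * c (Suc k) = (\<Sum>i\<le>k. (-1) ^ i * p (Suc i) * c (k - i))"
  shows "c k = newton p k"
proof (induction k rule: less_induct)
  case (less k)
  show ?case
  proof (cases k)
    case (Suc n)
    have "of_nat (Suc n) * c (Suc n) = of_nat (Suc n) * newton p (Suc n)"
      unfolding assms(2) newton_Suc using less Suc by (intro sum.cong) auto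
    then show ?thesis using Suc by (metis mult_cancel_left of_nat_eq_0_iff nat.distinct(1))
  qed (simp add: assms newton.simps)
qed

lemma tendsto_newton:
  assumes "\<And>i. i \<ge> 1 \<Longrightarrow> ((\<lambda>s. p s i) \<longlongrightarrow> q i) F"
  shows "((\<lambda>s. newton (p s) k) \<longlongrightarrow> newton q k) F"
proof (induction k rule: less_induct)
  case (less k)
  show ?case
  proof (cases k)
    case (Suc n)
    show ?thesis unfolding Suc newton.simps
      using Suc by (intro tendsto_intros assms less) (auto simp del: of_nat_Suc)
  qed (simp add: newton.simps)
qed

lemma holomorphic_newton:
  assumes "\<And>i. i \<ge> 1 \<Longrightarrow> (\<lambda>x. p x i) holomorphic_on S"
  shows "(\<lambda>x. newton (p x) k) holomorphic_on S"
proof (induction k rule: less_induct)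
  case (less k)
  show ?case
  proof (cases k)
    case (Suc n)
    show ?thesis unfolding Suc newton.simps
      using Suc by (intro holomorphic_intros assms less) (auto simp del: of_nat_Suc)
  qed (simp add: newton.simps)
qed

text \<open>The recursion is a linear differential equation: the generating function has the signed
  power sums as its logarithmic derivative. Multiplying series then corresponds to adding power
  sums.\<close>

lemma fps_newton_unique:
  assumes "fps_nth F 0 = 1" "fps_deriv F = Abs_fps (\<lambda>i. (-1) ^ i * p (Suc i)) * F"
  shows "F = Abs_fps (newton p)"
proof (rule fps_ext)
  fix k
  have "fps_nth F k = newton p k"
  proof (rule newton_unique)
    fix k
    have "of_nat (Suc k) * fps_nth F (Suc k) = fps_nth (fps_deriv F) k" by simp
    also have "\<dots> = (\<Sum>i\<le>k. (-1) ^ i * p (Suc i) * fps_nth F (k - i))"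
      unfolding assms(2) by (simp add: fps_mult_nth atLeast0AtMost)
    finally show "of_nat (Suc k) * fps_nth F (Suc k) = (\<Sum>i\<le>k. (-1) ^ i * p (Suc i) * fps_nth F (k - i))" .
  qed (simp add: assms)
  then show "fps_nth F k = fps_nth (Abs_fps (newton p)) k" by simp
qed

lemma fps_deriv_newton:
  "fps_deriv (Abs_fps (newton p)) = Abs_fps (\<lambda>i. (-1) ^ i * p (Suc i)) * Abs_fps (newton p)"
proof (rule fps_ext)
  fix n
  have "fps_nth (fps_deriv (Abs_fps (newton p))) n = of_nat (Suc n) * newton p (Suc n)"
    by simp
  then show "fps_nth (fps_deriv (Abs_fps (newton p))) n =
      fps_nth (Abs_fps (\<lambda>i. (-1) ^ i * p (Suc i)) * Abs_fps (newton p)) n"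
    unfolding newton_Suc by (simp add: fps_mult_nth atLeast0AtMost)
qed

text \<open>Only the constant term of the logarithmic derivative changes, by \<open>t\<close>, and
  \<open>t\<close> is the logarithmic derivative of \<open>fps_exp t\<close>.\<close>

lemma fps_newton_shift:
  assumes "q 1 = p 1 + t" "\<And>i. i \<ge> 2 \<Longrightarrow> q i = p i"
  shows "Abs_fps (newton q) = fps_exp t * Abs_fps (newton p)"
proof (rule fps_newton_unique[symmetric])
  have "Abs_fps (\<lambda>i. (-1) ^ i * q (Suc i)) = fps_const t + Abs_fps (\<lambda>i. (-1) ^ i * p (Suc i))"
  proof (rule fps_ext)
    fix n show "fps_nth (Abs_fps (\<lambda>i. (-1) ^ i * q (Suc i))) n = fps_nth (fps_const t + Abs_fps (\<lambda>i.
      (-1) ^ i * p (Suc i))) n"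
      using assms by (cases n) auto
  qed
  then show "fps_deriv (fps_exp t * Abs_fps (newton p)) =
      Abs_fps (\<lambda>i. (-1) ^ i * q (Suc i)) * (fps_exp t * Abs_fps (newton p))"
    by (simp only: fps_deriv_mult fps_exp_deriv fps_deriv_newton ring_distribs mult_ac add_ac)
qed (simp add: newton.simps(1))

lemma newton_shift:
  assumes "q 1 = p 1 + t" "\<And>i. i \<ge> 2 \<Longrightarrow> q i = p i"
  shows "newton q k = (\<Sum>j\<le>k. t ^ j / fact j * newton p (k - j))"
  using arg_cong[OF fps_newton_shift[of q p t, OF assms], of "\<lambda>F. fps_nth F k"]
  unfolding fps_mult_nth by (simp add: atLeast0AtMost)

lemma newton_esym_finite:
  assumes "finite I"
  shows "esym k f I = newton (\<lambda>j. \<Sum>i\<in>I. f i ^ j) k"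
proof -
  have "Abs_fps (\<lambda>k. esym k f I) = Abs_fps (newton (\<lambda>j. \<Sum>i\<in>I. f i ^ j))" using assms
  proof (induction I)
    case empty
    have "Abs_fps (\<lambda>k. esym k f {}) = 1"
    proof (rule fps_ext)
      fix n show "fps_nth (Abs_fps (\<lambda>k. esym k f {})) n = fps_nth 1 n"
        by (cases n) (simp add: esym_0, auto simp: esym_finite k_subsets_def)
    qed
    then show ?case by (intro fps_newton_unique) (simp_all add: esym_0 flip: fps_zero_def)
  next
    case (insert a I)
    let ?F = "Abs_fps (\<lambda>k. esym k f I)" and ?l = "1 + fps_const (f a) * fps_X"
    have eq: "Abs_fps (\<lambda>k. esym k f (insert a I)) = ?l * ?F"
    proof (rule fps_ext)
      fix n show "fps_nth (Abs_fps (\<lambda>k. esym k f (insert a I))) n = fps_nth (?l * ?F) n"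
        using insert(1,2) by (cases n) (auto simp: esym_0 esym_insert algebra_simps)
    qed
    \<comment> \<open>The logarithmic derivative of the linear factor \<open>1 + f a X\<close>, a
      geometric series; adding it passes from the power sums of \<open>I\<close> to those of
      \<open>insert a I\<close>.\<close>
    define g where "g = Abs_fps (\<lambda>n. (-1) ^ n * f a ^ Suc n)"
    have g: "g * ?l = fps_const (f a)"
    proof (rule fps_ext)
      fix n show "fps_nth (g * ?l) n = fps_nth (fps_const (f a)) n"
        by (cases n) (auto simp: g_def ring_distribs mult.assoc[symmetric])
    qed
    have sum: "Abs_fps (\<lambda>i. (-1) ^ i * (\<Sum>x\<in>insert a I. f x ^ Suc i)) =
        g + Abs_fps (\<lambda>i. (-1) ^ i * (\<Sum>x\<in>I. f x ^ Suc i))"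
      using insert(1,2) by (auto simp: fps_eq_iff g_def algebra_simps)
    show ?case unfolding eq
    proof (rule fps_newton_unique)
      have "fps_deriv (?l * ?F) = fps_const (f a) * ?F + ?l * fps_deriv ?F"
        by (simp add: algebra_simps)
      also have "\<dots> = g * ?l * ?F + ?l * (Abs_fps (\<lambda>i. (-1) ^ i * (\<Sum>x\<in>I. f x ^ Suc i)) * ?F)"
        by (simp only: g insert.IH fps_deriv_newton)
      finally show "fps_deriv (?l * ?F) =
          Abs_fps (\<lambda>i. (-1) ^ i * (\<Sum>x\<in>insert a I. f x ^ Suc i)) * (?l * ?F)"
        unfolding sum by (simp only: ring_distribs mult_ac add_ac)
    qed (simp add: esym_0)
  qed
  then show ?thesis by (metis fps_nth_Abs_fps)
qed

lemma power_abs_summable: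
  fixes f :: "'a \<Rightarrow> complex"
  assumes "(\<lambda>i. norm (f i)) summable_on I" "j \<ge> 1"
  shows "(\<lambda>i. norm (f i ^ j)) summable_on I"
proof -
  define C where "C = (\<Sum>\<^sub>\<infinity>i\<in>I. norm (f i))"
  have "(\<lambda>i. C ^ (j - 1) * norm (f i)) summable_on I"
    by (intro summable_on_cmult_right assms)
  then show ?thesis
  proof (rule Infinite_Sum.abs_summable_on_comparison_test')
    fix i assume i: "i \<in> I"
    have "norm (f i) \<le> C"
      unfolding C_def using finite_sum_le_infsum[OF assms(1), of "{i}"] i by simp
    then have "norm (f i) ^ (j - 1) * norm (f i) \<le> C ^ (j - 1) * norm (f i)"
      by (intro mult_right_mono power_mono) auto
    then show "norm (f i ^ j) \<le> C ^ (j - 1) * norm (f i)"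
      using assms(2) by (cases j) (auto simp: norm_mult norm_power mult.commute)
  qed
qed

lemma newton_esym:
  assumes "(\<lambda>i. norm (f i)) summable_on I"
  shows "esym k f I = newton (\<lambda>j. \<Sum>\<^sub>\<infinity>i\<in>I. f i ^ j) k"
proof (rule tendsto_unique)
  show "((\<lambda>Y. esym k f Y) \<longlongrightarrow> esym k f I) (finite_subsets_at_top I)"
    by (rule tendsto_esym_finite_subsets[OF assms])
  have "((\<lambda>Y. newton (\<lambda>j. \<Sum>i\<in>Y. f i ^ j) k) \<longlongrightarrow> newton (\<lambda>j. \<Sum>\<^sub>\<infinity>i\<in>I. f i ^ j) k) (finite_subsets_at_top I)"
    by (rule tendsto_newton, rule infsum_tendsto, rule abs_summable_summable, rule power_abs_summable[OF assms])
  then show "((\<lambda>Y. esym k f Y) \<longlongrightarrow> newton (\<lambda>j. \<Sum>\<^sub>\<infinity>i\<in>I. f i ^ j) k) (finite_subsets_at_top I)"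
    by (rule Lim_transform_eventually)
       (auto simp: newton_esym_finite intro!: eventually_finite_subsets_at_top_weakI)
qed simp

subsection \<open>Sums over a half lattice\<close>

text \<open>Weierstrass' theorem for unordered sums: the M-test runs along the finite subsets, and
  the majorant may change from ball to ball.\<close>

lemma holomorphic_infsum:
  fixes f :: "'a \<Rightarrow> complex \<Rightarrow> complex"
  assumes "open S" and hol: "\<And>x. x \<in> X \<Longrightarrow> f x holomorphic_on S"
    and dom: "\<And>z. z \<in> S \<Longrightarrow> \<exists>r>0. \<exists>M. cball z r \<subseteq> S \<and> M summable_on X \<and> (\<forall>x\<in>X. \<forall>w\<in>cball z r. norm (f x w) \<le> M x)"
  shows "(\<lambda>w. \<Sum>\<^sub>\<infinity>x\<in>X. f x w) holomorphic_on S"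
proof -
  have "(\<lambda>w. \<Sum>\<^sub>\<infinity>x\<in>X. f x w) field_differentiable at z" if z: "z \<in> S" for z
  proof -
    obtain r M where r: "r > 0" "cball z r \<subseteq> S" and M: "M summable_on X"
      and le: "\<And>x w. x \<in> X \<Longrightarrow> w \<in> cball z r \<Longrightarrow> norm (f x w) \<le> M x"
      using dom[OF z] by blast
    have "uniform_limit (cball z r) (\<lambda>Y w. \<Sum>x\<in>Y. f x w) (\<lambda>w. \<Sum>\<^sub>\<infinity>x\<in>X. f x w) (finite_subsets_at_top X)"
      by (rule Weierstrass_m_test_general[OF le M])
    moreover have "\<forall>\<^sub>F Y in finite_subsets_at_top X. continuous_on (cball z r) (\<lambda>w. \<Sum>x\<in>Y. f x w)
        \<and> (\<lambda>w. \<Sum>x\<in>Y. f x w) holomorphic_on ball z r"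
    proof (rule eventually_finite_subsets_at_top_weakI)
      fix Y assume Y: "finite Y" "Y \<subseteq> X"
      have "(\<lambda>w. \<Sum>x\<in>Y. f x w) holomorphic_on cball z r"
        using Y r by (intro holomorphic_on_sum holomorphic_on_subset[OF hol]) auto
      then show "continuous_on (cball z r) (\<lambda>w. \<Sum>x\<in>Y. f x w) \<and> (\<lambda>w. \<Sum>x\<in>Y. f x w) holomorphic_on ball z r"
        by (meson ball_subset_cball holomorphic_on_imp_continuous_on holomorphic_on_subset)
    qed
    ultimately have "(\<lambda>w. \<Sum>\<^sub>\<infinity>x\<in>X. f x w) holomorphic_on ball z r"
      using holomorphic_uniform_limit[of z r] finite_subsets_at_top_neq_bot by metis
    then show ?thesis
      using r(1) by (meson centre_in_ball holomorphic_on_imp_differentiable_at open_ball)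
  qed
  then show ?thesis by (meson field_differentiable_at_within holomorphic_on_def)
qed

text \<open>One representative of each pair of opposite nonzero lattice points. The first coordinate
  is the coefficient of \<open>\<tau>\<close>, the row, in contrast to
  \<open>period_lattice\<close>, which names the integer part first.\<close>

definition half_lattice :: "(int \<times> int) set" where
  "half_lattice = {(m, n). m > 0 \<or> m = 0 \<and> n > 0}"

definition lattice_point :: "complex \<Rightarrow> int \<times> int \<Rightarrow> complex" where
  "lattice_point \<tau> = (\<lambda>(m, n). of_int m * \<tau> + of_int n)"

text \<open>For \<open>w = m \<tau> + n\<close> the imaginary part gives
  \<open>|m| \<le> |w| / Im \<tau>\<close>, and \<open>|n| \<le> |w| + |m| |\<tau>|\<close>; the
  constant collects the factors of \<open>|w|\<close> in the sum of the two.\<close>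

definition lattice_const :: "complex \<Rightarrow> real" where
  "lattice_const \<tau> = 1 + (1 + cmod \<tau>) / Im \<tau>"

lemma lattice_const_ge_1: "Im \<tau> > 0 \<Longrightarrow> lattice_const \<tau> \<ge> 1"
  by (simp add: lattice_const_def)

lemma lattice_point_lower_bound:
  assumes "Im \<tau> > 0"
  shows "real_of_int (\<bar>m\<bar> + \<bar>n\<bar>) \<le> lattice_const \<tau> * cmod (lattice_point \<tau> (m, n))"
proof -
  let ?w = "of_int m * \<tau> + of_int n"
  have "\<bar>of_int m\<bar> * Im \<tau> = \<bar>Im ?w\<bar>"
    using assms by (simp add: abs_mult)
  also have "\<dots> \<le> cmod ?w" by (rule abs_Im_le_cmod)
  finally have m: "\<bar>of_int m\<bar> \<le> cmod ?w / Im \<tau>" using assms by (simp add: field_simps)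
  have "\<bar>real_of_int n\<bar> = cmod (?w - of_int m * \<tau>)" by simp
  also have "\<dots> \<le> cmod ?w + \<bar>of_int m\<bar> * cmod \<tau>"
    using norm_triangle_ineq4[of ?w "of_int m * \<tau>"] by (simp add: norm_mult)
  also have "\<dots> \<le> cmod ?w + cmod ?w / Im \<tau> * cmod \<tau>"
    using m by (intro add_left_mono mult_right_mono) auto
  finally have "\<bar>real_of_int n\<bar> \<le> cmod ?w + cmod ?w / Im \<tau> * cmod \<tau>" .
  with m have "\<bar>real_of_int m\<bar> + \<bar>real_of_int n\<bar> \<le> cmod ?w / Im \<tau> + (cmod ?w + cmod ?w / Im \<tau> * cmod \<tau>)"
    by linarith
  also have "\<dots> = lattice_const \<tau> * cmod ?w"
    by (simp add: lattice_const_def algebra_simps add_divide_distrib)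
  finally show ?thesis by (simp add: lattice_point_def)
qed

lemma inj_lattice_point: "Im \<tau> > 0 \<Longrightarrow> inj (lattice_point \<tau>)"
  by (auto simp: inj_def lattice_point_def complex_eq_iff)

lemma lattice_point_eq_0_iff: "Im \<tau> > 0 \<Longrightarrow> lattice_point \<tau> h = 0 \<longleftrightarrow> h = (0, 0)"
  using inj_eq[OF inj_lattice_point, of \<tau> h "(0,0)"] by (simp add: lattice_point_def)

lemma cmod_lattice_point_ge:
  assumes "Im \<tau> > 0" "h \<noteq> (0, 0)"
  shows "cmod (lattice_point \<tau> h) \<ge> 1 / lattice_const \<tau>"
proof -
  obtain m n where h: "h = (m, n)" by force
  have "1 \<le> real_of_int (\<bar>m\<bar> + \<bar>n\<bar>)" using assms(2) h by auto
  also have "\<dots> \<le> lattice_const \<tau> * cmod (lattice_point \<tau> (m, n))"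
    by (rule lattice_point_lower_bound[OF assms(1)])
  finally show ?thesis using h lattice_const_ge_1[OF assms(1)] by (simp add: field_simps)
qed

text \<open>The product form splits the double sum into two single ones and is free of
  \<open>\<tau>\<close>. The exponent \<open>a\<close> in each variable stands against
  \<open>|w|^(-2a)\<close>, so \<open>a > 1\<close> says that the modulus has exponent above
  2.\<close>

definition lattice_majorant :: "real \<Rightarrow> int \<times> int \<Rightarrow> real" where
  "lattice_majorant a = (\<lambda>(m, n). (1 + \<bar>real_of_int m\<bar>) powr - a * (1 + \<bar>real_of_int n\<bar>) powr - a)"

lemma summable_on_int_powr:
  assumes "a > 1"
  shows "(\<lambda>n::int. (1 + \<bar>real_of_int n\<bar>) powr - a) summable_on UNIV"
proof -
  have "summable (\<lambda>n. real n powr - a)" using assms by (simp add: summable_real_powr_iff)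
  then have "summable (\<lambda>n. real (Suc n) powr - a)" by (subst summable_Suc_iff)
  then have s: "(\<lambda>n. (1 + real n) powr - a) summable_on UNIV"
    by (simp add: summable_on_UNIV_nonneg_real_iff add.commute)
  have A: "(\<lambda>n::int. (1 + \<bar>real_of_int n\<bar>) powr - a) summable_on range int"
    using s by (subst summable_on_reindex) (auto simp: o_def)
  have B: "(\<lambda>n::int. (1 + \<bar>real_of_int n\<bar>) powr - a) summable_on range (\<lambda>n. - int n)"
    using s by (subst summable_on_reindex) (auto simp: o_def inj_def)
  have "range int \<union> range (\<lambda>n. - int n) = UNIV"
    by (auto simp: image_iff) (metis int_cases2)
  then show ?thesis using summable_on_union[OF A B] by simp
qed

lemma summable_on_lattice_majorant:
  assumes "a > 1"
  shows "lattice_majorant a summable_on X"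
proof -
  let ?f = "\<lambda>n::int. (1 + \<bar>real_of_int n\<bar>) powr - a"
  have s: "?f summable_on UNIV" by (rule summable_on_int_powr[OF assms])
  have "lattice_majorant a summable_on UNIV \<times> UNIV"
  proof (rule summable_on_SigmaI)
    show "((\<lambda>n. lattice_majorant a (m, n)) has_sum ?f m * infsum ?f UNIV) UNIV" for m
      unfolding lattice_majorant_def prod.case by (intro has_sum_cmult_right has_sum_infsum s)
    show "(\<lambda>m. ?f m * infsum ?f UNIV) summable_on UNIV"
      by (intro summable_on_cmult_left s)
  qed (auto simp: lattice_majorant_def)
  then show ?thesis by (auto intro: summable_on_subset)
qed

text \<open>With \<open>x = |m|\<close>, \<open>y = |n|\<close> and \<open>x + y \<ge> 1\<close>,
  the product \<open>(1 + x) (1 + y)\<close> is at most \<open>4 (x + y)^2\<close>, and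
  \<open>x + y\<close> is at most a constant times \<open>|w|\<close>. A separate bound
  \<open>K\<close> for that constant keeps the estimate uniform while \<open>\<tau>\<close> varies
  in a ball.\<close>

lemma lattice_point_powr_le_majorant:
  assumes "Im \<tau> > 0" "h \<noteq> (0, 0)" "a > 0" "lattice_const \<tau> \<le> K"
  shows "cmod (lattice_point \<tau> h) powr - (2 * a) \<le> (4 * K\<^sup>2) powr a * lattice_majorant a h"
proof -
  obtain m n where h: "h = (m, n)" by force
  let ?w = "cmod (lattice_point \<tau> h)"
  have w: "?w > 0" using assms h by (simp add: lattice_point_eq_0_iff)
  have K: "K \<ge> 1" using assms lattice_const_ge_1 by force
  define x where "x = \<bar>real_of_int m\<bar>" define y where "y = \<bar>real_of_int n\<bar>"
  have "m \<noteq> 0 \<or> n \<noteq> 0" using assms(2) h by auto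
  then have xy: "x \<ge> 0" "y \<ge> 0" "x + y \<ge> 1" by (auto simp: x_def y_def)
  have "(1 + x) * (1 + y) \<le> (1 + x + y) * (1 + x + y)"
    using xy by (intro mult_mono) auto
  also have "\<dots> \<le> (2 * (x + y)) * (2 * (x + y))"
    using xy by (intro mult_mono) auto
  also have "\<dots> = 4 * (x + y)\<^sup>2" by (simp add: power2_eq_square algebra_simps)
  also have "\<dots> \<le> 4 * (K * ?w)\<^sup>2"
  proof -
    have "x + y \<le> lattice_const \<tau> * ?w"
      using lattice_point_lower_bound[OF assms(1), of m n] h by (simp add: x_def y_def)
    also have "\<dots> \<le> K * ?w" using assms by (intro mult_right_mono) auto
    finally show ?thesis using xy by (intro mult_left_mono power_mono) auto
  qed
  finally have "(1 + x) * (1 + y) \<le> (4 * K\<^sup>2) * ?w\<^sup>2"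
    by (simp add: power_mult_distrib)
  then have "((4 * K\<^sup>2) * ?w\<^sup>2) powr - a \<le> ((1 + x) * (1 + y)) powr - a"
    using xy assms(3) by (intro powr_mono2') auto
  then have "(4 * K\<^sup>2) powr - a * (?w\<^sup>2) powr - a \<le> (1 + x) powr - a * (1 + y) powr - a"
    using xy by (simp add: powr_mult)
  moreover have "(?w\<^sup>2) powr - a = ?w powr - (2 * a)"
    using w powr_powr[of ?w 2 "-a"] by (simp add: powr_realpow)
  ultimately have "(4 * K\<^sup>2) powr - a * ?w powr - (2 * a) \<le> lattice_majorant a h"
    by (simp add: h lattice_majorant_def x_def y_def)
  then have "(4 * K\<^sup>2) powr a * ((4 * K\<^sup>2) powr - a * ?w powr - (2 * a)) \<le> (4 * K\<^sup>2) powr a * lattice_majorant a h"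
    by (rule mult_left_mono) simp
  moreover have "(4 * K\<^sup>2) powr a * (4 * K\<^sup>2) powr - a = 1"
    using K by (simp flip: powr_add)
  ultimately show ?thesis by (simp flip: mult.assoc)
qed

lemma summable_on_lattice_powr:
  assumes "Im \<tau> > 0" "a > 2" "(0, 0) \<notin> X"
  shows "(\<lambda>h. cmod (lattice_point \<tau> h) powr - a) summable_on X"
proof (rule summable_on_comparison_test)
  show "(\<lambda>h. (4 * (lattice_const \<tau>)\<^sup>2) powr (a / 2) * lattice_majorant (a / 2) h) summable_on X"
    using assms by (intro summable_on_cmult_right summable_on_lattice_majorant) auto
  fix h assume "h \<in> X"
  then have "h \<noteq> (0, 0)" using assms by auto
  from lattice_point_powr_le_majorant[OF assms(1) this, of "a / 2"] assms
  show "cmod (lattice_point \<tau> h) powr - a \<le> (4 * (lattice_const \<tau>)\<^sup>2) powr (a / 2) * lattice_majorant (a / 2) h"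
    by simp
qed auto

lemma zero_notin_half_lattice: "(0, 0) \<notin> half_lattice"
  by (simp add: half_lattice_def)

definition deform :: "real \<Rightarrow> complex \<Rightarrow> complex" where
  "deform s w = w\<^sup>2 * of_real (cmod w powr (2 * s))"

lemma deform_minus: "deform s (- w) = deform s w"
  by (simp add: deform_def)

lemma norm_deform: "norm (deform s w) = cmod w powr (2 + 2 * s)"
  by (cases "w = 0") (simp_all add: deform_def norm_mult norm_power powr_add powr_realpow)

lemma norm_inverse_deform: "norm (1 / deform s w) = cmod w powr - (2 + 2 * s)"
  by (simp add: norm_divide norm_deform powr_minus_divide del: minus_add_distrib)

text \<open>The modulus of \<open>deform s w\<close> determines \<open>|w|\<close>, because the
  exponent \<open>2 + 2 s\<close> is positive; after that the squares agree. Hence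
  \<open>deformed_lattice\<close> identifies opposite points and no others, and the half lattice
  parametrizes it.\<close>

lemma deform_eq_iff:
  assumes "s \<ge> 0"
  shows "deform s w = deform s w' \<longleftrightarrow> w = w' \<or> w = - w'"
proof
  assume eq: "deform s w = deform s w'"
  then have "cmod w powr (2 + 2 * s) = cmod w' powr (2 + 2 * s)" by (metis norm_deform)
  then have "(cmod w powr (2 + 2 * s)) powr (1 / (2 + 2 * s)) = (cmod w' powr (2 + 2 * s)) powr (1 / (2 + 2 * s))"
    by simp
  then have c: "cmod w = cmod w'" using assms by (simp add: powr_powr)
  show "w = w' \<or> w = - w'"
  proof (cases "w' = 0")
    case False
    then have "w\<^sup>2 = w'\<^sup>2" using eq c by (simp add: deform_def)
    then show ?thesis by (simp add: power2_eq_iff)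
  qed (use c in auto)
qed (auto simp: deform_minus)

lemma deformed_lattice_eq: "deformed_lattice \<tau> s = deform s ` (period_lattice \<tau> - {0})"
  by (auto simp: deformed_lattice_def deform_def)

lemma bij_betw_half_lattice:
  assumes "Im \<tau> > 0" "s \<ge> 0"
  shows "bij_betw (\<lambda>h. deform s (lattice_point \<tau> h)) half_lattice (deformed_lattice \<tau> s)"
  unfolding bij_betw_def
proof
  have neg: "- lattice_point \<tau> (m, n) = lattice_point \<tau> (- m, - n)" for m n
    by (simp add: lattice_point_def)
  show "inj_on (\<lambda>h. deform s (lattice_point \<tau> h)) half_lattice"
  proof (rule inj_onI)
    fix h h' assume h: "h \<in> half_lattice" "h' \<in> half_lattice"
      and "deform s (lattice_point \<tau> h) = deform s (lattice_point \<tau> h')"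
    then have "lattice_point \<tau> h = lattice_point \<tau> h' \<or> lattice_point \<tau> h = lattice_point \<tau> (- fst h', - snd h')"
      using neg[of "fst h'" "snd h'"] by (simp add: deform_eq_iff[OF assms(2)])
    then show "h = h'"
      using h unfolding inj_eq[OF inj_lattice_point[OF assms(1)]] by (auto simp: half_lattice_def)
  qed
  show "(\<lambda>h. deform s (lattice_point \<tau> h)) ` half_lattice = deformed_lattice \<tau> s"
  proof (intro equalityI subsetI)
    fix x assume "x \<in> (\<lambda>h. deform s (lattice_point \<tau> h)) ` half_lattice"
    then obtain h where h: "h \<in> half_lattice" "x = deform s (lattice_point \<tau> h)" by blast
    have "lattice_point \<tau> h \<in> period_lattice \<tau> - {0}"
      using h(1) lattice_point_eq_0_iff[OF assms(1), of h]
      by (auto simp: half_lattice_def period_lattice_def lattice_point_def split: prod.splits intro: add.commute)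
    then show "x \<in> deformed_lattice \<tau> s" using h(2) by (simp add: deformed_lattice_eq)
  next
    fix x assume "x \<in> deformed_lattice \<tau> s"
    then obtain w where w: "w \<in> period_lattice \<tau>" "w \<noteq> 0" "x = deform s w"
      by (auto simp: deformed_lattice_eq)
    then obtain m n where mn: "w = lattice_point \<tau> (m, n)"
      by (auto simp: period_lattice_def lattice_point_def add.commute)
    with w have "(m, n) \<noteq> (0, 0)" by (auto simp: lattice_point_def)
    then consider "(m, n) \<in> half_lattice" | "(- m, - n) \<in> half_lattice"
      by (fastforce simp: half_lattice_def)
    then show "x \<in> (\<lambda>h. deform s (lattice_point \<tau> h)) ` half_lattice"
    proof cases
      case 1 then show ?thesis using w(3) mn by blast
    next
      case 2
      have "x = deform s (lattice_point \<tau> (- m, - n))"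
        using w(3) mn neg[of m n] deform_minus[of s w] by simp
      with 2 show ?thesis by blast
    qed
  qed
qed

definition power_sum :: "complex \<Rightarrow> real \<Rightarrow> nat \<Rightarrow> complex" where
  "power_sum \<tau> s j = (\<Sum>\<^sub>\<infinity>h\<in>half_lattice. (1 / deform s (lattice_point \<tau> h)) ^ j)"

lemma deformed_lattice_abs_summable:
  assumes "Im \<tau> > 0" "s > 0"
  shows "(\<lambda>x. norm (1 / x)) summable_on deformed_lattice \<tau> s"
proof -
  have "(\<lambda>h. norm (1 / deform s (lattice_point \<tau> h))) summable_on half_lattice"
    unfolding norm_inverse_deform
    using assms zero_notin_half_lattice by (intro summable_on_lattice_powr) auto
  then show ?thesis
    using assms summable_on_reindex_bij_betw[OF bij_betw_half_lattice[of \<tau> s], of "\<lambda>x. norm (1 / x)"] by simp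
qed

lemma elem_sym_recip_deformed_lattice:
  assumes "Im \<tau> > 0" "s > 0"
  shows "elem_sym_recip k (deformed_lattice \<tau> s) = newton (power_sum \<tau> s) k"
proof -
  have "(\<Sum>\<^sub>\<infinity>x\<in>deformed_lattice \<tau> s. (1 / x) ^ j) = power_sum \<tau> s j" for j
    unfolding power_sum_def
    by (rule infsum_reindex_bij_betw[OF bij_betw_half_lattice, symmetric]) (use assms in auto)
  then show ?thesis
    unfolding elem_sym_recip_eq_esym newton_esym[OF deformed_lattice_abs_summable[OF assms]]
    by (auto intro: newton_unique[symmetric] simp: newton.simps(1) newton_Suc)
qed

lemma deform_0: "w \<noteq> 0 \<Longrightarrow> deform 0 w = w\<^sup>2"
  by (simp add: deform_def)

lemma tendsto_deform: "w \<noteq> 0 \<Longrightarrow> ((\<lambda>s. deform s w) \<longlongrightarrow> w\<^sup>2) (at_right 0)"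
  unfolding deform_def by (rule tendsto_eq_rhs) (auto intro!: tendsto_eq_intros)

text \<open>Dominated convergence: \<open>|w| \<ge> 1 / K\<close> on the half lattice bounds
  \<open>|w|^(-2s)\<close> by \<open>K^2\<close> for \<open>0 < s < 1\<close>, and the remaining
  exponent \<open>2 j\<close> is at least 4.\<close>

lemma tendsto_power_sum:
  assumes "Im \<tau> > 0" "j \<ge> 2"
  shows "((\<lambda>s. power_sum \<tau> s j) \<longlongrightarrow> power_sum \<tau> 0 j) (at_right 0)"
proof -
  let ?K = "lattice_const \<tau>" and ?w = "lattice_point \<tau>"
  have K: "?K \<ge> 1" using assms(1) by (rule lattice_const_ge_1)
  have ne: "?w h \<noteq> 0" if "h \<in> half_lattice" for h
    using that assms zero_notin_half_lattice lattice_point_eq_0_iff by metis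
  have bound: "norm ((1 / deform s (?w h)) ^ j) \<le> ?K ^ (2 * j) * cmod (?w h) powr - (2 * real j)"
    if h: "h \<in> half_lattice" and s: "0 < s" "s < 1" for h s
  proof -
    have ge: "cmod (?w h) \<ge> 1 / ?K"
      using h zero_notin_half_lattice by (intro cmod_lattice_point_ge[OF assms(1)]) auto
    have "cmod (?w h) powr - (2 * s) \<le> (1 / ?K) powr - (2 * s)"
      using ge K s by (intro powr_mono2') auto
    also have "\<dots> = ?K powr (2 * s)" using K by (simp add: powr_divide powr_minus field_simps)
    also have "\<dots> \<le> ?K powr 2" using K s by (intro powr_mono) auto
    also have "\<dots> = ?K ^ 2" using K by simp
    finally have A: "cmod (?w h) powr - (2 * s) \<le> ?K ^ 2" .
    have "norm (1 / deform s (?w h)) = cmod (?w h) powr - 2 * cmod (?w h) powr - (2 * s)"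
      unfolding norm_inverse_deform by (simp add: powr_add[symmetric])
    also have "\<dots> \<le> cmod (?w h) powr - 2 * ?K ^ 2" using A by (intro mult_left_mono) auto
    finally have "norm (1 / deform s (?w h)) ^ j \<le> (cmod (?w h) powr - 2 * ?K ^ 2) ^ j"
      by (intro power_mono) auto
    also have "\<dots> = ?K ^ (2 * j) * (cmod (?w h) powr - 2) ^ j"
      by (simp add: power_mult_distrib power_mult mult.commute flip: power_mult)
    also have "(cmod (?w h) powr - 2) ^ j = cmod (?w h) powr - (2 * real j)"
      using ne[OF h] powr_powr[of "cmod (?w h)" "-2" "real j"] by (simp add: powr_realpow)
    finally show ?thesis by (simp only: norm_power)
  qed
  have "((\<lambda>s. \<Sum>\<^sub>\<infinity>h\<in>half_lattice. (1 / deform s (?w h)) ^ j) \<longlongrightarrow> (\<Sum>\<^sub>\<infinity>h\<in>half_lattice. (1 / deform 0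
    (?w h)) ^ j)) (at_right 0)"
  proof (rule conjunct2[OF tendsto_infsum_dominated])
    show "((\<lambda>s. (1 / deform s (?w h)) ^ j) \<longlongrightarrow> (1 / deform 0 (?w h)) ^ j) (at_right 0)" if "h \<in> half_lattice" for h
      using ne[OF that] by (auto intro!: tendsto_intros tendsto_deform simp: deform_0)
    show "\<forall>\<^sub>F s in at_right 0. \<forall>h\<in>half_lattice. norm ((1 / deform s (?w h)) ^ j)
      \<le> ?K ^ (2 * j) * cmod (?w h) powr - (2 * real j)"
      using bound by (intro eventually_mono[OF eventually_at_right_real[of 0 1]]) auto
    show "(\<lambda>h. ?K ^ (2 * j) * cmod (?w h) powr - (2 * real j)) summable_on half_lattice"
      using assms zero_notin_half_lattice by (intro summable_on_cmult_right summable_on_lattice_powr) auto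
  qed simp
  then show ?thesis by (simp add: power_sum_def)
qed

lemma open_upper_half_plane: "open upper_half_plane"
  by (simp add: open_halfspace_Im_gt)

lemma holomorphic_power_sum:
  assumes "j \<ge> 2"
  shows "(\<lambda>\<tau>. power_sum \<tau> 0 j) holomorphic_on upper_half_plane"
  unfolding power_sum_def
proof (rule holomorphic_infsum[OF open_upper_half_plane])
  fix h assume h: "h \<in> half_lattice"
  have "(\<lambda>\<tau>. (1 / (lattice_point \<tau> h)\<^sup>2) ^ j) holomorphic_on upper_half_plane"
    using h zero_notin_half_lattice lattice_point_eq_0_iff
    by (cases h) (auto intro!: holomorphic_intros simp: lattice_point_def)
  then show "(\<lambda>\<tau>. (1 / deform 0 (lattice_point \<tau> h)) ^ j) holomorphic_on upper_half_plane"
    by (rule holomorphic_transform)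
       (metis deform_0 h lattice_point_eq_0_iff mem_Collect_eq zero_notin_half_lattice)
next
  fix z assume z: "z \<in> upper_half_plane"
  define r where "r = Im z / 2"
  \<comment> \<open>On the ball of radius \<open>r = Im z / 2\<close> the imaginary part is at least
    \<open>r\<close> and the modulus at most \<open>cmod z + r\<close>, so this bounds
    \<open>lattice_const\<close> there.\<close>
  define K where "K = 1 + (1 + (cmod z + r)) / r"
  have r: "r > 0" using z by (simp add: r_def)
  have w: "Im w \<ge> r" "cmod w \<le> cmod z + r" if "w \<in> cball z r" for w
  proof -
    have "cmod (w - z) \<le> r" using that by (simp add: dist_norm norm_minus_commute)
    then show "Im w \<ge> r" using abs_Im_le_cmod[of "w - z"] by (simp add: r_def)
    show "cmod w \<le> cmod z + r" using \<open>cmod (w - z) \<le> r\<close> norm_triangle_sub[of w z] by linarith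
  qed
  have K: "lattice_const w \<le> K" if "w \<in> cball z r" for w
    unfolding lattice_const_def K_def using w[OF that] r
    by (intro add_left_mono frac_le) auto
  let ?M = "\<lambda>h. (4 * K\<^sup>2) powr real j * lattice_majorant (real j) h"
  show "\<exists>r>0. \<exists>M. cball z r \<subseteq> upper_half_plane \<and> M summable_on half_lattice \<and>
      (\<forall>h\<in>half_lattice. \<forall>w\<in>cball z r. norm ((1 / deform 0 (lattice_point w h)) ^ j) \<le> M h)"
  proof (intro exI conjI ballI)
    show "?M summable_on half_lattice"
      using assms by (intro summable_on_cmult_right summable_on_lattice_majorant) auto
    show "cball z r \<subseteq> upper_half_plane" using w(1) r by force
    fix h w' assume h: "h \<in> half_lattice" and w': "w' \<in> cball z r"
    have i: "Im w' > 0" using w(1)[OF w'] r by simp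
    have h0: "h \<noteq> (0, 0)" using h zero_notin_half_lattice by auto
    have ne: "lattice_point w' h \<noteq> 0" using i h0 by (simp add: lattice_point_eq_0_iff)
    have "norm ((1 / deform 0 (lattice_point w' h)) ^ j) = (cmod (lattice_point w' h) powr - 2) ^ j"
      by (simp only: norm_power norm_inverse_deform) simp
    also have "\<dots> = cmod (lattice_point w' h) powr - (2 * real j)"
      using ne powr_powr[of "cmod (lattice_point w' h)" "-2" "real j"] by (simp add: powr_realpow)
    also have "\<dots> \<le> ?M h"
      using lattice_point_powr_le_majorant[OF i h0 _ K[OF w']] assms by simp
    finally show "norm ((1 / deform 0 (lattice_point w' h)) ^ j) \<le> ?M h" .
  qed (use r in auto)
qed

subsection \<open>Hecke's summation of the weight two series\<close>

text \<open>The limit \<open>L\<close> is the integral of \<open>(1 + x^2)^(-1-s)\<close> over the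
  half line, which is \<open>pi / 2\<close> at \<open>s = 0\<close>. The lower bounds in the last
  line, one for each \<open>X\<close>, force \<open>L\<close> up to \<open>pi / 2\<close> as
  \<open>s\<close> tends to 0.\<close>

definition is_hecke_primitive :: "real \<Rightarrow> (real \<Rightarrow> real) \<Rightarrow> real \<Rightarrow> bool" where
  "is_hecke_primitive s H L \<longleftrightarrow>
     (\<forall>x. (H has_real_derivative (1 + x\<^sup>2) powr (- 1 - s)) (at x)) \<and> (\<forall>x. H (- x) = - H x) \<and>
     (\<forall>x. \<bar>H x\<bar> \<le> pi / 2) \<and> (H \<longlongrightarrow> L) at_top \<and> L \<le> pi / 2 \<and>
     (\<forall>X\<ge>0. (1 + X\<^sup>2) powr - s * arctan X \<le> L)"

lemma ex_hecke_primitive: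
  fixes s :: real
  assumes "s \<ge> 0"
  shows "\<exists>H L. is_hecke_primitive s H L"
proof -
  let ?f = "\<lambda>x::real. (1 + x\<^sup>2) powr (- 1 - s)"
  have pos: "1 + x\<^sup>2 > 0" for x :: real by (simp add: add_pos_nonneg)
  have "\<exists>F. \<forall>x::real. - \<infinity> < ereal x \<longrightarrow> ereal x < \<infinity> \<longrightarrow> (F has_vector_derivative ?f x) (at x)"
    by (rule einterval_antiderivative) (use pos in \<open>auto intro!: continuous_intros simp: less_imp_neq[symmetric]\<close>)
  then obtain F where F: "\<And>x. (F has_real_derivative ?f x) (at x)"
    by (auto simp: has_real_derivative_iff_has_vector_derivative)
  \<comment> \<open>The integrand is even, so the odd part of an antiderivative is an antiderivative
    too.\<close>
  define H where "H x = (F x - F (- x)) / 2" for x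
  have dH: "(H has_real_derivative ?f x) (at x)" for x
    unfolding H_def by (auto intro!: derivative_eq_intros DERIV_chain2[OF F])
  have odd: "H (- x) = - H x" for x by (simp add: H_def diff_divide_distrib)
  have mono: "H x \<le> H y" if "x \<le> y" for x y
    by (rule DERIV_nonneg_imp_nondecreasing[OF that], rule exI, rule conjI, rule dH, simp)
  have H0: "H 0 = 0" by (simp add: H_def)
  have le: "H x \<le> arctan x" if "x \<ge> 0" for x
  proof -
    have "arctan 0 - H 0 \<le> arctan x - H x"
    proof (rule DERIV_nonneg_imp_nondecreasing[OF that])
      fix y :: real
      have "?f y \<le> (1 + y\<^sup>2) powr - 1" using assms by (intro powr_mono) auto
      then have "0 \<le> inverse (1 + y\<^sup>2) - ?f y" using pos[of y] by (simp add: powr_minus)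
      then show "\<exists>d. ((\<lambda>x. arctan x - H x) has_real_derivative d) (at y) \<and> 0 \<le> d"
        by (intro exI[of _ "inverse (1 + y\<^sup>2) - ?f y"]) (auto intro!: derivative_eq_intros dH)
    qed
    then show ?thesis by (simp add: H0)
  qed
  \<comment> \<open>On \<open>[0, X]\<close> the integrand is at least \<open>(1 + X^2)^(-s)\<close>
    times the derivative of \<open>arctan\<close>.\<close>
  have ge: "(1 + X\<^sup>2) powr - s * arctan X \<le> H X" if "X \<ge> 0" for X
  proof -
    have "H 0 - (1 + X\<^sup>2) powr - s * arctan 0 \<le> H X - (1 + X\<^sup>2) powr - s * arctan X"
    proof (rule DERIV_nonneg_imp_nondecreasing[OF that])
      fix y :: real assume y: "0 \<le> y" "y \<le> X"
      have "(1 + X\<^sup>2) powr - s \<le> (1 + y\<^sup>2) powr - s"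
        using assms y pos[of y] by (intro powr_mono2') (auto intro: power_mono)
      then have "(1 + X\<^sup>2) powr - s * inverse (1 + y\<^sup>2) \<le> (1 + y\<^sup>2) powr - s * inverse (1 + y\<^sup>2)"
        using pos[of y] by (intro mult_right_mono) auto
      also have "\<dots> = ?f y"
        using pos[of y] powr_add[of "1 + y\<^sup>2" "-1" "-s"] by (simp add: powr_minus[of _ 1] divide_inverse)
      finally have "0 \<le> ?f y - (1 + X\<^sup>2) powr - s * inverse (1 + y\<^sup>2)" by simp
      then show "\<exists>d. ((\<lambda>x. H x - (1 + X\<^sup>2) powr - s * arctan x) has_real_derivative d) (at y) \<and> 0 \<le> d"
        by (intro exI[of _ "?f y - (1 + X\<^sup>2) powr - s * inverse (1 + y\<^sup>2)"])
           (auto intro!: derivative_eq_intros dH)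
    qed
    then show ?thesis by (simp add: H0)
  qed
  have bound: "H x \<le> pi / 2" for x
  proof (cases "x \<ge> 0")
    case True then show ?thesis using le[of x] arctan_ubound[of x] by linarith
  next
    case False then show ?thesis using mono[of x 0] H0 pi_gt_zero by linarith
  qed
  define L where "L = (SUP x. H x)"
  have bdd: "bdd_above (range H)" by (rule bdd_aboveI2[OF bound])
  have HL: "H x \<le> L" for x unfolding L_def by (rule cSUP_upper[OF _ bdd]) simp
  have "(H \<longlongrightarrow> L) at_top"
  proof (rule order_tendstoI)
    fix a assume "a < L"
    then obtain x where "a < H x" unfolding L_def using less_cSUP_iff[OF UNIV_not_empty bdd] by auto
    then show "\<forall>\<^sub>F y in at_top. a < H y"
      by (intro eventually_mono[OF eventually_ge_at_top[of x]]) (use mono in force)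
  next
    fix a assume "L < a"
    then show "\<forall>\<^sub>F y in at_top. H y < a" using HL by (intro always_eventually) (meson le_less_trans)
  qed
  moreover have "L \<le> pi / 2" unfolding L_def by (rule cSUP_least) (use bound in auto)
  moreover have "\<bar>H x\<bar> \<le> pi / 2" for x using bound[of x] bound[of "-x"] odd[of x] by auto
  moreover have "(1 + X\<^sup>2) powr - s * arctan X \<le> L" if "X \<ge> 0" for X
    using ge[OF that] HL[of X] by linarith
  ultimately show ?thesis using dH odd unfolding is_hecke_primitive_def by blast
qed

definition hecke_primitive :: "real \<Rightarrow> real \<Rightarrow> real" where
  "hecke_primitive s = (SOME H. \<exists>L. is_hecke_primitive s H L)"

definition hecke_limit :: "real \<Rightarrow> real" where
  "hecke_limit s = Lim at_top (hecke_primitive s)"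

lemma hecke_primitive:
  assumes "s \<ge> 0"
  shows "(hecke_primitive s has_real_derivative (1 + x\<^sup>2) powr (- 1 - s)) (at x)"
    and "hecke_primitive s (- x) = - hecke_primitive s x"
    and "\<bar>hecke_primitive s x\<bar> \<le> pi / 2"
    and "(hecke_primitive s \<longlongrightarrow> hecke_limit s) at_top"
    and "hecke_limit s \<le> pi / 2"
    and "X \<ge> 0 \<Longrightarrow> (1 + X\<^sup>2) powr - s * arctan X \<le> hecke_limit s"
proof -
  note someI_ex[OF ex_hecke_primitive[OF assms], folded hecke_primitive_def]
  then obtain L where "is_hecke_primitive s (hecke_primitive s) L" by blast
  note L = this[unfolded is_hecke_primitive_def]
  have "hecke_limit s = L" unfolding hecke_limit_def using L by (intro tendsto_Lim) auto
  then show "(hecke_primitive s has_real_derivative (1 + x\<^sup>2) powr (- 1 - s)) (at x)"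
    "hecke_primitive s (- x) = - hecke_primitive s x" "\<bar>hecke_primitive s x\<bar> \<le> pi / 2"
    "(hecke_primitive s \<longlongrightarrow> hecke_limit s) at_top" "hecke_limit s \<le> pi / 2"
    "X \<ge> 0 \<Longrightarrow> (1 + X\<^sup>2) powr - s * arctan X \<le> hecke_limit s"
    using L by auto
qed

lemma tendsto_hecke_limit: "(hecke_limit \<longlongrightarrow> pi / 2) (at_right 0)"
proof (rule order_tendstoI)
  fix a assume a: "a < pi / 2"
  \<comment> \<open>The tangent of an angle halfway between \<open>max a 0\<close> and
    \<open>pi / 2\<close>: then \<open>c\<close> is nonnegative and \<open>arctan c\<close> exceeds
    \<open>a\<close>, while the factor \<open>(1 + c^2)^(-s)\<close> tends to 1.\<close>
  define c where "c = tan ((max a 0 + pi / 2) / 2)"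
  have t: "0 < (max a 0 + pi / 2) / 2" "(max a 0 + pi / 2) / 2 < pi / 2"
    using a by (auto simp: max_def)
  have c: "c \<ge> 0" "arctan c > a"
  proof -
    show "c \<ge> 0" unfolding c_def using t by (intro less_imp_le tan_gt_zero) auto
    have "arctan c = (max a 0 + pi / 2) / 2" unfolding c_def using t by (intro arctan_tan) auto
    then show "arctan c > a" using a by (simp add: max_def field_simps split: if_splits)
  qed
  have "((\<lambda>s. (1 + c\<^sup>2) powr - s * arctan c) \<longlongrightarrow> (1 + c\<^sup>2) powr - 0 * arctan c) (at_right 0)"
    by (intro tendsto_intros) (auto simp: add_pos_nonneg less_imp_neq[symmetric])
  then have "\<forall>\<^sub>F s in at_right 0. a < (1 + c\<^sup>2) powr - s * arctan c"
    using c(2) by (intro order_tendstoD) (auto simp: add_pos_nonneg less_imp_neq[symmetric])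
  with eventually_at_right_less show "\<forall>\<^sub>F s in at_right 0. a < hecke_limit s"
    by eventually_elim (use c(1) hecke_primitive(6)[of _ c] in \<open>fastforce intro: less_le_trans\<close>)
next
  fix a :: real assume a: "pi / 2 < a"
  show "\<forall>\<^sub>F s in at_right 0. hecke_limit s < a"
    by (rule eventually_mono[OF eventually_at_right_less]) (meson hecke_primitive(5) a le_less_trans less_imp_le)
qed

section \<open>Comparison of a row with an integral\<close>

lemma norm_diff_le_vector_derivative:
  fixes f :: "real \<Rightarrow> complex"
  assumes "convex S" "x \<in> S" "y \<in> S"
    and "\<And>t. t \<in> S \<Longrightarrow> (f has_vector_derivative f' t) (at t within S)"
    and "\<And>t. t \<in> S \<Longrightarrow> norm (f' t) \<le> C"
  shows "norm (f x - f y) \<le> C * norm (x - y)"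
proof (rule differentiable_bound[OF assms(1) _ _ assms(2,3), where f' = "\<lambda>t h. h *\<^sub>R f' t"])
  fix t assume t: "t \<in> S"
  show "(f has_derivative (\<lambda>h. h *\<^sub>R f' t)) (at t within S)"
    using assms(4)[OF t] by (simp add: has_vector_derivative_def)
  show "onorm (\<lambda>h. h *\<^sub>R f' t) \<le> C"
    using assms(5)[OF t] order.trans[OF norm_ge_zero assms(5)[OF t]]
    by (intro onorm_bound) (auto simp: mult.commute[of C] intro: mult_left_mono)
qed

text \<open>
  An antiderivative of \<open>x \<mapsto> 1 / deform s (x + \<i> a)\<close>. Integration by parts leaves \<open>s\<close> times a
  primitive of \<open>(x\<^sup>2 + a\<^sup>2)\<^sup>-\<^sup>1\<^sup>-\<^sup>s\<close>; the factor \<open>s\<close> is what the pole of the zeta function is played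
  against below.
\<close>

definition hecke_antideriv :: "real \<Rightarrow> real \<Rightarrow> real \<Rightarrow> complex" where
  "hecke_antideriv s a x =
     (- inverse (of_real x + \<i> * of_real a) * of_real ((x\<^sup>2 + a\<^sup>2) powr - s)
       - of_real (s * a powr (- 1 - 2 * s) * hecke_primitive s (x / a))) / of_real (1 + s)"

lemma inverse_deform_eq:
  assumes "a > 0"
  shows "1 / deform s (of_real x + \<i> * of_real a) =
    inverse ((of_real x + \<i> * of_real a)\<^sup>2) * of_real ((x\<^sup>2 + a\<^sup>2) powr - s)"
proof -
  have c: "cmod (of_real x + \<i> * of_real a) = sqrt (x\<^sup>2 + a\<^sup>2)" by (simp add: cmod_def)
  have "sqrt (x\<^sup>2 + a\<^sup>2) powr (2 * s) = (x\<^sup>2 + a\<^sup>2) powr s"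
    using assms by (simp add: powr_half_sqrt[symmetric] powr_powr)
  then show ?thesis unfolding deform_def c by (simp add: powr_minus divide_inverse)
qed

text \<open>Put \<open>z = x + i a\<close> and \<open>A = x^2 + a^2\<close>, the product of
  \<open>z\<close> and its conjugate. Since \<open>2 x\<close> is their sum,
  \<open>2 x / (z A) = 1 / A + 1 / z^2\<close>, so the derivative of \<open>- A^(-s) / z\<close> is
  \<open>(1 + s) A^(-s) / z^2 + s A^(-1-s)\<close>. The primitive removes the last term, and the
  substitution \<open>x / a\<close> in it accounts for the power of \<open>a\<close>.\<close>

lemma has_vector_derivative_hecke_antideriv:
  assumes "a > 0" "s \<ge> 0"
  shows "(hecke_antideriv s a has_vector_derivative 1 / deform s (of_real x + \<i> * of_real a)) (at x)"
proof -
  let ?z = "of_real x + \<i> * of_real a :: complex"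
  have z: "?z \<noteq> 0" using assms by (auto simp: complex_eq_iff)
  define A where "A = x\<^sup>2 + a\<^sup>2"
  have A: "A > 0" using assms by (simp add: A_def add_nonneg_pos)
  have zz: "?z * cnj ?z = of_real A"
    by (simp add: A_def complex_eq_iff power2_eq_square)
  have d1: "((\<lambda>x. inverse (of_real x + \<i> * of_real a)) has_vector_derivative - inverse (?z\<^sup>2)) (at x)"
    by (rule has_vector_derivative_real_field)
      (use z in \<open>auto intro!: derivative_eq_intros simp: power2_eq_square\<close>)
  have "((\<lambda>x. (x\<^sup>2 + a\<^sup>2) powr - s) has_real_derivative - (2 * s * x * A powr (- s - 1))) (at x)"
    using A by (auto intro!: derivative_eq_intros simp: A_def)
  then have d2: "((\<lambda>x. of_real ((x\<^sup>2 + a\<^sup>2) powr - s) :: complex) has_vector_derivative of_real (- (2 * s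
    * x * A powr (- s - 1)))) (at x)"
    by (intro has_vector_derivative_of_real) (simp add: has_real_derivative_iff_has_vector_derivative)
  have "(1 + (x / a)\<^sup>2) = A / a\<^sup>2" using assms by (simp add: A_def field_simps)
  then have "(1 + (x / a)\<^sup>2) powr (- 1 - s) = A powr (- 1 - s) / (a\<^sup>2) powr (- 1 - s)"
    using A by (simp add: powr_divide)
  moreover have "(a\<^sup>2) powr (- 1 - s) = a powr (- 2 - 2 * s)"
    using assms powr_powr[of a 2 "- 1 - s"] by (simp add: powr_realpow)
  moreover have "a powr (- 1 - 2 * s) = a powr (- 2 - 2 * s) * a"
    using assms powr_add[of a "- 2 - 2 * s" 1] by simp
  ultimately have e3: "s * a powr (- 1 - 2 * s) * ((1 + (x / a)\<^sup>2) powr (- 1 - s) * (1 / a))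
    = s * A powr (- 1 - s)"
    using assms by simp
  have "((\<lambda>x. s * a powr (- 1 - 2 * s) * hecke_primitive s (x / a)) has_real_derivative s * A powr (- 1
    - s)) (at x)"
    unfolding e3[symmetric]
    by (intro DERIV_cmult DERIV_chain2[OF hecke_primitive(1)[OF assms(2)]] DERIV_cdivide[OF DERIV_ident])
  then have d3: "((\<lambda>x. of_real (s * a powr (- 1 - 2 * s) * hecke_primitive s (x / a)) :: complex)
    has_vector_derivative of_real (s * A powr (- 1 - s))) (at x)"
    by (intro has_vector_derivative_of_real) (simp add: has_real_derivative_iff_has_vector_derivative)
  let ?p = "of_real (A powr (- s)) :: complex"
  have p: "of_real (A powr (- s - 1)) = ?p / of_real A" "of_real (A powr (- 1 - s)) = ?p / of_real A"
    using A powr_add[of A "-s" "-1"] powr_add[of A "-1" "-s"] by (simp_all add: powr_minus divide_inverse)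
  have d: "(hecke_antideriv s a has_vector_derivative
      (((- inverse ?z) * of_real (- (2 * s * x * A powr (- s - 1))) + (- (- inverse (?z\<^sup>2))) * ?p)
        - of_real (s * A powr (- 1 - s))) / of_real (1 + s)) (at x)"
    unfolding hecke_antideriv_def A_def
    by (intro has_vector_derivative_divide has_vector_derivative_diff d3[unfolded A_def]
         has_vector_derivative_mult has_vector_derivative_minus d1 d2[unfolded A_def])
  have A0: "of_real A \<noteq> (0::complex)" using A by simp
  have two: "2 * of_real x = ?z + cnj ?z" by (simp add: complex_eq_iff)
  have e: "((- inverse ?z) * of_real (- (2 * s * x * A powr (- s - 1))) + (- (- inverse (?z\<^sup>2))) * ?p)
        - of_real (s * A powr (- 1 - s)) = of_real (1 + s) * (inverse (?z\<^sup>2) * ?p)"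
  proof -
    have id: "inverse w * (w + c) * inverse (w * c) - inverse (w * c) = inverse (w\<^sup>2)"
      if "w \<noteq> 0" "c \<noteq> 0" for w c :: complex
      using that by (simp add: field_simps power2_eq_square)
    have "inverse ?z * (2 * of_real x) * inverse (of_real A) - inverse (of_real A) = inverse (?z\<^sup>2)"
      unfolding two zz[symmetric] using z by (intro id) auto
    then have "of_real s * ?p * (inverse ?z * (2 * of_real x) * inverse (of_real A) - inverse (of_real A))
      = of_real s * ?p * inverse (?z\<^sup>2)"
      by simp
    then show ?thesis by (simp add: p divide_inverse algebra_simps)
  qed
  have "of_real (1 + s) \<noteq> (0::complex)" using assms(2)
    by (metis add_pos_nonneg less_numeral_extra(3) of_real_eq_0_iff zero_less_one)
  then show ?thesis using d[unfolded e] unfolding inverse_deform_eq[OF assms(1)] by (simp add: A_def)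
qed

text \<open>Mean value estimate: the derivative has two terms, each at most
  \<open>2 |z|^(-3-2s)\<close>. As \<open>|z| \<ge> v\<close>, the factor \<open>|z|^(-2s)\<close>
  is at most \<open>max 1 (v powr - 2)\<close> for all \<open>s\<close> in \<open>[0, 1]\<close>,
  and the modulus at the left end of the unit interval is at most \<open>1 + 1 / v\<close> times
  \<open>|z|\<close> inside it.\<close>

lemma norm_inverse_deform_diff_le:
  assumes "a \<ge> v" "v > 0" "0 \<le> s" "s \<le> 1" "x0 \<le> x" "x \<le> x0 + 1"
  shows "norm (1 / deform s (of_real x + \<i> * of_real a) - 1 / deform s (of_real x0 + \<i> * of_real a))
     \<le> 4 * max 1 (v powr - 2) * (1 + 1 / v) ^ 3 * cmod (of_real x0 + \<i> * of_real a) powr - 3"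
proof -
  let ?C = "4 * max 1 (v powr - 2) * (1 + 1 / v) ^ 3 * cmod (of_real x0 + \<i> * of_real a) powr - 3"
  have a: "a > 0" using assms by simp
  have "norm (1 / deform s (of_real x + \<i> * of_real a) - 1 / deform s (of_real x0 + \<i> * of_real a))
    \<le> ?C * norm (x - x0)"
  proof (rule norm_diff_le_vector_derivative[where S = "{x0..x0+1}"])
    fix y assume y: "y \<in> {x0..x0+1}"
    let ?z = "of_real y + \<i> * of_real a :: complex"
    have z: "?z \<noteq> 0" using a by (auto simp: complex_eq_iff)
    define A where "A = y\<^sup>2 + a\<^sup>2"
    have A: "A > 0" using a by (simp add: A_def add_nonneg_pos)
    define D where "D = - 2 * inverse (?z ^ 3) * of_real (A powr - s) - inverse (?z\<^sup>2) * of_real (2 * s * y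
      * A powr (- s - 1))"
    have d1: "((\<lambda>x. inverse ((of_real x + \<i> * of_real a)\<^sup>2)) has_vector_derivative - 2 * inverse (?z ^ 3)) (at y)"
    proof (rule has_vector_derivative_real_field)
      have "((\<lambda>w. inverse ((w + \<i> * of_real a)\<^sup>2)) has_field_derivative - (2 * ?z * inverse (?z\<^sup>2 ^ Suc
        (Suc 0)))) (at (of_real y))"
        by (rule DERIV_inverse_fun) (use z in \<open>auto intro!: derivative_eq_intros\<close>)
      moreover have "- (2 * w * inverse (w\<^sup>2 ^ Suc (Suc 0))) = - 2 * inverse (w ^ 3)" if "w \<noteq> 0" for w :: complex
        using that by (simp add: field_simps eval_nat_numeral)
      ultimately show "((\<lambda>w. inverse ((w + \<i> * of_real a)\<^sup>2)) has_field_derivative - 2 * inverse (?z ^ 3))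
        (at (of_real y))"
        using z by (metis DERIV_cong)
    qed
    have "((\<lambda>x. (x\<^sup>2 + a\<^sup>2) powr - s) has_real_derivative - (2 * s * y * A powr (- s - 1))) (at y)"
      using A by (auto intro!: derivative_eq_intros simp: A_def)
    then have d2: "((\<lambda>x. of_real ((x\<^sup>2 + a\<^sup>2) powr - s) :: complex) has_vector_derivative of_real (- (2 * s
      * y * A powr (- s - 1)))) (at y)"
      by (intro has_vector_derivative_of_real) (simp add: has_real_derivative_iff_has_vector_derivative)
    have "((\<lambda>y. 1 / deform s (of_real y + \<i> * of_real a)) has_vector_derivative
      inverse (?z\<^sup>2) * of_real (- (2 * s * y * A powr (- s - 1))) + (- 2 * inverse (?z ^ 3)) * of_real ((y\<^sup>2
        + a\<^sup>2) powr - s)) (at y)"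
      unfolding inverse_deform_eq[OF a] by (intro has_vector_derivative_mult d1 d2)
    also have "inverse (?z\<^sup>2) * of_real (- (2 * s * y * A powr (- s - 1))) + (- 2 * inverse (?z ^ 3))
      * of_real ((y\<^sup>2 + a\<^sup>2) powr - s) = D"
      by (simp add: D_def A_def)
    finally show "((\<lambda>y. 1 / deform s (of_real y + \<i> * of_real a))
      has_vector_derivative D) (at y within {x0..x0+1})"
      by (rule has_vector_derivative_at_within)
    have cA: "A = (cmod ?z)\<^sup>2" by (simp add: A_def cmod_power2)
    have ay: "\<bar>y\<bar> \<le> cmod ?z" using abs_Re_le_cmod[of ?z] by simp
    have va: "v \<le> cmod ?z" using abs_Im_le_cmod[of ?z] a assms by simp
    have zp: "cmod ?z > 0" using z by simp
    have pA: "A powr - s = cmod ?z powr (- 2 * s)"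
      unfolding cA using zp powr_powr[of "cmod ?z" 2 "-s"] by (simp add: powr_realpow)
    have pA1: "A powr (- s - 1) = cmod ?z powr (- 2 * s) * cmod ?z powr - 2"
      using powr_add[of A "-s" "-1"] pA cA zp by (simp add: powr_minus powr_realpow)
    have ps: "cmod ?z powr (- 2 * s) \<le> max 1 (v powr - 2)"
    proof -
      have "cmod ?z powr (- 2 * s) \<le> v powr (- 2 * s)"
        using va assms by (intro powr_mono2') auto
      also have "\<dots> \<le> max 1 (v powr - 2)"
      proof (cases "v \<ge> 1")
        case True
        then have "v powr (- 2 * s) \<le> v powr 0" using assms by (intro powr_mono) auto
        then show ?thesis using assms by simp
      next
        case False
        then have "v powr (- 2 * s) \<le> v powr - 2" using assms by (intro powr_mono') auto
        then show ?thesis by simp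
      qed
      finally show ?thesis .
    qed
    have n1: "norm (- 2 * inverse (?z ^ 3) * of_real (A powr - s)) = 2 * cmod ?z powr - 3 * cmod ?z powr (- 2 * s)"
      using zp unfolding norm_mult norm_inverse norm_power norm_of_real pA
      by (simp add: powr_minus powr_realpow)
    have n2: "norm (inverse (?z\<^sup>2) * of_real (2 * s * y * A powr (- s - 1)))
      \<le> 2 * cmod ?z powr - 3 * cmod ?z powr (- 2 * s)"
    proof -
      have "norm (inverse (?z\<^sup>2) * of_real (2 * s * y * A powr (- s - 1))) =
          cmod ?z powr - 2 * (2 * (s * \<bar>y\<bar>)) * (cmod ?z powr (- 2 * s) * cmod ?z powr - 2)"
        using zp assms(3) unfolding pA1 norm_mult norm_inverse norm_power norm_of_real
        by (simp add: abs_mult powr_minus powr_realpow)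
      also have "\<dots> \<le> cmod ?z powr - 2 * (2 * (1 * cmod ?z)) * (cmod ?z powr (- 2 * s) * cmod ?z powr - 2)"
        using ay assms by (intro mult_right_mono mult_left_mono mult_mono) auto
      also have "\<dots> = 2 * cmod ?z powr - 3 * cmod ?z powr (- 2 * s)"
        using zp powr_add[of "cmod ?z" "-2" "-2"] powr_add[of "cmod ?z" 1 "-4"] by simp
      finally show ?thesis .
    qed
    have "norm D \<le> 4 * cmod ?z powr - 3 * cmod ?z powr (- 2 * s)"
      unfolding D_def using norm_triangle_ineq4[of "- 2 * inverse (?z ^ 3) * of_real (A powr - s)" "inverse
        (?z\<^sup>2) * of_real (2 * s * y * A powr (- s - 1))"] n1 n2
      by linarith
    also have "\<dots> \<le> 4 * (((1 + 1 / v) ^ 3) * cmod (of_real x0 + \<i> * of_real a) powr - 3) * max 1 (v powr - 2)"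
    proof (intro mult_mono ps mult_left_mono)
      have "cmod (of_real x0 + \<i> * of_real a) = cmod (?z - of_real (y - x0))"
        by (simp add: algebra_simps)
      also have "\<dots> \<le> cmod ?z + \<bar>y - x0\<bar>" using norm_triangle_ineq4[of ?z "of_real (y - x0)"]
        by (simp del: of_real_diff)
      also have "\<dots> \<le> cmod ?z + 1" using y by auto
      also have "\<dots> \<le> (1 + 1 / v) * cmod ?z" using va assms(2) by (simp add: field_simps)
      finally have le: "cmod (of_real x0 + \<i> * of_real a) \<le> (1 + 1 / v) * cmod ?z" .
      have p0: "cmod (of_real x0 + \<i> * of_real a) > 0" using a by (auto simp: complex_eq_iff)
      have "((1 + 1 / v) * cmod ?z) powr - 3 \<le> cmod (of_real x0 + \<i> * of_real a) powr - 3"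
        using le p0 by (intro powr_mono2') auto
      then have "(1 + 1 / v) powr - 3 * cmod ?z powr - 3 \<le> cmod (of_real x0 + \<i> * of_real a) powr - 3"
        using assms(2) by (simp add: powr_mult)
      then have "(1 + 1 / v) ^ 3 * ((1 + 1 / v) powr - 3 * cmod ?z powr - 3)
        \<le> (1 + 1 / v) ^ 3 * cmod (of_real x0 + \<i> * of_real a) powr - 3"
        using assms(2) by (intro mult_left_mono) auto
      moreover have "(1 + 1 / v) ^ 3 * (1 + 1 / v) powr - 3 = 1"
      proof -
        have "1 + 1 / v > 0" using assms(2) by (simp add: add_pos_pos)
        then show ?thesis by (simp add: powr_minus powr_realpow)
      qed
      ultimately show "cmod ?z powr - 3 \<le> (1 + 1 / v) ^ 3 * cmod (of_real x0 + \<i> * of_real a) powr - 3"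
        by (simp flip: mult.assoc)
    qed (use assms in auto)
    finally show "norm D \<le> ?C" by (simp add: mult_ac)
  qed (use assms in auto)
  also have "\<dots> \<le> ?C * 1" using assms by (intro mult_left_mono) auto
  finally show ?thesis by simp
qed

text \<open>The increment of the antiderivative is the integral of the term over a unit interval; it
  differs from the value at the left end by no more than the term varies there.\<close>

lemma norm_hecke_antideriv_diff_le:
  assumes "a \<ge> v" "v > 0" "0 \<le> s" "s \<le> 1"
  shows "norm (1 / deform s (of_real x0 + \<i> * of_real a) - (hecke_antideriv s a (x0 + 1) - hecke_antideriv s a x0))
     \<le> 4 * max 1 (v powr - 2) * (1 + 1 / v) ^ 3 * cmod (of_real x0 + \<i> * of_real a) powr - 3" (is "_ \<le> ?C")
proof -
  let ?f = "\<lambda>x. 1 / deform s (of_real x + \<i> * of_real a)"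
  \<comment> \<open>Subtracting the linear function with slope \<open>?f x0\<close> leaves the
    derivative \<open>?f y - ?f x0\<close>, to which the previous estimate applies.\<close>
  let ?F = "\<lambda>x. hecke_antideriv s a x - of_real x * ?f x0"
  have a: "a > 0" using assms by simp
  have "norm (?F (x0 + 1) - ?F x0) \<le> ?C * norm (x0 + 1 - x0)"
  proof (rule norm_diff_le_vector_derivative[where S = "{x0..x0+1}"])
    fix y assume y: "y \<in> {x0..x0+1}"
    show "(?F has_vector_derivative (?f y - ?f x0)) (at y within {x0..x0+1})"
      by (rule has_vector_derivative_at_within)
         (auto intro!: derivative_eq_intros has_vector_derivative_hecke_antideriv[OF a assms(3)])
    show "norm (?f y - ?f x0) \<le> ?C"
      using y by (intro norm_inverse_deform_diff_le assms) auto
  qed auto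
  moreover have "?f x0 - (hecke_antideriv s a (x0 + 1) - hecke_antideriv s a x0) = - (?F (x0 + 1) - ?F x0)"
    by (simp add: add_divide_distrib)
  then have "norm (?f x0 - (hecke_antideriv s a (x0 + 1) - hecke_antideriv s a x0)) = norm (?F (x0 + 1) - ?F x0)"
    by (metis norm_minus_cancel)
  ultimately show ?thesis by (simp only: add_diff_cancel_left' norm_one mult_1_right)
qed

section \<open>Telescoping along a row and the pole of the zeta function\<close>

lemma filterlim_finite_subsets_at_topI:
  assumes "\<And>N. finite (A N)" "\<And>N. A N \<subseteq> X" "\<And>x. x \<in> X \<Longrightarrow> \<forall>\<^sub>F N in F. x \<in> A N"
  shows "filterlim A (finite_subsets_at_top X) F"
  unfolding filterlim_finite_subsets_at_top
proof (intro allI impI)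
  fix Y assume "finite Y \<and> Y \<subseteq> X"
  then have "\<forall>\<^sub>F N in F. \<forall>x\<in>Y. x \<in> A N" using assms(3) by (intro eventually_ball_finite) auto
  then show "\<forall>\<^sub>F N in F. finite (A N) \<and> Y \<subseteq> A N \<and> A N \<subseteq> X"
    by eventually_elim (use assms(1,2) in auto)
qed

lemma filterlim_int_interval:
  "filterlim (\<lambda>N. {- int N..<int N}) (finite_subsets_at_top UNIV) sequentially"
proof (rule filterlim_finite_subsets_at_topI)
  fix x :: int
  show "\<forall>\<^sub>F N in sequentially. x \<in> {- int N..<int N}"
    by (rule eventually_mono[OF eventually_ge_at_top[of "nat \<bar>x\<bar> + 1"]]) auto
qed auto

lemma infsum_int_telescope:
  fixes g :: "int \<Rightarrow> complex"
  assumes "(\<lambda>n. g (n + 1) - g n) summable_on UNIV"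
    and A: "(\<lambda>N. g (int N)) \<longlonglongrightarrow> A" and B: "(\<lambda>N. g (- int N)) \<longlonglongrightarrow> B"
  shows "(\<Sum>\<^sub>\<infinity>n. g (n + 1) - g n) = A - B"
proof (rule LIMSEQ_unique)
  show "(\<lambda>N. \<Sum>n\<in>{- int N..<int N}. g (n + 1) - g n) \<longlonglongrightarrow> (\<Sum>\<^sub>\<infinity>n. g (n + 1) - g n)"
    by (rule filterlim_compose[OF infsum_tendsto[OF assms(1)] filterlim_int_interval])
  have "(\<Sum>n\<in>{- int N..<int N}. g (n + 1) - g n) = g (int N) - g (- int N)" for N
  proof (induction N)
    case (Suc N)
    have st: "{- int (Suc N)..<int (Suc N)} = insert (int N) (insert (- int N - 1) {- int N..<int N})" by auto
    have ee: "- 1 - int N = - int N - 1" "1 + int N = int N + 1" by simp_all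
    show ?case unfolding st using Suc by (simp add: ee)
  qed auto
  then show "(\<lambda>N. \<Sum>n\<in>{- int N..<int N}. g (n + 1) - g n) \<longlonglongrightarrow> A - B"
    using tendsto_diff[OF A B] by simp
qed

text \<open>The value \<open>zeta (1 + 2 s)\<close>, summed over integers because they number the
  rows.\<close>

abbreviation zeta_sum :: "real \<Rightarrow> real" where
  "zeta_sum s \<equiv> \<Sum>\<^sub>\<infinity>m\<in>{1::int..}. of_int m powr (- 1 - 2 * s)"

text \<open>Integral test: by the mean value theorem the increments of the antiderivative
  \<open>g\<close> lie between consecutive terms, and they telescope to \<open>1 / (2 s)\<close>;
  the upper bound adds the first term of the series, which is 1.\<close>

lemma zeta_pole_bounds:
  fixes s :: real
  assumes "s > 0"
  shows "(\<lambda>m::int. of_int m powr (- 1 - 2 * s)) summable_on {1..}"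
    and "1 / 2 \<le> s * zeta_sum s"
    and "s * zeta_sum s \<le> 1 / 2 + s"
proof -
  define f where "f x = x powr (- 1 - 2 * s)" for x :: real
  define g where "g x = - (x powr (- 2 * s)) / (2 * s)" for x :: real
  have dg: "(g has_real_derivative f x) (at x)" if "x > 0" for x
  proof -
    have e: "- (s * 2) - 1 = - 1 - s * 2" by simp
    show ?thesis
      unfolding g_def f_def using that assms by (auto intro!: derivative_eq_intros simp: field_simps e)
  qed
  have mvt: "f (x + 1) \<le> g (x + 1) - g x" "g (x + 1) - g x \<le> f x" if x: "x > 0" for x
  proof -
    obtain y where y: "x < y" "y < x + 1" "g (x + 1) - g x = (x + 1 - x) * f y"
      using MVT2[of x "x + 1" g f] dg x by force
    then show "f (x + 1) \<le> g (x + 1) - g x" "g (x + 1) - g x \<le> f x"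
      using x assms by (auto simp: f_def intro!: powr_mono2')
  qed
  have sf: "summable (\<lambda>n. f (real (Suc n)))"
    unfolding f_def using assms by (subst summable_Suc_iff) (simp add: summable_real_powr_iff)
  have bij: "bij_betw (\<lambda>n. int n + 1) UNIV {1..}"
    by (rule bij_betwI[of _ _ _ "\<lambda>m. nat (m - 1)"]) auto
  have hs: "((\<lambda>n. f (real (Suc n))) has_sum (\<Sum>n. f (real (Suc n)))) UNIV"
    using sf by (intro sums_nonneg_imp_has_sum) (auto simp: f_def intro: summable_sums)
  then have hz: "((\<lambda>m::int. f (of_int m)) has_sum (\<Sum>n. f (real (Suc n)))) {1..}"
    by (subst has_sum_reindex_bij_betw[OF bij, symmetric]) (simp add: add.commute)
  then show "(\<lambda>m::int. of_int m powr (- 1 - 2 * s)) summable_on {1..}"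
    unfolding f_def by (rule has_sum_imp_summable)
  have Z: "zeta_sum s = (\<Sum>n. f (real (Suc n)))"
    using hz unfolding f_def by (rule infsumI)
  have "((\<lambda>x. - (x powr (- 2 * s)) / (2 * s)) \<longlongrightarrow> - 0 / (2 * s)) at_top"
    using assms by (intro tendsto_intros tendsto_neg_powr filterlim_ident) auto
  then have "(\<lambda>n. g (real (Suc n))) \<longlonglongrightarrow> - 0 / (2 * s)"
    unfolding g_def by (rule filterlim_compose) (rule
      filterlim_compose[OF filterlim_real_sequentially filterlim_Suc])
  from telescope_sums[OF this] have tele: "(\<lambda>n. g (real (Suc (Suc n))) - g (real (Suc n))) sums (1 / (2 * s))"
    by (simp add: g_def)
  have tele_eq: "g (real (Suc (Suc n))) - g (real (Suc n)) = g (real (Suc n) + 1) - g (real (Suc n))" for n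
    by (simp add: add.commute)
  have "1 / (2 * s) \<le> (\<Sum>n. f (real (Suc n)))"
    by (rule sums_le[OF _ tele summable_sums[OF sf]]) (unfold tele_eq, rule mvt, simp)
  then show "1 / 2 \<le> s * zeta_sum s"
    unfolding Z using assms by (simp add: field_simps)
  have sf2: "summable (\<lambda>n. f (real (Suc (Suc n))))" using sf summable_Suc_iff[of "\<lambda>n. f (real (Suc n))"] by simp
  have "(\<Sum>n. f (real (Suc (Suc n)))) \<le> 1 / (2 * s)"
    by (rule sums_le[OF _ summable_sums[OF sf2] tele]) (unfold tele_eq,
      metis mvt(1) of_nat_Suc add.commute of_nat_0_less_iff zero_less_Suc)
  moreover have "(\<Sum>n. f (real (Suc n))) = (\<Sum>n. f (real (Suc (Suc n)))) + 1"
    using suminf_split_head[OF sf] by (simp add: f_def)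
  ultimately show "s * zeta_sum s \<le> 1 / 2 + s"
    unfolding Z using assms by (simp add: field_simps)
qed

lemma tendsto_zeta_pole:
  "((\<lambda>s::real. s * zeta_sum s) \<longlongrightarrow> 1 / 2) (at_right 0)"
proof (rule tendsto_sandwich[of "\<lambda>_. 1 / 2" _ _ "\<lambda>s. 1 / 2 + s"])
  show "((\<lambda>s::real. 1 / 2 + s) \<longlongrightarrow> 1 / 2) (at_right 0)"
    by (rule tendsto_eq_rhs[OF tendsto_add[OF tendsto_const tendsto_ident_at]]) simp
  show "\<forall>\<^sub>F s::real in at_right 0. 1 / 2 \<le> s * zeta_sum s"
    by (rule eventually_mono[OF eventually_at_right_less]) (rule zeta_pole_bounds(2))
  show "\<forall>\<^sub>F s::real in at_right 0. s * zeta_sum s \<le> 1 / 2 + s"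
    by (rule eventually_mono[OF eventually_at_right_less]) (rule zeta_pole_bounds(3))
qed simp

text \<open>
  Hecke's trick: subtracting the telescoping increments of the antiderivative from the terms of a
  row leaves an error of order \<open>|\<omega>|\<^sup>-\<^sup>3\<close> uniformly in \<open>s\<close>, while the increments of row \<open>m\<close> add up to
  a multiple of \<open>s m\<^sup>-\<^sup>1\<^sup>-\<^sup>2\<^sup>s\<close>, so that the pole of the zeta function at \<open>1\<close> produces the
  non-holomorphic term.
\<close>

definition hecke_increment :: "complex \<Rightarrow> real \<Rightarrow> int \<times> int \<Rightarrow> complex" where
  "hecke_increment \<tau> s = (\<lambda>(m, n). if m > 0
     then hecke_antideriv s (of_int m * Im \<tau>) (of_int m * Re \<tau> + of_int n + 1)
          - hecke_antideriv s (of_int m * Im \<tau>) (of_int m * Re \<tau> + of_int n)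
     else 0)"

text \<open>For \<open>s = 0\<close> and a row \<open>m > 0\<close> this is
  \<open>1 / (w^2 (w + 1))\<close>, where \<open>w\<close> is the lattice point.\<close>

definition hecke_diff :: "complex \<Rightarrow> real \<Rightarrow> int \<times> int \<Rightarrow> complex" where
  "hecke_diff \<tau> s h = 1 / deform s (lattice_point \<tau> h) - hecke_increment \<tau> s h"

lemma lattice_point_Re_Im:
  "lattice_point \<tau> (m, n) = of_real (of_int m * Re \<tau> + of_int n) + \<i> * of_real (of_int m * Im \<tau>)"
  by (simp add: lattice_point_def complex_eq_iff)

text \<open>In rows \<open>m > 0\<close> the comparison with the integral leaves order
  \<open>|w|^(-3)\<close>. Row 0 has increment 0 and terms \<open>n^(-2-2s)\<close>, summable by
  themselves. Both bounds hold for all \<open>s\<close> in \<open>[0, 1]\<close>, which prepares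
  dominated convergence.\<close>

lemma norm_hecke_diff_le:
  assumes v: "Im \<tau> > 0"
  obtains M where "M summable_on half_lattice"
    "\<And>s h. 0 \<le> s \<Longrightarrow> s \<le> 1 \<Longrightarrow> h \<in> half_lattice \<Longrightarrow> norm (hecke_diff \<tau> s h) \<le> M h"
proof
  let ?v = "Im \<tau>"
  define C where "C = 4 * max 1 (?v powr - 2) * (1 + 1 / ?v) ^ 3"
  define M where "M h = (if fst h > 0 then C * cmod (lattice_point \<tau> h) powr - 3 else real_of_int
    (snd h) powr - 2)" for h
  have half: "half_lattice = ({1..} \<times> UNIV) \<union> ({0} \<times> {1..})"
    by (auto simp: half_lattice_def)
  have "(\<lambda>n::int. real_of_int n powr - 2) summable_on {1..}"
    using zeta_pole_bounds(1)[of "1/2"] by simp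
  then have "(\<lambda>h::int\<times>int. real_of_int (snd h) powr - 2) summable_on (Pair 0 ` {1..})"
    by (subst summable_on_reindex) (auto simp: o_def inj_on_def)
  also have "Pair (0::int) ` {1::int..} = {0} \<times> {1..}" by auto
  finally have B: "M summable_on ({0} \<times> {1..})"
    by (rule summable_on_cong[THEN iffD2, rotated]) (auto simp: M_def)
  have "(\<lambda>h. C * cmod (lattice_point \<tau> h) powr - 3) summable_on {1..} \<times> UNIV"
    using v by (intro summable_on_cmult_right summable_on_lattice_powr) auto
  then have A: "M summable_on {1..} \<times> UNIV"
    by (rule summable_on_cong[THEN iffD2, rotated]) (auto simp: M_def)
  show "M summable_on half_lattice"
    unfolding half by (rule summable_on_union[OF A B])
  fix s :: real and h assume s: "0 \<le> s" "s \<le> 1" and h: "h \<in> half_lattice"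
  obtain m n where mn: "h = (m, n)" by force
  show "norm (hecke_diff \<tau> s h) \<le> M h"
  proof (cases "m > 0")
    case True
    have "?v \<le> of_int m * ?v" using True v by simp
    from norm_hecke_antideriv_diff_le[OF this v s, of "of_int m * Re \<tau> + of_int n"] True
    show ?thesis
      unfolding mn hecke_diff_def hecke_increment_def lattice_point_Re_Im M_def C_def
      by (simp add: add.assoc)
  next
    case False
    then have "m = 0" "n > 0" using h mn by (auto simp: half_lattice_def)
    then have "norm (hecke_diff \<tau> s h) = real_of_int n powr - (2 + 2 * s)"
      by (simp add: mn hecke_diff_def hecke_increment_def norm_inverse_deform lattice_point_def del: minus_add_distrib)
    also have "\<dots> \<le> real_of_int n powr - 2" using s \<open>n > 0\<close> by (intro powr_mono) auto
    finally show ?thesis using False by (simp add: M_def mn)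
  qed
qed

text \<open>\<open>hecke_primitive s\<close> is chosen anew for each \<open>s\<close>, so nothing is
  known about its continuity in \<open>s\<close>; the uniform bound \<open>pi / 2\<close> against
  the vanishing factor \<open>s\<close> settles the limit.\<close>

lemma tendsto_hecke_antideriv_0:
  assumes "a > 0"
  shows "((\<lambda>s. hecke_antideriv s a x) \<longlongrightarrow> hecke_antideriv 0 a x) (at_right 0)"
proof -
  have 1: "x\<^sup>2 + a\<^sup>2 \<noteq> 0" using assms by (simp add: sum_power2_eq_zero_iff)
  have "((\<lambda>s. s * a powr (- 1 - 2 * s) * hecke_primitive s (x / a)) \<longlongrightarrow> 0) (at_right 0)"
  proof (rule tendsto_0_le[where K = "pi / 2"])
    have "((\<lambda>s. s * a powr (- 1 - 2 * s)) \<longlongrightarrow> 0 * a powr (- 1 - 2 * 0)) (at_right 0)"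
      using assms by (intro tendsto_intros) auto
    then show "((\<lambda>s. s * a powr (- 1 - 2 * s)) \<longlongrightarrow> 0) (at_right 0)" by simp
    show "\<forall>\<^sub>F s in at_right 0. norm (s * a powr (- 1 - 2 * s) * hecke_primitive s (x / a))
      \<le> norm (s * a powr (- 1 - 2 * s)) * (pi / 2)"
      by (rule eventually_mono[OF eventually_at_right_less])
         (use hecke_primitive(3) in \<open>auto simp: abs_mult intro!: mult_left_mono\<close>)
  qed
  then have "((\<lambda>s. hecke_antideriv s a x) \<longlongrightarrow>
      (- inverse (of_real x + \<i> * of_real a) * of_real ((x\<^sup>2 + a\<^sup>2) powr - 0) - of_real 0) / of_real (1
        + 0)) (at_right 0)"
    unfolding hecke_antideriv_def using 1 by (intro tendsto_intros) auto
  then show ?thesis by (simp add: hecke_antideriv_def)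
qed

lemma tendsto_hecke_diff:
  assumes "Im \<tau> > 0" "h \<in> half_lattice"
  shows "((\<lambda>s. hecke_diff \<tau> s h) \<longlongrightarrow> hecke_diff \<tau> 0 h) (at_right 0)"
proof -
  have ne: "lattice_point \<tau> h \<noteq> 0" using assms zero_notin_half_lattice lattice_point_eq_0_iff by metis
  have "((\<lambda>s. 1 / deform s (lattice_point \<tau> h)) \<longlongrightarrow> 1 / deform 0 (lattice_point \<tau> h)) (at_right 0)"
    using ne by (auto intro!: tendsto_intros tendsto_deform simp: deform_0)
  moreover have "((\<lambda>s. hecke_increment \<tau> s h) \<longlongrightarrow> hecke_increment \<tau> 0 h) (at_right 0)"
    using assms by (auto simp: hecke_increment_def split: prod.splits intro!: tendsto_diff tendsto_hecke_antideriv_0)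
  ultimately show ?thesis unfolding hecke_diff_def by (rule tendsto_diff)
qed

lemma tendsto_hecke_antideriv_at_infinity:
  assumes a: "a > 0" and s: "s \<ge> 0"
  shows "(hecke_antideriv s a \<longlongrightarrow> - of_real (s * a powr (- 1 - 2 * s) * hecke_limit s) / of_real (1 + s)) at_top"
    and "((\<lambda>x. hecke_antideriv s a (- x)) \<longlongrightarrow> of_real (s * a powr (- 1 - 2 * s) * hecke_limit s) / of_real (1
      + s)) at_top"
proof -
  \<comment> \<open>The sign \<open>c\<close> covers both ends of the row at once.\<close>
  have i: "((\<lambda>x. inverse (of_real (c * x) + \<i> * of_real a) * of_real (((c * x)\<^sup>2 + a\<^sup>2) powr - s)) \<longlongrightarrow> 0) at_top"
    if c: "c = 1 \<or> c = -1" for c :: real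
  proof (rule tendsto_0_le[where K = "(a\<^sup>2) powr - s"])
    show "((\<lambda>x::real. inverse x) \<longlongrightarrow> 0) at_top" by (rule tendsto_inverse_0_at_top) (rule filterlim_ident)
    show "\<forall>\<^sub>F x in at_top. norm (inverse (of_real (c * x) + \<i> * of_real a) * of_real (((c * x)\<^sup>2 + a\<^sup>2) powr
      - s)) \<le> norm (inverse x) * (a\<^sup>2) powr - s"
      using eventually_gt_at_top[of 0]
    proof eventually_elim
      case (elim x)
      have "x \<le> cmod (of_real (c * x) + \<i> * of_real a)"
        using abs_Re_le_cmod[of "of_real (c * x) + \<i> * of_real a"] c by auto
      then have "inverse (cmod (of_real (c * x) + \<i> * of_real a)) \<le> inverse x"
        using elim by (intro le_imp_inverse_le) auto
      moreover have "((c * x)\<^sup>2 + a\<^sup>2) powr - s \<le> (a\<^sup>2) powr - s"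
        using a s by (intro powr_mono2') auto
      ultimately show ?case using elim unfolding norm_mult norm_inverse norm_of_real by (intro mult_mono) auto
    qed
  qed
  have lim: "((\<lambda>x. hecke_primitive s (x / a)) \<longlongrightarrow> hecke_limit s) at_top"
    by (rule filterlim_compose[OF hecke_primitive(4)[OF s]])
       (use a in \<open>auto intro!: filterlim_at_top_mult_tendsto_pos simp: divide_inverse intro: filterlim_ident tendsto_const
          filterlim_tendsto_pos_mult_at_top[OF tendsto_const _ filterlim_ident, of "inverse a",
            simplified mult.commute]\<close>)
  have s1: "1 + s \<noteq> 0" using s by linarith
  have "((\<lambda>x. (- (inverse (of_real (1 * x) + \<i> * of_real a) * of_real (((1 * x)\<^sup>2 + a\<^sup>2) powr - s))
      - of_real (s * a powr (- 1 - 2 * s) * hecke_primitive s (x / a))) / of_real (1 + s))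
     \<longlongrightarrow> (- 0 - of_real (s * a powr (- 1 - 2 * s) * hecke_limit s)) / of_real (1 + s)) at_top"
    using s1 by (intro tendsto_intros i lim) (auto simp del: of_real_add)
  then show "(hecke_antideriv s a \<longlongrightarrow> - of_real (s * a powr (- 1 - 2 * s) * hecke_limit s) / of_real (1 + s)) at_top"
    by (simp add: hecke_antideriv_def[abs_def])
  have "((\<lambda>x. (- (inverse (of_real (-1 * x) + \<i> * of_real a) * of_real (((-1 * x)\<^sup>2 + a\<^sup>2) powr - s))
      + of_real (s * a powr (- 1 - 2 * s) * hecke_primitive s (x / a))) / of_real (1 + s))
     \<longlongrightarrow> (- 0 + of_real (s * a powr (- 1 - 2 * s) * hecke_limit s)) / of_real (1 + s)) at_top"
    using s1 by (intro tendsto_intros i lim) (auto simp del: of_real_add)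
  then show "((\<lambda>x. hecke_antideriv s a (- x)) \<longlongrightarrow> of_real (s * a powr (- 1 - 2 * s) * hecke_limit s) / of_real
    (1 + s)) at_top"
    using hecke_primitive(2)[OF s] by (simp add: hecke_antideriv_def)
qed

text \<open>The two ends of the row have opposite limits, which doubles the value, and
  \<open>(m * Im \<tau>) powr (- 1 - 2 * s)\<close> splits off the power of \<open>m\<close>. At
  \<open>s = 0\<close> the row sum vanishes.\<close>

lemma infsum_hecke_increment_row:
  assumes "Im \<tau> > 0" "m > 0" "s \<ge> 0" "(\<lambda>n. hecke_increment \<tau> s (m, n)) summable_on UNIV"
  shows "(\<Sum>\<^sub>\<infinity>n. hecke_increment \<tau> s (m, n)) =
    of_real (- 2 * s * hecke_limit s * (Im \<tau>) powr (- 1 - 2 * s) / (1 + s) * (of_int m powr (- 1 - 2 * s)))"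
proof -
  let ?a = "of_int m * Im \<tau>" and ?b = "of_int m * Re \<tau>"
  have a: "?a > 0" using assms by simp
  define g where "g n = hecke_antideriv s ?a (?b + of_int n)" for n :: int
  have g: "hecke_increment \<tau> s (m, n) = g (n + 1) - g n" for n
    using assms by (simp add: hecke_increment_def g_def add.assoc)
  let ?L = "of_real (s * ?a powr (- 1 - 2 * s) * hecke_limit s) / of_real (1 + s) :: complex"
  have "filterlim (\<lambda>N. ?b + real N) at_top sequentially" "filterlim (\<lambda>N. - ?b + real N) at_top sequentially"
    by (intro filterlim_tendsto_add_at_top[OF tendsto_const filterlim_real_sequentially])+
  from filterlim_compose[OF tendsto_hecke_antideriv_at_infinity(1)[OF a assms(3)] this(1)]
       filterlim_compose[OF tendsto_hecke_antideriv_at_infinity(2)[OF a assms(3)] this(2)]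
  have "(\<lambda>N. g (int N)) \<longlonglongrightarrow> - ?L" "(\<lambda>N. g (- int N)) \<longlonglongrightarrow> ?L"
    by (simp_all add: g_def)
  from infsum_int_telescope[OF _ this] assms(4)
  have "(\<Sum>\<^sub>\<infinity>n. hecke_increment \<tau> s (m, n)) = - 2 * ?L" by (simp add: g)
  then show ?thesis using assms by (simp add: powr_mult)
qed

text \<open>
  In every row the increments telescope to \<open>0\<close> for \<open>s = 0\<close>, so this is the sum of \<open>1 / \<omega>\<^sup>2\<close> over the
  half lattice, taken row by row; see \<open>infsum_row_hecke_diff\<close>.
\<close>

definition eisenstein_term :: "complex \<Rightarrow> complex" where
  "eisenstein_term \<tau> = (\<Sum>\<^sub>\<infinity>h\<in>half_lattice. hecke_diff \<tau> 0 h)"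

theorem tendsto_power_sum_1:
  assumes v: "Im \<tau> > 0"
  shows "((\<lambda>s. power_sum \<tau> s 1) \<longlongrightarrow> eisenstein_term \<tau> - of_real (pi / (2 * Im \<tau>))) (at_right 0)"
proof -
  obtain M where M: "M summable_on half_lattice"
    and le: "\<And>s h. 0 \<le> s \<Longrightarrow> s \<le> 1 \<Longrightarrow> h \<in> half_lattice \<Longrightarrow> norm (hecke_diff \<tau> s h) \<le> M h"
    using norm_hecke_diff_le[OF v] by blast
  have sub: "{1..} \<times> UNIV \<subseteq> half_lattice" by (auto simp: half_lattice_def)
  have lim1: "((\<lambda>s. \<Sum>\<^sub>\<infinity>h\<in>half_lattice. hecke_diff \<tau> s h) \<longlongrightarrow> eisenstein_term \<tau>) (at_right 0)"
    unfolding eisenstein_term_def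
  proof (rule conjunct2[OF tendsto_infsum_dominated[OF tendsto_hecke_diff[OF v] _ M]])
    show "\<forall>\<^sub>F s in at_right 0. \<forall>h\<in>half_lattice. norm (hecke_diff \<tau> s h) \<le> M h"
      by (rule eventually_mono[OF eventually_at_right_real[of 0 1]]) (use le in auto)
  qed auto
  have eq: "power_sum \<tau> s 1 = (\<Sum>\<^sub>\<infinity>h\<in>half_lattice. hecke_diff \<tau> s h)
      + of_real (- 2 * hecke_limit s * (Im \<tau>) powr (- 1 - 2 * s) / (1 + s) * (s * zeta_sum s))"
    if s: "s \<in> {0<..<1}" for s
  proof -
    have f: "(\<lambda>h. 1 / deform s (lattice_point \<tau> h)) summable_on half_lattice"
    proof (rule abs_summable_summable)
      show "(\<lambda>h. norm (1 / deform s (lattice_point \<tau> h))) summable_on half_lattice"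
        unfolding norm_inverse_deform using s v zero_notin_half_lattice by (intro summable_on_lattice_powr) auto
    qed
    have D: "hecke_diff \<tau> s summable_on half_lattice"
      by (rule abs_summable_summable, rule Infinite_Sum.abs_summable_on_comparison_test'[OF M]) (use s le in auto)
    \<comment> \<open>For \<open>s > 0\<close> the terms themselves are absolutely summable, so the
      increments inherit summability as a difference and may be summed by rows.\<close>
    have I: "hecke_increment \<tau> s summable_on half_lattice"
      using summable_on_add[OF f summable_on_uminus[THEN iffD2, OF D]] by (simp add: hecke_diff_def)
    have I2: "hecke_increment \<tau> s summable_on {1..} \<times> UNIV" by (rule summable_on_subset_banach[OF I sub])
    have "power_sum \<tau> s 1 = (\<Sum>\<^sub>\<infinity>h\<in>half_lattice. hecke_diff \<tau> s h + hecke_increment \<tau> s h)"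
      by (simp add: power_sum_def hecke_diff_def)
    also have "\<dots> = (\<Sum>\<^sub>\<infinity>h\<in>half_lattice. hecke_diff \<tau> s h) + (\<Sum>\<^sub>\<infinity>h\<in>half_lattice. hecke_increment \<tau> s h)"
      by (rule infsum_add[OF D I])
    also have "(\<Sum>\<^sub>\<infinity>h\<in>half_lattice. hecke_increment \<tau> s h) = (\<Sum>\<^sub>\<infinity>h\<in>{1..} \<times> UNIV. hecke_increment \<tau> s h)"
      by (rule infsum_cong_neutral) (auto simp: half_lattice_def hecke_increment_def)
    also have "\<dots> = (\<Sum>\<^sub>\<infinity>m\<in>{1..}. \<Sum>\<^sub>\<infinity>n. hecke_increment \<tau> s (m, n))"
      by (rule infsum_Sigma_banach[OF I2, symmetric])
    also have "\<dots> = (\<Sum>\<^sub>\<infinity>m\<in>{1::int..}. of_real (- 2 * s * hecke_limit s * (Im \<tau>) powr (- 1 - 2 * s) / (1 + s)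
      * (of_int m powr (- 1 - 2 * s))))"
    proof (rule infsum_cong, rule infsum_hecke_increment_row[OF v])
      fix m :: int assume m: "m \<in> {1..}"
      then show "0 < m" by simp
      show "(\<lambda>n. hecke_increment \<tau> s (m, n)) summable_on UNIV"
        using summable_on_SigmaD1[of "\<lambda>m n. hecke_increment \<tau> s (m, n)" "{1..}" "\<lambda>_. UNIV", OF _ m] I2 by simp
    qed (use s in auto)
    also have "\<dots> = of_real (- 2 * s * hecke_limit s * (Im \<tau>) powr (- 1 - 2 * s) / (1 + s) * zeta_sum s)"
      using s by (intro infsumI has_sum_of_real has_sum_cmult_right has_sum_infsum zeta_pole_bounds(1)) auto
    finally show ?thesis by (simp add: mult_ac)
  qed
  \<comment> \<open>Here \<open>hecke_limit s\<close> tends to \<open>pi / 2\<close> and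
    \<open>s * zeta_sum s\<close> to \<open>1 / 2\<close>; with the factor tending to
    \<open>- 2 / Im \<tau>\<close> they produce \<open>- pi / (2 * Im \<tau>)\<close>.\<close>
  have "((\<lambda>s. (\<Sum>\<^sub>\<infinity>h\<in>half_lattice. hecke_diff \<tau> s h)
      + of_real (- 2 * hecke_limit s * (Im \<tau>) powr (- 1 - 2 * s) / (1 + s) * (s * zeta_sum s)))
     \<longlongrightarrow> eisenstein_term \<tau> + of_real (- 2 * (pi / 2) * (Im \<tau>) powr (- 1 - 2 * 0) / (1 + 0) * (1 / 2))) (at_right 0)"
    using v by (intro tendsto_intros lim1 tendsto_hecke_limit tendsto_zeta_pole) auto
  also have "eisenstein_term \<tau> + of_real (- 2 * (pi / 2) * (Im \<tau>) powr (- 1 - 2 * 0) / (1 + 0) * (1 / 2))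
    = eisenstein_term \<tau> - of_real (pi / (2 * Im \<tau>))"
    using v by (simp add: powr_neg_one)
  finally show ?thesis
    by (rule Lim_transform_eventually)
       (rule eventually_mono[OF eventually_at_right_real[of 0 1, OF zero_less_one]], rule eq[symmetric])
qed

subsection \<open>The Jacobi form as a product of sines\<close>

abbreviation sinpi :: "complex \<Rightarrow> complex" where
  "sinpi z \<equiv> sin (of_real pi * z)"

text \<open>With \<open>q = nome \<tau>\<close> this is
  \<open>- 1 / (4 sin^2 (pi m \<tau>))\<close>, so the factor
  \<open>1 - sin^2 (pi z) / sin^2 (pi m \<tau>)\<close> is \<open>1 + y * lambert q m\<close> for
  \<open>y = 4 sin^2 (pi z)\<close>.\<close>

definition lambert :: "complex \<Rightarrow> nat \<Rightarrow> complex" where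
  "lambert q m = q ^ m / (1 - q ^ m)\<^sup>2"

lemma norm_lambert_le:
  assumes "norm q \<le> \<rho>" "\<rho> < 1" "m \<ge> 1"
  shows "norm (lambert q m) \<le> \<rho> ^ m / (1 - \<rho>)\<^sup>2"
proof -
  have \<rho>: "0 \<le> \<rho>" using assms(1) norm_ge_zero order.trans by blast
  have qm: "norm (q ^ m) \<le> \<rho> ^ m" using assms by (simp add: norm_power power_mono)
  have "\<rho> ^ m \<le> \<rho> ^ 1" using assms \<rho> by (intro power_decreasing) auto
  then have "1 - \<rho> \<le> norm (1 - q ^ m)"
    using qm norm_triangle_ineq2[of 1 "q ^ m"] by simp
  then have "(1 - \<rho>)\<^sup>2 \<le> norm ((1 - q ^ m)\<^sup>2)"
    using assms by (simp add: norm_power power_mono)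
  then show ?thesis unfolding lambert_def norm_divide
    using qm assms \<rho> by (intro frac_le) auto
qed

lemma summable_on_geometric_from_1:
  assumes "0 \<le> (\<rho>::real)" "\<rho> < 1"
  shows "(\<lambda>m. \<rho> ^ m / c) summable_on {1..}"
  using has_sum_divide_const[OF has_sum_geometric_from_1, of \<rho> c] assms has_sum_imp_summable by auto

lemma lambert_abs_summable:
  assumes "norm q < 1"
  shows "(\<lambda>m. norm (lambert q m)) summable_on {1..}"
  by (rule Infinite_Sum.abs_summable_on_comparison_test'[OF summable_on_geometric_from_1[of "norm q"]])
     (use assms norm_lambert_le[OF order.refl assms] in auto)

definition nome :: "complex \<Rightarrow> complex" where
  "nome \<tau> = exp (2 * of_real pi * \<i> * \<tau>)"

lemma norm_nome_less_1: "Im \<tau> > 0 \<Longrightarrow> norm (nome \<tau>) < 1"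
  by (simp add: nome_def)

text \<open>The product of all \<open>1 + y * lambert q m\<close>, expanded in \<open>y\<close>. In
  this form it is entire in \<open>y\<close> with coefficients holomorphic in \<open>q\<close>,
  which serves both the joint holomorphy and the Fourier expansion.\<close>

definition lambert_gen :: "complex \<Rightarrow> complex \<Rightarrow> complex" where
  "lambert_gen y q = (\<Sum>k. esym k (lambert q) {1..} * y ^ k)"

text \<open>Classically \<open>theta_1 (z) / theta_1' (0)\<close>: with
  \<open>zeta = exp (2 pi i z)\<close>, the factor of index \<open>m\<close> is
  \<open>(1 - zeta q^m) (1 - q^m / zeta) / (1 - q^m)^2\<close>.\<close>

definition jacobi_phi :: "complex \<Rightarrow> complex \<Rightarrow> complex" where
  "jacobi_phi z \<tau> = sinpi z / of_real pi * lambert_gen (4 * (sinpi z)\<^sup>2) (nome \<tau>)"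

lemma sin_square_eq_exp: "(sin w)\<^sup>2 = - ((1 - exp (2 * \<i> * w))\<^sup>2 / (4 * exp (2 * \<i> * w)))" for w :: complex
proof -
  have e: "exp (2 * \<i> * w) = exp (\<i> * w) * exp (\<i> * w)"
    by (simp flip: exp_add add: algebra_simps)
  have "sin w = (exp (\<i> * w) - inverse (exp (\<i> * w))) / (2 * \<i>)"
    by (simp add: sin_exp_eq exp_minus)
  moreover have "((x - inverse x) / (2 * \<i>))\<^sup>2 = - ((1 - x * x)\<^sup>2 / (4 * (x * x)))" if "x \<noteq> 0" for x :: complex
    using that by (simp add: field_simps power2_eq_square)
  ultimately show ?thesis unfolding e by simp
qed

lemma sin_mult_tau_nonzero:
  assumes "Im a \<noteq> 0"
  shows "sinpi a \<noteq> 0"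
proof
  assume "sinpi a = 0"
  then obtain n :: int where "of_real pi * a = of_real (of_int n * pi)" by (auto simp: sin_eq_0)
  then have "Im (of_real pi * a) = 0" by (metis Im_complex_of_real)
  then show False using assms by simp
qed

lemma sin_mult_sin: "sin (a - z) * sin (a + z) = (sin a)\<^sup>2 - (sin z)\<^sup>2" for a z :: complex
proof -
  have "sin (a - z) * sin (a + z) = (sin a)\<^sup>2 * (cos z)\<^sup>2 - (cos a)\<^sup>2 * (sin z)\<^sup>2"
    by (simp add: sin_add sin_diff power2_eq_square algebra_simps)
  also have "\<dots> = (sin a)\<^sup>2 - (sin z)\<^sup>2"
    unfolding cos_squared_eq by (simp add: algebra_simps)
  finally show ?thesis .
qed

lemma one_plus_lambert_eq:
  assumes "Im \<tau> > 0" "m \<ge> 1"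
  shows "1 + 4 * (sinpi z)\<^sup>2 * lambert (nome \<tau>) m =
    sinpi (of_nat m * \<tau> - z) * sinpi (of_nat m * \<tau> + z) / (sinpi (of_nat m * \<tau>))\<^sup>2"
proof -
  let ?s = "sinpi (of_nat m * \<tau>)"
  have s: "?s \<noteq> 0" using assms by (intro sin_mult_tau_nonzero) auto
  have e: "exp (2 * \<i> * (of_real pi * (of_nat m * \<tau>))) = nome \<tau> ^ m"
    by (simp add: nome_def exp_of_nat_mult[symmetric] mult_ac)
  have "?s\<^sup>2 = - ((1 - nome \<tau> ^ m)\<^sup>2 / (4 * nome \<tau> ^ m))"
    using sin_square_eq_exp[of "of_real pi * (of_nat m * \<tau>)"] by (simp only: e)
  then have "1 / ?s\<^sup>2 = - (4 * lambert (nome \<tau>) m)" by (simp add: lambert_def)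
  then have l: "4 * lambert (nome \<tau>) m = - (1 / ?s\<^sup>2)" by simp
  have "1 + 4 * (sinpi z)\<^sup>2 * lambert (nome \<tau>) m = 1 + (sinpi z)\<^sup>2 * (4 * lambert (nome \<tau>) m)"
    by simp
  also have "\<dots> = (?s\<^sup>2 - (sinpi z)\<^sup>2) / ?s\<^sup>2"
    unfolding l using s by (simp add: field_simps)
  finally show ?thesis unfolding sin_mult_sin[symmetric] by (simp only: ring_distribs)
qed

section \<open>The elliptic transformation law\<close>

definition jacobi_phi_partial :: "nat \<Rightarrow> complex \<Rightarrow> complex \<Rightarrow> complex" where
  "jacobi_phi_partial M z \<tau> = sinpi z / of_real pi *
     (\<Prod>m=1..M. sinpi (of_nat m * \<tau> - z) * sinpi (of_nat m * \<tau> + z) / (sinpi (of_nat m * \<tau>))\<^sup>2)"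

lemma tendsto_jacobi_phi_partial:
  assumes "Im \<tau> > 0"
  shows "(\<lambda>M. jacobi_phi_partial M z \<tau>) \<longlonglongrightarrow> jacobi_phi z \<tau>"
proof -
  have "(\<lambda>M. \<Prod>m=1..M. 1 + 4 * (sinpi z)\<^sup>2 * lambert (nome \<tau>) m) \<longlonglongrightarrow>
      lambert_gen (4 * (sinpi z)\<^sup>2) (nome \<tau>)"
    unfolding lambert_gen_def
    by (rule prod_one_plus_tendsto_esym_series[OF lambert_abs_summable[OF norm_nome_less_1[OF assms]]])
  moreover have "(\<Prod>m=1..M. 1 + 4 * (sinpi z)\<^sup>2 * lambert (nome \<tau>) m) =
     (\<Prod>m=1..M. sinpi (of_nat m * \<tau> - z) * sinpi (of_nat m * \<tau> + z) / (sinpi (of_nat m * \<tau>))\<^sup>2)" for M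
    by (intro prod.cong refl one_plus_lambert_eq assms) auto
  ultimately show ?thesis
    unfolding jacobi_phi_partial_def jacobi_phi_def by (auto intro!: tendsto_intros)
qed

text \<open>Shifting \<open>z\<close> by \<open>\<tau>\<close> moves every factor of the product by
  one index, so all but the factors at the ends cancel. The relation is stated without a quotient
  since \<open>sinpi (M * \<tau> - z)\<close> may vanish.\<close>

lemma jacobi_phi_partial_shift:
  "jacobi_phi_partial M (z + \<tau>) \<tau> * sinpi (of_nat M * \<tau> - z) =
   - jacobi_phi_partial M z \<tau> * sinpi (of_nat (Suc M) * \<tau> + z)"
proof (induction M)
  case 0
  show ?case using sin_minus[of "of_real pi * z"] by (simp add: jacobi_phi_partial_def add.commute)
next
  case (Suc M)
  define g where "g w = sinpi w" for w :: complex
  let ?d = "(g (of_nat (Suc M) * \<tau>))\<^sup>2"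
  have st: "jacobi_phi_partial (Suc M) w \<tau> = jacobi_phi_partial M w \<tau> * (g (of_nat (Suc M) * \<tau> - w) * g
    (of_nat (Suc M) * \<tau> + w) / ?d)" for w
    by (simp add: jacobi_phi_partial_def g_def)
  have e: "of_nat (Suc M) * \<tau> - (z + \<tau>) = of_nat M * \<tau> - z" "of_nat (Suc M) * \<tau> + (z + \<tau>)
    = of_nat (Suc (Suc M)) * \<tau> + z"
    by (simp_all add: algebra_simps)
  have "jacobi_phi_partial (Suc M) (z + \<tau>) \<tau> * g (of_nat (Suc M) * \<tau> - z) =
      (jacobi_phi_partial M (z + \<tau>) \<tau> * g (of_nat M * \<tau> - z)) * g (of_nat (Suc (Suc M)) * \<tau> + z) * g (of_nat
        (Suc M) * \<tau> - z) / ?d"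
    unfolding st e by simp
  also have "\<dots> = - jacobi_phi_partial (Suc M) z \<tau> * g (of_nat (Suc (Suc M)) * \<tau> + z)"
    unfolding Suc.IH[folded g_def] st by simp
  finally show ?case by (simp only: g_def)
qed

lemma jacobi_phi_shift_1: "jacobi_phi (z + 1) \<tau> = - jacobi_phi z \<tau>"
proof -
  have "sinpi (z + 1) = - sinpi z"
    by (simp add: ring_distribs sin_add flip: of_real_mult)
  then show ?thesis by (simp add: jacobi_phi_def)
qed

text \<open>Write \<open>sinpi w\<close> as \<open>(E w - 1) exp (- i pi w) / (2 i)\<close>. In the
  two end factors \<open>E\<close> carries the power \<open>q^M\<close> and vanishes in the limit,
  so both brackets tend to -1, and the quotient of the remaining exponentials is independent of
  \<open>M\<close>: it is the automorphy factor.\<close>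

lemma jacobi_phi_shift_tau:
  assumes "Im \<tau> > 0"
  shows "jacobi_phi (z + \<tau>) \<tau> = - exp (- (of_real pi * \<i> * (\<tau> + 2 * z))) * jacobi_phi z \<tau>"
proof -
  define E where "E w = exp (2 * \<i> * of_real pi * w)" for w
  have sinE: "sinpi w = (E w - 1) * exp (- (\<i> * of_real pi * w)) / (2 * \<i>)" for w
  proof -
    have "E w * exp (- (\<i> * of_real pi * w)) = exp (\<i> * of_real pi * w)"
      unfolding E_def by (simp flip: exp_add) (simp add: mult_ac)
    then show ?thesis by (simp add: sin_exp_eq algebra_simps)
  qed
  have qE: "E (of_nat M * \<tau> + w) = nome \<tau> ^ M * E w" for M w
    by (simp add: E_def nome_def exp_of_nat_mult[symmetric] ring_distribs mult_ac add_ac flip: exp_add)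
  have q0: "(\<lambda>M. nome \<tau> ^ M) \<longlonglongrightarrow> 0"
    by (rule LIMSEQ_power_zero[OF norm_nome_less_1[OF assms]])
  have lim: "(\<lambda>M. E (of_nat M * \<tau> + w) - 1) \<longlonglongrightarrow> 0 * E w - 1" for w
    unfolding qE by (intro tendsto_intros q0)
  have "(\<lambda>M. jacobi_phi_partial M (z + \<tau>) \<tau> * (E (of_nat M * \<tau> + - z) - 1))
    \<longlonglongrightarrow> jacobi_phi (z + \<tau>) \<tau> * (0 * E (- z) - 1)"
    by (intro tendsto_mult tendsto_jacobi_phi_partial assms lim)
  moreover have "(\<lambda>M. - exp (- (of_real pi * \<i> * (\<tau> + 2 * z))) * jacobi_phi_partial M z \<tau> * (E (of_nat M * \<tau>
    + (\<tau> + z)) - 1))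
      \<longlonglongrightarrow> - exp (- (of_real pi * \<i> * (\<tau> + 2 * z))) * jacobi_phi z \<tau> * (0 * E (\<tau> + z) - 1)"
    by (intro tendsto_mult tendsto_const tendsto_jacobi_phi_partial assms lim)
  moreover have "jacobi_phi_partial M (z + \<tau>) \<tau> * (E (of_nat M * \<tau> + - z) - 1) =
     - exp (- (of_real pi * \<i> * (\<tau> + 2 * z))) * jacobi_phi_partial M z \<tau> * (E (of_nat M * \<tau> + (\<tau> + z)) - 1)" for M
  proof -
    have a: "of_nat M * \<tau> - z = of_nat M * \<tau> + - z" "of_nat (Suc M) * \<tau> + z = of_nat M * \<tau> + (\<tau> + z)"
      by (simp_all add: algebra_simps)
    have e: "exp (- (\<i> * of_real pi * (of_nat M * \<tau> + (\<tau> + z)))) =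
        exp (- (of_real pi * \<i> * (\<tau> + 2 * z))) * exp (- (\<i> * of_real pi * (of_nat M * \<tau> + - z)))"
      by (simp flip: exp_add) (simp add: algebra_simps)
    \<comment> \<open>Cancels the common exponential, which never vanishes, from the relation
      between the partial products.\<close>
    have c: "x = y" if "x * (k / (2 * \<i>)) = y * (k / (2 * \<i>))" "k \<noteq> 0" for x y k :: complex
      using that by simp
    show ?thesis
    proof (rule c)
      show "jacobi_phi_partial M (z + \<tau>) \<tau> * (E (of_nat M * \<tau> + - z) - 1) * (exp (- (\<i> * of_real pi *
        (of_nat M * \<tau> + - z))) / (2 * \<i>)) =
        - exp (- (of_real pi * \<i> * (\<tau> + 2 * z))) * jacobi_phi_partial M z \<tau> * (E (of_nat M * \<tau> + (\<tau> + z))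
          - 1) * (exp (- (\<i> * of_real pi * (of_nat M * \<tau> + - z))) / (2 * \<i>))"
        using jacobi_phi_partial_shift[of M z \<tau>] unfolding a sinE e by (simp add: mult_ac)
    qed simp
  qed
  ultimately have "jacobi_phi (z + \<tau>) \<tau> * (0 * E (- z) - 1) = - exp (- (of_real pi * \<i> * (\<tau> + 2 * z)))
    * jacobi_phi z \<tau> * (0 * E (\<tau> + z) - 1)"
    by (simp only: LIMSEQ_unique)
  then have "- jacobi_phi (z + \<tau>) \<tau> = exp (- (of_real pi * \<i> * (\<tau> + 2 * z))) * jacobi_phi z \<tau>" by simp
  then show ?thesis by (metis minus_equation_iff mult_minus_left)
qed

lemma jacobi_phi_elliptic_int: "jacobi_phi (z + of_int \<mu>) \<tau> = (- 1) powi \<mu> * jacobi_phi z \<tau>"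
proof (induction \<mu> rule: int_induct[where k = 0])
  case (step1 i)
  then show ?case using jacobi_phi_shift_1[of "z + of_int i" \<tau>] by (simp add: add.assoc power_int_add)
next
  case (step2 i)
  then show ?case using jacobi_phi_shift_1[of "z + of_int (i - 1)" \<tau>] by (simp add: add.assoc power_int_diff)
qed simp

lemma jacobi_phi_elliptic_tau:
  assumes "Im \<tau> > 0"
  shows "jacobi_phi (z + of_int l * \<tau>) \<tau> =
    (- 1) powi l * exp (- (of_real pi * \<i> * ((of_int l)\<^sup>2 * \<tau> + 2 * of_int l * z))) * jacobi_phi z \<tau>"
proof (induction l rule: int_induct[where k = 0])
  case (step1 i)
  have "jacobi_phi (z + of_int (i + 1) * \<tau>) \<tau> = jacobi_phi (z + of_int i * \<tau> + \<tau>) \<tau>"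
    by (simp add: algebra_simps)
  also have "\<dots> = - exp (- (of_real pi * \<i> * (\<tau> + 2 * (z + of_int i * \<tau>)))) *
     ((- 1) powi i * exp (- (of_real pi * \<i> * ((of_int i)\<^sup>2 * \<tau> + 2 * of_int i * z))) * jacobi_phi z \<tau>)"
    unfolding jacobi_phi_shift_tau[OF assms] step1 ..
  also have "\<dots> = - ((- 1) powi i) * (exp (- (of_real pi * \<i> * (\<tau> + 2 * (z + of_int i * \<tau>)))) *
     exp (- (of_real pi * \<i> * ((of_int i)\<^sup>2 * \<tau> + 2 * of_int i * z)))) * jacobi_phi z \<tau>"
    by simp
  also have "exp (- (of_real pi * \<i> * (\<tau> + 2 * (z + of_int i * \<tau>)))) *
     exp (- (of_real pi * \<i> * ((of_int i)\<^sup>2 * \<tau> + 2 * of_int i * z))) =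
     exp (- (of_real pi * \<i> * ((of_int (i + 1))\<^sup>2 * \<tau> + 2 * of_int (i + 1) * z)))"
    by (simp flip: exp_add) (simp add: algebra_simps power2_eq_square)
  finally show ?case by (simp add: power_int_add)
next
  case (step2 i)
  have "jacobi_phi (z + of_int i * \<tau>) \<tau> = jacobi_phi (z + of_int (i - 1) * \<tau> + \<tau>) \<tau>"
    by (simp add: algebra_simps)
  also have "\<dots> = - exp (- (of_real pi * \<i> * (\<tau> + 2 * (z + of_int (i - 1) * \<tau>)))) * jacobi_phi (z + of_int (i
    - 1) * \<tau>) \<tau>"
    unfolding jacobi_phi_shift_tau[OF assms] ..
  finally have "jacobi_phi (z + of_int (i - 1) * \<tau>) \<tau> = - exp (of_real pi * \<i> * (\<tau> + 2 * (z + of_int (i - 1)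
    * \<tau>))) * jacobi_phi (z + of_int i * \<tau>) \<tau>"
    by (simp add: exp_minus)
  also have "\<dots> = - ((- 1) powi i) * (exp (of_real pi * \<i> * (\<tau> + 2 * (z + of_int (i - 1) * \<tau>))) *
     exp (- (of_real pi * \<i> * ((of_int i)\<^sup>2 * \<tau> + 2 * of_int i * z)))) * jacobi_phi z \<tau>"
    unfolding step2 by simp
  also have "exp (of_real pi * \<i> * (\<tau> + 2 * (z + of_int (i - 1) * \<tau>))) *
     exp (- (of_real pi * \<i> * ((of_int i)\<^sup>2 * \<tau> + 2 * of_int i * z))) =
     exp (- (of_real pi * \<i> * ((of_int (i - 1))\<^sup>2 * \<tau> + 2 * of_int (i - 1) * z)))"
    by (simp flip: exp_add) (simp add: algebra_simps power2_eq_square)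
  finally show ?case by (simp add: power_int_diff)
qed simp

lemma esym_lambert_conv_radius:
  assumes "norm q < 1"
  shows "fps_conv_radius (Abs_fps (\<lambda>k. esym k (lambert q) {1..})) = \<infinity>"
  unfolding fps_conv_radius_def
proof (rule conv_radius_inftyI'')
  fix y :: complex
  show "summable (\<lambda>k. fps_nth (Abs_fps (\<lambda>k. esym k (lambert q) {1..})) k * y ^ k)"
    by (rule summable_comparison_test[where g = "\<lambda>k. exp (2 * norm y * (\<Sum>\<^sub>\<infinity>i\<in>{1..}. norm (lambert q i))) *
      (1/2) ^ k"])
       (use norm_esym_power_le_geometric[OF
         lambert_abs_summable[OF assms] order.refl] in \<open>auto intro!: summable_mult summable_geometric\<close>)
qed

lemma holomorphic_lambert_gen:
  assumes "norm q < 1"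
  shows "(\<lambda>y. lambert_gen y q) holomorphic_on UNIV"
proof -
  have "eval_fps (Abs_fps (\<lambda>k. esym k (lambert q) {1..})) holomorphic_on UNIV"
    using esym_lambert_conv_radius[OF assms] by (intro holomorphic_on_eval_fps) auto
  then show ?thesis by (simp add: eval_fps_def[abs_def] lambert_gen_def[abs_def])
qed

lemma holomorphic_jacobi_phi:
  assumes "Im \<tau> > 0"
  shows "(\<lambda>z. jacobi_phi z \<tau>) holomorphic_on UNIV"
proof -
  have "(\<lambda>z. 4 * (sinpi z)\<^sup>2) holomorphic_on UNIV" by (intro holomorphic_intros)
  from holomorphic_on_compose[OF this holomorphic_on_subset[OF
    holomorphic_lambert_gen[OF norm_nome_less_1[OF assms]]]]
  have "(\<lambda>z. lambert_gen (4 * (sinpi z)\<^sup>2) (nome \<tau>)) holomorphic_on UNIV"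
    by (simp add: o_def)
  then show ?thesis unfolding jacobi_phi_def by (intro holomorphic_intros) auto
qed

subsection \<open>Logarithm of the product\<close>

text \<open>The part of \<open>- log (1 - x)\<close> of degree at least two. The linear term is kept
  apart: over the lattice it converges only in Hecke's ordering, while this part is of order
  \<open>|w|^(-4)\<close> at \<open>x = z^2 / w^2\<close>.\<close>

definition log_remainder :: "complex \<Rightarrow> complex" where
  "log_remainder x = (\<Sum>\<^sub>\<infinity>i\<in>{2..}. x ^ i / of_nat i)"

lemma norm_power_div_of_nat_le:
  fixes x :: complex
  assumes "i \<ge> 2"
  shows "norm (x ^ i / of_nat i) \<le> norm x ^ i"
proof -
  have "norm x ^ i / real i \<le> norm x ^ i / 1" using assms by (intro divide_left_mono) auto
  then show ?thesis by (simp add: norm_divide norm_power)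
qed

lemma log_remainder_abs_summable:
  fixes x :: complex
  assumes "norm x < 1"
  shows "(\<lambda>i. norm (x ^ i / of_nat i)) summable_on {2..}"
proof (rule Infinite_Sum.abs_summable_on_comparison_test')
  show "(\<lambda>i. norm x ^ i / 1) summable_on {2..}"
    by (rule summable_on_subset_banach[OF summable_on_geometric_from_1]) (use assms in auto)
  show "norm (x ^ i / of_nat i) \<le> norm x ^ i / 1" if "i \<in> {2..}" for i
    using norm_power_div_of_nat_le[of i x] that by simp
qed

lemma one_minus_eq_exp:
  assumes "norm x < 1"
  shows "1 - x = exp (- x - log_remainder x)"
proof -
  let ?f = "\<lambda>i. x ^ i / of_nat i"
  have "(\<lambda>n. - ((- (- x)) ^ n) / of_nat n) sums ln (1 + - x)"
    by (rule Ln_series') (use assms in auto)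
  then have s: "?f sums (- ln (1 - x))" using sums_minus by fastforce
  have "?f summable_on {2..}" by (rule abs_summable_summable[OF log_remainder_abs_summable[OF assms]])
  then have "(?f has_sum log_remainder x) {2..}" unfolding log_remainder_def by (rule has_sum_infsum)
  then have "(?f has_sum (x + log_remainder x)) (insert 1 {2..})"
    using has_sum_insert[of 1 "{2..}" ?f "log_remainder x"] by simp
  \<comment> \<open>The term of index 0 is \<open>1 / 0 = 0\<close>.\<close>
  then have "(?f has_sum (x + log_remainder x)) UNIV"
    by (rule has_sum_cong_neutral[THEN iffD1, rotated -1]) auto
  then have "?f sums (x + log_remainder x)" by (rule has_sum_imp_sums)
  with s have "- ln (1 - x) = x + log_remainder x" by (rule sums_unique2)
  then have "ln (1 - x) = - (x + log_remainder x)" by (metis minus_minus)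
  then have "ln (1 - x) = - x - log_remainder x" by simp
  then show ?thesis using assms by (metis exp_Ln eq_iff_diff_eq_0 norm_one order_less_irrefl)
qed

definition row :: "int \<Rightarrow> int set" where
  "row m = (if m > 0 then UNIV else {1..})"

lemma half_lattice_Sigma: "half_lattice = Sigma {0..} row"
  by (auto simp: half_lattice_def row_def split: if_splits)

lemma summable_on_row_inverse_square:
  assumes "Im \<tau> > 0" "m \<ge> 0"
  shows "(\<lambda>n. norm (1 / (lattice_point \<tau> (m, n))\<^sup>2)) summable_on row m"
proof (rule Infinite_Sum.abs_summable_on_comparison_test')
  let ?K = "lattice_const \<tau>"
  have "(\<lambda>n::int. (1 + \<bar>real_of_int n\<bar>) powr - 2) summable_on UNIV"
    by (rule summable_on_int_powr) simp
  then show "(\<lambda>n::int. (2 * ?K)\<^sup>2 * (1 + \<bar>real_of_int n\<bar>) powr - 2) summable_on row m"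
    by (intro summable_on_cmult_right) (rule summable_on_subset_banach, auto)
  fix n assume n: "n \<in> row m"
  then have ne: "m > 0 \<or> n > 0" by (auto simp: row_def split: if_splits)
  let ?w = "lattice_point \<tau> (m, n)"
  have "1 + \<bar>real_of_int n\<bar> \<le> 2 * real_of_int (\<bar>m\<bar> + \<bar>n\<bar>)" using ne by auto
  also have "\<dots> \<le> 2 * (?K * cmod ?w)" using mult_left_mono[OF lattice_point_lower_bound[OF assms(1), of m n],
    of 2] by simp
  finally have le: "1 + \<bar>real_of_int n\<bar> \<le> 2 * ?K * cmod ?w" by simp
  then have "(1 + \<bar>real_of_int n\<bar>)\<^sup>2 \<le> (2 * ?K)\<^sup>2 * (cmod ?w)\<^sup>2"
    unfolding power_mult_distrib[symmetric] by (intro power_mono) auto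
  moreover have "?w \<noteq> 0" using ne assms by (auto simp: lattice_point_eq_0_iff)
  ultimately show "norm (1 / ?w\<^sup>2) \<le> (2 * ?K)\<^sup>2 * (1 + \<bar>real_of_int n\<bar>) powr - 2"
    by (simp add: norm_divide norm_power powr_minus powr_realpow field_simps)
qed

lemma infsum_row_hecke_diff:
  assumes v: "Im \<tau> > 0" and m: "m \<ge> 0"
  shows "(\<Sum>\<^sub>\<infinity>n\<in>row m. hecke_diff \<tau> 0 (m, n)) = (\<Sum>\<^sub>\<infinity>n\<in>row m. 1 / (lattice_point \<tau> (m, n))\<^sup>2)"
proof -
  obtain M where M: "M summable_on half_lattice"
    and le: "\<And>s h. 0 \<le> s \<Longrightarrow> s \<le> 1 \<Longrightarrow> h \<in> half_lattice \<Longrightarrow> norm (hecke_diff \<tau> s h) \<le> M h"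
    using norm_hecke_diff_le[OF v] by blast
  have "hecke_diff \<tau> 0 summable_on half_lattice"
    by (rule abs_summable_summable, rule Infinite_Sum.abs_summable_on_comparison_test'[OF M]) (use le in auto)
  then have D: "(\<lambda>n. hecke_diff \<tau> 0 (m, n)) summable_on row m"
    using summable_on_SigmaD1[of "\<lambda>m n. hecke_diff \<tau> 0 (m, n)" "{0..}" row m] m by (simp add: half_lattice_Sigma)
  have F: "(\<lambda>n. 1 / (lattice_point \<tau> (m, n))\<^sup>2) summable_on row m"
    by (rule abs_summable_summable[OF summable_on_row_inverse_square[OF v m]])
  have eq: "hecke_increment \<tau> 0 (m, n) = 1 / (lattice_point \<tau> (m, n))\<^sup>2 - hecke_diff \<tau> 0 (m, n)"
    if "n \<in> row m" for n
  proof -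
    have "lattice_point \<tau> (m, n) \<noteq> 0" using that m v
      by (auto simp: row_def lattice_point_eq_0_iff split: if_splits)
    then show ?thesis by (simp add: hecke_diff_def deform_0)
  qed
  have I: "(\<lambda>n. hecke_increment \<tau> 0 (m, n)) summable_on row m"
    using summable_on_add[OF F summable_on_uminus[THEN iffD2, OF D]] by (simp add: eq cong: summable_on_cong)
  have "(\<Sum>\<^sub>\<infinity>n\<in>row m. hecke_increment \<tau> 0 (m, n)) = 0"
  proof (cases "m > 0")
    case True
    then show ?thesis using infsum_hecke_increment_row[OF v True, of 0] I by (simp add: row_def)
  qed (simp add: hecke_increment_def)
  then have "(\<Sum>\<^sub>\<infinity>n\<in>row m. hecke_diff \<tau> 0 (m, n) + hecke_increment \<tau> 0 (m, n))
    = (\<Sum>\<^sub>\<infinity>n\<in>row m. hecke_diff \<tau> 0 (m, n))"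
    by (simp add: infsum_add[OF D I])
  moreover have "(\<Sum>\<^sub>\<infinity>n\<in>row m. hecke_diff \<tau> 0 (m, n) + hecke_increment \<tau> 0 (m, n))
    = (\<Sum>\<^sub>\<infinity>n\<in>row m. 1 / (lattice_point \<tau> (m, n))\<^sup>2)"
    by (rule infsum_cong) (simp add: eq)
  ultimately show ?thesis by simp
qed

section \<open>Euler's product in a single row\<close>

lemma prod_int_symmetric:
  fixes g :: "int \<Rightarrow> complex"
  shows "(\<Prod>k\<in>{- int N..int N}. g k) = g 0 * (\<Prod>k=1..N. g (int k) * g (- int k))"
proof (induction N)
  case (Suc N)
  have "{- int (Suc N)..int (Suc N)} = insert (int (Suc N)) (insert (- int (Suc N)) {- int N..int N})" by auto
  then show ?case using Suc by (simp del: of_nat_Suc add: mult_ac)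
qed auto

text \<open>Pairing \<open>k\<close> with \<open>- k\<close> turns the product into a quotient of
  Euler products for the sine: those at \<open>a - z\<close> and \<open>a + z\<close> over the
  square of the one at \<open>a\<close>.\<close>

lemma tendsto_prod_sin_shifted:
  assumes a: "Im a \<noteq> 0"
  shows "(\<lambda>N. \<Prod>k\<in>{- int N..int N}. 1 - z\<^sup>2 / (a + of_int k)\<^sup>2) \<longlonglongrightarrow>
    sinpi (a - z) * sinpi (a + z) / (sinpi a)\<^sup>2"
proof -
  define P where "P w n = of_real pi * w * (\<Prod>k=1..n. 1 - w\<^sup>2 / (of_nat k)\<^sup>2)" for w :: complex and n
  have P: "P w \<longlonglongrightarrow> sinpi w" for w
    unfolding P_def by (rule sin_product_formula_complex)
  have ak: "a + of_int k \<noteq> 0" for k using a by (auto simp: complex_eq_iff)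
  have ak': "a + of_nat k \<noteq> 0" "a - of_nat k \<noteq> 0" for k
    using ak[of "int k"] ak[of "- int k"] by auto
  have a0: "a \<noteq> 0" using a by auto
  have g: "1 - z\<^sup>2 / w\<^sup>2 = (w - z) * (w + z) / w\<^sup>2" if "w \<noteq> 0" for w
    using that by (simp add: field_simps power2_eq_square)
  have step: "(1 - z\<^sup>2 / (a + of_nat k)\<^sup>2) * (1 - z\<^sup>2 / (a - of_nat k)\<^sup>2) =
      (1 - (a - z)\<^sup>2 / (of_nat k)\<^sup>2) * (1 - (a + z)\<^sup>2 / (of_nat k)\<^sup>2) / (1 - a\<^sup>2 / (of_nat k)\<^sup>2)\<^sup>2"
    if k: "k \<ge> 1" for k :: nat
  proof -
    define c where "c = (of_nat k :: complex)"
    have c: "c \<noteq> 0" "a + c \<noteq> 0" "a - c \<noteq> 0" using k ak'[of k] by (auto simp: c_def)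
    have h: "1 - w\<^sup>2 / c\<^sup>2 = (c - w) * (c + w) / c\<^sup>2" for w
      using c by (simp add: field_simps power2_eq_square)
    have "(a + c - z) * (a + c + z) / (a + c)\<^sup>2 * ((a - c - z) * (a - c + z) / (a - c)\<^sup>2) =
      ((c - (a - z)) * (c + (a - z)) / c\<^sup>2) * ((c - (a + z)) * (c + (a + z)) / c\<^sup>2) / ((c - a) * (c + a) / c\<^sup>2)\<^sup>2"
    proof -
      have 1: "(c - a) * (c + a) = - ((a + c) * (a - c))" by (simp add: algebra_simps)
      have 2: "(c - (a - z)) * (c + (a - z)) * ((c - (a + z)) * (c + (a + z)))
        = (a + c - z) * (a + c + z) * ((a - c - z) * (a - c + z))"
        by (simp add: algebra_simps)
      have "((c - (a - z)) * (c + (a - z)) / c\<^sup>2) * ((c - (a + z)) * (c + (a + z)) / c\<^sup>2) / ((c - a) * (c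
        + a) / c\<^sup>2)\<^sup>2
        = ((c - (a - z)) * (c + (a - z)) * ((c - (a + z)) * (c + (a + z)))) / ((c - a) * (c + a))\<^sup>2"
        using c by (simp add: power_divide power2_eq_square)
      then show ?thesis unfolding 1 2 using c by (simp add: power_mult_distrib)
    qed
    then show ?thesis unfolding c_def[symmetric] h g[OF c(2)] g[OF c(3)] .
  qed
  have eq: "(\<Prod>k\<in>{- int N..int N}. 1 - z\<^sup>2 / (a + of_int k)\<^sup>2) = P (a - z) N * P (a + z) N / (P a N)\<^sup>2" for N
  proof -
    have "(\<Prod>k\<in>{- int N..int N}. 1 - z\<^sup>2 / (a + of_int k)\<^sup>2) =
      (1 - z\<^sup>2 / a\<^sup>2) * (\<Prod>k=1..N. (1 - (a - z)\<^sup>2 / (of_nat k)\<^sup>2) * (1 - (a + z)\<^sup>2 / (of_nat k)\<^sup>2) / (1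
        - a\<^sup>2 / (of_nat k)\<^sup>2)\<^sup>2)"
      unfolding prod_int_symmetric using step by (auto intro!: prod.cong)
    also have "\<dots> = P (a - z) N * P (a + z) N / (P a N)\<^sup>2"
      unfolding g[OF a0] P_def by (simp add: prod_dividef prod.distrib prod_power_distrib power_mult_distrib power2_eq_square mult_ac)
    finally show ?thesis .
  qed
  show ?thesis unfolding eq by (intro tendsto_intros P) (use sin_mult_tau_nonzero[OF a] in auto)
qed

context
  fixes \<tau> z :: complex
  assumes v: "Im \<tau> > 0" and z: "norm z \<le> 1 / (2 * lattice_const \<tau>)"
begin

text \<open>The radius in this context is half of the lower bound
  \<open>1 / lattice_const \<tau>\<close> for nonzero lattice points, so every logarithm series
  below converges geometrically.\<close>

lemma norm_square_div_lattice_point_le: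
  assumes "h \<in> half_lattice"
  shows "norm (z\<^sup>2 / (lattice_point \<tau> h)\<^sup>2) \<le> 1 / 4"
proof -
  let ?K = "lattice_const \<tau>" and ?w = "lattice_point \<tau> h"
  have K: "?K > 0" using lattice_const_ge_1[OF v] by simp
  have "h \<noteq> (0, 0)" using assms zero_notin_half_lattice by auto
  then have "1 / ?K \<le> cmod ?w" by (rule cmod_lattice_point_ge[OF v])
  moreover have "0 < 1 / ?K" using K by simp
  ultimately have "norm (z / ?w) \<le> (1 / (2 * ?K)) / (1 / ?K)"
    unfolding norm_divide using z K by (intro frac_le) auto
  also have "\<dots> = 1 / 2" using K by simp
  finally have "norm (z / ?w) ^ 2 \<le> (1 / 2) ^ 2" by (intro power_mono) auto
  then show ?thesis by (simp add: norm_power norm_divide power_divide)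
qed

text \<open>Splitting \<open>x^i = x^2 x^(i-2)\<close> with
  \<open>x = |z^2 / w^2| \<le> 1/4\<close>: the square gives the summable \<open>|w|^(-4)\<close>,
  the rest a geometric series; the factor 16 is \<open>4^2\<close>.\<close>

lemma summable_on_log_remainder:
  "(\<lambda>(h, i). norm ((z\<^sup>2 / (lattice_point \<tau> h)\<^sup>2) ^ i / of_nat i)) summable_on half_lattice \<times> {2..}"
proof (rule summable_on_comparison_test)
  let ?f = "\<lambda>h. norm z ^ 4 * cmod (lattice_point \<tau> h) powr - 4"
  have A: "?f summable_on half_lattice"
    using v zero_notin_half_lattice by (intro summable_on_cmult_right summable_on_lattice_powr) auto
  have B: "(\<lambda>i. 16 * ((1 / 4 :: real) ^ i)) summable_on {2..}"
    using summable_on_subset_banach[OF summable_on_geometric_from_1[of "1/4" "1/16"], of "{2..}"]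
      by (simp add: mult.commute)
  show "(\<lambda>(h, i). ?f h * (16 * ((1 / 4 :: real) ^ i))) summable_on half_lattice \<times> {2..}"
  proof (rule summable_on_SigmaI)
    show "((\<lambda>i. case (h, i) of (h, i) \<Rightarrow> ?f h * (16 * ((1 / 4 :: real) ^ i)))
      has_sum ?f h * (\<Sum>\<^sub>\<infinity>i\<in>{2::nat..}. 16 * ((1 / 4) ^ i))) {2..}" for h
      unfolding prod.case by (intro has_sum_cmult_right has_sum_infsum B)
    show "(\<lambda>h. ?f h * (\<Sum>\<^sub>\<infinity>i\<in>{2::nat..}. 16 * ((1 / 4) ^ i))) summable_on half_lattice"
      by (intro summable_on_cmult_left A)
  qed auto
next
  fix p assume "p \<in> half_lattice \<times> {2::nat..}"
  then obtain h i where p: "p = (h, i)" "h \<in> half_lattice" "i \<ge> 2" by auto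
  let ?x = "norm (z\<^sup>2 / (lattice_point \<tau> h)\<^sup>2)"
  have power_split: "x ^ i = x ^ 2 * x ^ (i - 2)" if "2 \<le> i" for x :: real and i
    using that by (simp only: power_add[symmetric] le_add_diff_inverse)
  have ne: "lattice_point \<tau> h \<noteq> 0" using p v zero_notin_half_lattice lattice_point_eq_0_iff by metis
  have "norm ((z\<^sup>2 / (lattice_point \<tau> h)\<^sup>2) ^ i / of_nat i) \<le> ?x ^ i"
    by (rule norm_power_div_of_nat_le[OF p(3)])
  also have "?x ^ i = ?x ^ 2 * ?x ^ (i - 2)" by (rule power_split[OF p(3)])
  also have "\<dots> \<le> ?x ^ 2 * (1 / 4) ^ (i - 2)"
    using norm_square_div_lattice_point_le[OF p(2)] by (intro mult_left_mono power_mono) auto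
  also have "(1 / 4 :: real) ^ (i - 2) = 16 * (1 / 4) ^ i"
    using power_split[OF p(3), of "1 / 4"] by (simp add: power2_eq_square)
  also have "?x ^ 2 = norm z ^ 4 * cmod (lattice_point \<tau> h) powr - 4"
  proof -
    have "cmod (lattice_point \<tau> h) powr - 4 = 1 / cmod (lattice_point \<tau> h) ^ 4"
      using ne by (simp add: powr_minus_divide)
    then show ?thesis by (simp add: norm_divide norm_power power_divide flip: power_mult)
  qed
  finally show "(case p of (h, i) \<Rightarrow> norm ((z\<^sup>2 / (lattice_point \<tau> h)\<^sup>2) ^ i / of_nat i))
     \<le> (case p of (h, i) \<Rightarrow> norm z ^ 4 * cmod (lattice_point \<tau> h) powr - 4 * (16 * (1 / 4) ^ i))"
    using p(1) by simp
qed auto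

text \<open>Absolute summability of the double series allows the interchange; for a fixed exponent
  \<open>i\<close> the sum over the lattice is a power sum.\<close>

lemma summable_on_log_remainder_lattice:
  "(\<lambda>h. log_remainder (z\<^sup>2 / (lattice_point \<tau> h)\<^sup>2)) summable_on half_lattice"
  and infsum_log_remainder_lattice:
  "(\<Sum>\<^sub>\<infinity>h\<in>half_lattice. log_remainder (z\<^sup>2 / (lattice_point \<tau> h)\<^sup>2)) =
     (\<Sum>\<^sub>\<infinity>i\<in>{2..}. z ^ (2 * i) / of_nat i * power_sum \<tau> 0 i)"
  and summable_on_power_sum_series:
  "(\<lambda>i. z ^ (2 * i) / of_nat i * power_sum \<tau> 0 i) summable_on {2..}"
proof -
  let ?f = "\<lambda>h i. (z\<^sup>2 / (lattice_point \<tau> h)\<^sup>2) ^ i / of_nat i"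
  have s: "(\<lambda>(h, i). ?f h i) summable_on half_lattice \<times> {2..}"
    by (rule abs_summable_summable) (use summable_on_log_remainder in \<open>simp add: case_prod_unfold\<close>)
  show "(\<lambda>h. log_remainder (z\<^sup>2 / (lattice_point \<tau> h)\<^sup>2)) summable_on half_lattice"
    using summable_on_Sigma_banach[OF s] by (simp add: log_remainder_def)
  have inner: "(\<Sum>\<^sub>\<infinity>h\<in>half_lattice. ?f h i) = z ^ (2 * i) / of_nat i * power_sum \<tau> 0 i" for i
  proof -
    have "(\<Sum>\<^sub>\<infinity>h\<in>half_lattice. ?f h i) = (\<Sum>\<^sub>\<infinity>h\<in>half_lattice. z ^ (2 * i) / of_nat i * (1 / deform 0
      (lattice_point \<tau> h)) ^ i)"
    proof (rule infsum_cong)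
      fix h assume "h \<in> half_lattice"
      then have "lattice_point \<tau> h \<noteq> 0" using v zero_notin_half_lattice lattice_point_eq_0_iff by metis
      then show "?f h i = z ^ (2 * i) / of_nat i * (1 / deform 0 (lattice_point \<tau> h)) ^ i"
        by (simp add: deform_0 power_divide power_mult)
    qed
    then show ?thesis by (simp only: infsum_cmult_right' power_sum_def)
  qed
  show "(\<Sum>\<^sub>\<infinity>h\<in>half_lattice. log_remainder (z\<^sup>2 / (lattice_point \<tau> h)\<^sup>2)) =
     (\<Sum>\<^sub>\<infinity>i\<in>{2..}. z ^ (2 * i) / of_nat i * power_sum \<tau> 0 i)"
    unfolding log_remainder_def inner[symmetric] by (rule infsum_swap_banach[OF s])
  have "(\<lambda>(i, h). ?f h i) summable_on {2..} \<times> half_lattice"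
    using summable_on_swap[of "\<lambda>(h, i). ?f h i"] s by simp
  from summable_on_Sigma_banach[OF this]
  show "(\<lambda>i. z ^ (2 * i) / of_nat i * power_sum \<tau> 0 i) summable_on {2..}" by (simp add: inner)
qed

text \<open>In a single row \<open>1 / w^2\<close> is absolutely summable, so any exhaustion
  \<open>A\<close> by finite sets will do: \<open>{1..N}\<close> for row 0 and symmetric intervals
  for the other rows, as in Euler's products.\<close>

lemma tendsto_prod_row:
  assumes m: "m \<ge> 0" and A: "\<And>N. finite (A N)" "\<And>N. A N \<subseteq> row m" "\<And>n. n \<in> row m \<Longrightarrow> \<forall>\<^sub>F N in sequentially. n \<in> A N"
  shows "(\<lambda>N. \<Prod>n\<in>A N. 1 - z\<^sup>2 / (lattice_point \<tau> (m, n))\<^sup>2) \<longlonglongrightarrow>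
    exp (- z\<^sup>2 * (\<Sum>\<^sub>\<infinity>n\<in>row m. hecke_diff \<tau> 0 (m, n)) - (\<Sum>\<^sub>\<infinity>n\<in>row m. log_remainder (z\<^sup>2 / (lattice_point \<tau>
      (m, n))\<^sup>2)))"
proof -
  have lim: "filterlim A (finite_subsets_at_top (row m)) sequentially"
    by (rule filterlim_finite_subsets_at_topI[OF A])
  let ?w = "\<lambda>n. lattice_point \<tau> (m, n)"
  have s1: "(\<lambda>n. 1 / (?w n)\<^sup>2) summable_on row m"
    by (rule abs_summable_summable[OF summable_on_row_inverse_square[OF v m]])
  have s2: "(\<lambda>n. log_remainder (z\<^sup>2 / (?w n)\<^sup>2)) summable_on row m"
    using summable_on_SigmaD1[of "\<lambda>m n. log_remainder (z\<^sup>2 / (lattice_point \<tau> (m, n))\<^sup>2)" "{0..}" row m]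
      summable_on_log_remainder_lattice m by (simp add: half_lattice_Sigma case_prod_unfold)
  have eq: "(\<Prod>n\<in>A N. 1 - z\<^sup>2 / (?w n)\<^sup>2) = exp (- z\<^sup>2 * (\<Sum>n\<in>A N. 1 / (?w n)\<^sup>2) - (\<Sum>n\<in>A N. log_remainder
    (z\<^sup>2 / (?w n)\<^sup>2)))" for N
  proof -
    have "(\<Prod>n\<in>A N. 1 - z\<^sup>2 / (?w n)\<^sup>2) = (\<Prod>n\<in>A N. exp (- (z\<^sup>2 / (?w n)\<^sup>2) - log_remainder (z\<^sup>2 / (?w n)\<^sup>2)))"
    proof (intro prod.cong refl one_minus_eq_exp)
      fix n assume "n \<in> A N"
      then have "(m, n) \<in> half_lattice" using A(2) m by (auto simp: half_lattice_Sigma)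
      from norm_square_div_lattice_point_le[OF this] show "norm (z\<^sup>2 / (?w n)\<^sup>2) < 1" by simp
    qed
    also have "\<dots> = exp (- z\<^sup>2 * (\<Sum>n\<in>A N. 1 / (?w n)\<^sup>2) - (\<Sum>n\<in>A N. log_remainder (z\<^sup>2 / (?w n)\<^sup>2)))"
      using A(1) by (simp add: exp_sum[symmetric] sum_subtractf sum_negf sum_distrib_left)
    finally show ?thesis .
  qed
  show ?thesis unfolding eq infsum_row_hecke_diff[OF v m]
    by (intro tendsto_intros filterlim_compose[OF infsum_tendsto[OF s1] lim] filterlim_compose[OF
      infsum_tendsto[OF s2] lim])
qed

definition "row_factor m = exp (- z\<^sup>2 * (\<Sum>\<^sub>\<infinity>n\<in>row m. hecke_diff \<tau> 0 (m, n)) - (\<Sum>\<^sub>\<infinity>n\<in>row m. log_remainder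
  (z\<^sup>2 / (lattice_point \<tau> (m, n))\<^sup>2)))"

lemma row_factor_0: "sinpi z / of_real pi = z * row_factor 0"
proof -
  have "(\<lambda>N. \<Prod>n\<in>{1..int N}. 1 - z\<^sup>2 / (lattice_point \<tau> (0, n))\<^sup>2) \<longlonglongrightarrow> row_factor 0"
    unfolding row_factor_def
  proof (rule tendsto_prod_row)
    fix n :: int assume "n \<in> row 0"
    then show "\<forall>\<^sub>F N in sequentially. n \<in> {1..int N}"
      by (intro eventually_mono[OF eventually_ge_at_top[of "nat n"]]) (auto simp: row_def)
  qed (auto simp: row_def)
  moreover have "(\<Prod>n\<in>{1..int N}. 1 - z\<^sup>2 / (lattice_point \<tau> (0, n))\<^sup>2) = (\<Prod>k=1..N. 1 - z\<^sup>2 / (of_nat k)\<^sup>2)" for N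
    by (rule prod.reindex_bij_witness[of _ int nat]) (auto simp: lattice_point_def)
  ultimately have "(\<lambda>N. of_real pi * z * (\<Prod>k=1..N. 1 - z\<^sup>2 / (of_nat k)\<^sup>2)) \<longlonglongrightarrow> of_real pi * z * row_factor 0"
    by (intro tendsto_intros) simp
  from LIMSEQ_unique[OF sin_product_formula_complex this] show ?thesis by simp
qed

lemma row_factor_pos:
  assumes "m \<ge> 1"
  shows "sinpi (of_nat m * \<tau> - z) * sinpi (of_nat m * \<tau> + z) / (sinpi (of_nat m * \<tau>))\<^sup>2
    = row_factor (int m)"
proof (rule LIMSEQ_unique[OF tendsto_prod_sin_shifted])
  have "(\<lambda>N. \<Prod>n\<in>{- int N..int N}. 1 - z\<^sup>2 / (lattice_point \<tau> (int m, n))\<^sup>2) \<longlonglongrightarrow> row_factor (int m)"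
    unfolding row_factor_def
  proof (rule tendsto_prod_row)
    fix n :: int
    show "\<forall>\<^sub>F N in sequentially. n \<in> {- int N..int N}"
      by (rule eventually_mono[OF eventually_ge_at_top[of "nat \<bar>n\<bar>"]]) auto
  qed (use assms in \<open>auto simp: row_def\<close>)
  then show "(\<lambda>N. \<Prod>k\<in>{- int N..int N}. 1 - z\<^sup>2 / (of_nat m * \<tau> + of_int k)\<^sup>2) \<longlonglongrightarrow> row_factor (int m)"
    by (simp add: lattice_point_def)
qed (use v assms in auto)

text \<open>The partial product up to index \<open>M\<close> is the exponential of the sums over the
  rows \<open>0..M\<close>. With \<open>hecke_diff\<close> in place of \<open>1 / w^2\<close>, which
  has the same sum in each row, the double series converge absolutely, so the sums by rows tend to
  their totals.\<close>

lemma jacobi_phi_eq_exp: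
  "jacobi_phi z \<tau> = z * exp (- z\<^sup>2 * eisenstein_term \<tau> - (\<Sum>\<^sub>\<infinity>i\<in>{2..}. z ^ (2 * i) / of_nat i * power_sum \<tau> 0 i))"
proof (rule LIMSEQ_unique[OF tendsto_jacobi_phi_partial[OF v]])
  let ?D = "\<lambda>m. \<Sum>\<^sub>\<infinity>n\<in>row m. hecke_diff \<tau> 0 (m, n)"
  let ?R = "\<lambda>m. \<Sum>\<^sub>\<infinity>n\<in>row m. log_remainder (z\<^sup>2 / (lattice_point \<tau> (m, n))\<^sup>2)"
  obtain M where M: "M summable_on half_lattice"
    and le: "\<And>s h. 0 \<le> s \<Longrightarrow> s \<le> 1 \<Longrightarrow> h \<in> half_lattice \<Longrightarrow> norm (hecke_diff \<tau> s h) \<le> M h"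
    using norm_hecke_diff_le[OF v] by blast
  have D: "hecke_diff \<tau> 0 summable_on Sigma {0..} row"
    unfolding half_lattice_Sigma[symmetric]
    by (rule abs_summable_summable, rule Infinite_Sum.abs_summable_on_comparison_test'[OF M]) (use le in auto)
  note R = summable_on_log_remainder_lattice[unfolded half_lattice_Sigma]
  have D': "(?D has_sum eisenstein_term \<tau>) {0..}"
  proof -
    have "?D summable_on {0..}" using summable_on_Sigma_banach[of "\<lambda>m n. hecke_diff \<tau> 0 (m, n)"] D by simp
    then show ?thesis unfolding eisenstein_term_def half_lattice_Sigma infsum_Sigma_banach[OF D, symmetric]
      by (rule has_sum_infsum)
  qed
  have R': "(?R has_sum (\<Sum>\<^sub>\<infinity>i\<in>{2..}. z ^ (2 * i) / of_nat i * power_sum \<tau> 0 i)) {0..}"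
  proof -
    have "?R summable_on {0..}"
      using summable_on_Sigma_banach[of "\<lambda>m n. log_remainder (z\<^sup>2 / (lattice_point \<tau> (m, n))\<^sup>2)"] R
        by (simp add: case_prod_unfold)
    then show ?thesis unfolding infsum_log_remainder_lattice[symmetric] half_lattice_Sigma infsum_Sigma_banach[OF R, symmetric]
      by (rule has_sum_infsum)
  qed
  have lim: "filterlim (\<lambda>M. {0..int M}) (finite_subsets_at_top {0..}) sequentially"
  proof (rule filterlim_finite_subsets_at_topI)
    fix x :: int
    show "\<forall>\<^sub>F M in sequentially. x \<in> {0..int M}" if "x \<in> {0..}"
      using that by (intro eventually_mono[OF eventually_ge_at_top[of "nat x"]]) auto
  qed auto
  have eq: "jacobi_phi_partial M z \<tau> = z * exp (- z\<^sup>2 * (\<Sum>m\<in>{0..int M}. ?D m) - (\<Sum>m\<in>{0..int M}. ?R m))" for M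
  proof -
    have "jacobi_phi_partial M z \<tau> = z * (row_factor 0 * (\<Prod>m=1..M. row_factor (int m)))"
      unfolding jacobi_phi_partial_def row_factor_0 by (simp add: row_factor_pos)
    also have "row_factor 0 * (\<Prod>m=1..M. row_factor (int m)) = (\<Prod>m\<in>{0..int M}. row_factor m)"
    proof -
      have "(\<Prod>m\<in>{0..int M}. row_factor m) = (\<Prod>m\<in>{0..M}. row_factor (int m))"
        by (rule prod.reindex_bij_witness[of _ int nat]) auto
      then show ?thesis by (simp add: prod.atLeast_Suc_atMost)
    qed
    also have "\<dots> = exp (- z\<^sup>2 * (\<Sum>m\<in>{0..int M}. ?D m) - (\<Sum>m\<in>{0..int M}. ?R m))"
      unfolding row_factor_def by (simp add: exp_sum[symmetric] sum_subtractf sum_negf sum_distrib_left)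
    finally show ?thesis .
  qed
  show "(\<lambda>M. jacobi_phi_partial M z \<tau>) \<longlonglongrightarrow> z * exp (- z\<^sup>2 * eisenstein_term \<tau> - (\<Sum>\<^sub>\<infinity>i\<in>{2..}. z ^ (2
    * i) / of_nat i * power_sum \<tau> 0 i))"
    unfolding eq
    by (intro tendsto_intros filterlim_compose[OF D'[unfolded has_sum_def] lim]
      filterlim_compose[OF R'[unfolded has_sum_def] lim])
qed

end

subsection \<open>Generating function of the limits\<close>

text \<open>The limits of the power sums with the nonholomorphic part of the first one removed;
  \<open>limit_power_sum\<close> below keeps it.\<close>

definition hol_power_sum :: "complex \<Rightarrow> nat \<Rightarrow> complex" where
  "hol_power_sum \<tau> i = (if i = 1 then eisenstein_term \<tau> else power_sum \<tau> 0 i)"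

definition hol_power_series :: "complex \<Rightarrow> complex fps" where
  "hol_power_series \<tau> = Abs_fps (\<lambda>i. if i = 0 then 0 else - hol_power_sum \<tau> i / of_nat i)"

lemma hol_power_series_expansion:
  assumes v: "Im \<tau> > 0"
  shows "(\<lambda>x. - x * eisenstein_term \<tau> - (\<Sum>\<^sub>\<infinity>i\<in>{2..}. x ^ i / of_nat i * power_sum \<tau> 0 i))
    has_fps_expansion hol_power_series \<tau>"
proof (rule has_fps_expansionI)
  define r where "r = 1 / (2 * lattice_const \<tau>)"
  have r: "r > 0" using lattice_const_ge_1[OF v] by (simp add: r_def)
  have "\<forall>\<^sub>F x in nhds 0. x \<in> ball (0::complex) (r\<^sup>2)"
    using r by (intro eventually_nhds_in_open) auto
  then show "\<forall>\<^sub>F x in nhds 0. (\<lambda>n. fps_nth (hol_power_series \<tau>) n * x ^ n) sums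
      (- x * eisenstein_term \<tau> - (\<Sum>\<^sub>\<infinity>i\<in>{2..}. x ^ i / of_nat i * power_sum \<tau> 0 i))"
  proof eventually_elim
    case (elim x)
    \<comment> \<open>The series is one in \<open>x = z^2\<close>; a square root brings the point
      back to the region \<open>|z| \<le> r\<close> in which the logarithms were expanded.\<close>
    define z where "z = csqrt x"
    have zx: "z\<^sup>2 = x" by (simp add: z_def)
    have "(cmod z)\<^sup>2 = cmod x" by (simp flip: zx norm_power)
    also have "\<dots> \<le> r\<^sup>2" using elim by simp
    finally have "cmod z \<le> r" by (rule power2_le_imp_le) (use r in simp)
    from summable_on_power_sum_series[OF v this[unfolded r_def]]
    have "(\<lambda>i. x ^ i / of_nat i * power_sum \<tau> 0 i) summable_on {2..}"
      by (simp add: power_mult zx)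
    then have "((\<lambda>i. - (x ^ i / of_nat i * power_sum \<tau> 0 i)) has_sum - (\<Sum>\<^sub>\<infinity>i\<in>{2..}. x ^ i / of_nat i
      * power_sum \<tau> 0 i)) {2..}"
      by (intro has_sum_uminusI has_sum_infsum)
    then have "((\<lambda>n. fps_nth (hol_power_series \<tau>) n * x ^ n) has_sum - (\<Sum>\<^sub>\<infinity>i\<in>{2..}. x ^ i / of_nat i
      * power_sum \<tau> 0 i)) {2..}"
      by (rule has_sum_cong[THEN iffD1, rotated]) (auto simp: hol_power_series_def hol_power_sum_def)
    from has_sum_insert[OF _ this, of 1]
    have "((\<lambda>n. fps_nth (hol_power_series \<tau>) n * x ^ n) has_sum
        - x * eisenstein_term \<tau> - (\<Sum>\<^sub>\<infinity>i\<in>{2..}. x ^ i / of_nat i * power_sum \<tau> 0 i)) (insert 1 {2..})"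
      by (simp add: hol_power_series_def hol_power_sum_def mult.commute)
    then have "((\<lambda>n. fps_nth (hol_power_series \<tau>) n * x ^ n) has_sum
        - x * eisenstein_term \<tau> - (\<Sum>\<^sub>\<infinity>i\<in>{2..}. x ^ i / of_nat i * power_sum \<tau> 0 i)) UNIV"
      by (rule has_sum_cong_neutral[THEN iffD1, rotated -1])
        (auto simp: hol_power_series_def not_le less_2_cases_iff)
    then show ?case by (rule has_sum_imp_sums)
  qed
qed

definition hol_coeff :: "complex \<Rightarrow> nat \<Rightarrow> complex" where
  "hol_coeff \<tau> = newton (hol_power_sum \<tau>)"

text \<open>The left side has logarithmic derivative \<open>- sum p_(i+1) X^i\<close>; the sign
  \<open>(-1) ^ k\<close> put on its coefficients turns the corresponding recursion into Newton's
  identities.\<close>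

lemma exp_hol_power_series:
  "fps_exp 1 oo hol_power_series \<tau> = Abs_fps (\<lambda>k. (-1) ^ k * hol_coeff \<tau> k)"
proof (rule fps_ext)
  let ?H = "fps_exp 1 oo hol_power_series \<tau>"
  have L0: "fps_nth (hol_power_series \<tau>) 0 = 0" by (simp add: hol_power_series_def)
  have d: "fps_deriv (hol_power_series \<tau>) = Abs_fps (\<lambda>i. - hol_power_sum \<tau> (Suc i))"
    by (rule fps_ext) (simp add: hol_power_series_def del: of_nat_Suc)
  have D: "fps_deriv ?H = Abs_fps (\<lambda>i. - hol_power_sum \<tau> (Suc i)) * ?H"
    by (simp add: fps_compose_deriv[OF L0] d mult.commute)
  fix n
  have "(-1) ^ n * fps_nth ?H n = newton (hol_power_sum \<tau>) n"
  proof (rule newton_unique)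
    show "(-1) ^ 0 * fps_nth ?H 0 = 1" by simp
    fix k
    have "of_nat (Suc k) * fps_nth ?H (Suc k) = fps_nth (fps_deriv ?H) k" by simp
    also have "\<dots> = (\<Sum>i\<le>k. - hol_power_sum \<tau> (Suc i) * fps_nth ?H (k - i))"
      unfolding D by (simp add: fps_mult_nth atLeast0AtMost)
    finally have "of_nat (Suc k) * ((-1) ^ Suc k * fps_nth ?H (Suc k))
      = (-1) ^ Suc k * (\<Sum>i\<le>k. - hol_power_sum \<tau> (Suc i) * fps_nth ?H (k - i))"
      by (metis mult.left_commute)
    also have "\<dots> = (\<Sum>i\<le>k. (-1) ^ i * hol_power_sum \<tau> (Suc i) * ((-1) ^ (k - i) * fps_nth ?H (k - i)))"
      unfolding sum_distrib_left
    proof (rule sum.cong[OF refl])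
      fix i assume "i \<in> {..k}"
      then have "(-1 :: complex) ^ k = (-1) ^ i * (-1) ^ (k - i)" by (simp flip: power_add)
      then show "(-1) ^ Suc k * (- hol_power_sum \<tau> (Suc i) * fps_nth ?H (k - i)) =
         (-1) ^ i * hol_power_sum \<tau> (Suc i) * ((-1) ^ (k - i) * fps_nth ?H (k - i))" by simp
    qed
    finally show "of_nat (Suc k) * ((-1) ^ Suc k * fps_nth ?H (Suc k)) =
       (\<Sum>i\<le>k. (-1) ^ i * hol_power_sum \<tau> (Suc i) * ((-1) ^ (k - i) * fps_nth ?H (k - i)))" .
  qed
  then have "(-1) ^ n * ((-1) ^ n * fps_nth ?H n) = (-1) ^ n * hol_coeff \<tau> n" by (simp add: hol_coeff_def)
  then show "fps_nth ?H n = fps_nth (Abs_fps (\<lambda>k. (-1) ^ k * hol_coeff \<tau> k)) n"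
    by (simp flip: mult.assoc power_add)
qed

lemma jacobi_phi_expansion:
  assumes v: "Im \<tau> > 0"
  shows "(\<lambda>z. jacobi_phi z \<tau>) has_fps_expansion fps_X * (Abs_fps (\<lambda>k. (-1) ^ k * hol_coeff \<tau> k) oo fps_X ^ 2)"
proof -
  let ?l = "\<lambda>x. - x * eisenstein_term \<tau> - (\<Sum>\<^sub>\<infinity>i\<in>{2..}. x ^ i / of_nat i * power_sum \<tau> 0 i)"
  have 1: "(exp \<circ> ?l) has_fps_expansion (fps_exp 1 oo hol_power_series \<tau>)"
    by (intro has_fps_expansion_compose hol_power_series_expansion[OF v] has_fps_expansion_exp1)
      (simp add: hol_power_series_def)
  have "((exp \<circ> ?l) \<circ> (\<lambda>z. z ^ 2)) has_fps_expansion ((fps_exp 1 oo hol_power_series \<tau>) oo fps_X ^ 2)"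
    by (rule has_fps_expansion_compose[OF 1 has_fps_expansion_fps_X_power]) simp
  then have "(\<lambda>z. z * ((exp \<circ> ?l) \<circ> (\<lambda>z. z ^ 2)) z)
    has_fps_expansion fps_X * ((fps_exp 1 oo hol_power_series \<tau>) oo fps_X ^ 2)"
    by (intro has_fps_expansion_mult has_fps_expansion_fps_X)
  moreover have "\<forall>\<^sub>F z in nhds 0. z * ((exp \<circ> ?l) \<circ> (\<lambda>z. z ^ 2)) z = jacobi_phi z \<tau>"
  proof -
    have "\<forall>\<^sub>F z in nhds 0. z \<in> ball (0::complex) (1 / (2 * lattice_const \<tau>))"
      using lattice_const_ge_1[OF v] by (intro eventually_nhds_in_open) auto
    then show ?thesis
      by eventually_elim (simp add: jacobi_phi_eq_exp[OF v] power_mult)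
  qed
  ultimately show ?thesis
    unfolding exp_hol_power_series by (subst has_fps_expansion_cong[OF _ refl, symmetric])
qed

text \<open>The expansion is known near \<open>z = 0\<close> only, but \<open>jacobi_phi\<close> is
  entire in \<open>z\<close> and hence equals its Taylor series everywhere. The coefficients of even
  degree vanish, which permits the passage to the exponents \<open>2 k + 1\<close>.\<close>

lemma jacobi_phi_sums:
  assumes v: "Im \<tau> > 0"
  shows "(\<lambda>k. (-1) ^ k * hol_coeff \<tau> k * z ^ (2 * k + 1)) sums jacobi_phi z \<tau>"
proof -
  let ?F = "fps_X * (Abs_fps (\<lambda>k. (-1) ^ k * hol_coeff \<tau> k) oo fps_X ^ 2)"
  let ?f = "\<lambda>z. jacobi_phi z \<tau>"
  have "(\<lambda>n. (deriv ^^ n) ?f 0 / fact n * (z - 0) ^ n) sums ?f z"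
    by (rule holomorphic_power_series[where r = "norm z + 1"])
       (auto intro!: holomorphic_on_subset[OF holomorphic_jacobi_phi[OF v]])
  then have s: "(\<lambda>n. fps_nth ?F n * z ^ n) sums ?f z"
    using fps_nth_fps_expansion[OF jacobi_phi_expansion[OF v]] by simp
  have F: "fps_nth ?F (2 * k + 1) = (-1) ^ k * hol_coeff \<tau> k" for k
    by (simp add: fps_nth_compose_X_power)
  have F0: "fps_nth ?F n = 0" if "n \<notin> range (\<lambda>k. 2 * k + 1)" for n
  proof (cases n)
    case (Suc m)
    have "\<not> 2 dvd m" using that Suc by (auto simp: image_iff elim!: dvdE)
    then show ?thesis using Suc by (simp add: fps_nth_compose_X_power)
  qed simp
  have "(\<lambda>k. fps_nth ?F (2 * k + 1) * z ^ (2 * k + 1)) sums ?f z"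
    by (subst sums_mono_reindex[of "\<lambda>k. 2 * k + 1"]) (use s F0 in \<open>auto simp: strict_mono_def\<close>)
  then show ?thesis unfolding F .
qed

section \<open>The limits \<open>elem_sym_lattice\<close> and their generating function\<close>

definition limit_power_sum :: "complex \<Rightarrow> nat \<Rightarrow> complex" where
  "limit_power_sum \<tau> i = (if i = 1 then eisenstein_term \<tau> - of_real (pi / (2 * Im \<tau>)) else power_sum \<tau> 0 i)"

lemma tendsto_elem_sym_recip:
  assumes v: "Im \<tau> > 0"
  shows "((\<lambda>s. elem_sym_recip k (deformed_lattice \<tau> s)) \<longlongrightarrow> newton (limit_power_sum \<tau>) k) (at_right 0)"
proof -
  have "((\<lambda>s. newton (power_sum \<tau> s) k) \<longlongrightarrow> newton (limit_power_sum \<tau>) k) (at_right 0)"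
  proof (rule tendsto_newton)
    fix i :: nat assume "i \<ge> 1"
    then show "((\<lambda>s. power_sum \<tau> s i) \<longlongrightarrow> limit_power_sum \<tau> i) (at_right 0)"
      using tendsto_power_sum_1[OF v] tendsto_power_sum[OF v, of i] by (cases "i
        = 1") (auto simp: limit_power_sum_def)
  qed
  then show ?thesis
    by (rule Lim_transform_eventually)
       (rule eventually_mono[OF eventually_at_right_less], simp add: elem_sym_recip_deformed_lattice[OF v])
qed

lemma elem_sym_lattice_eq_newton:
  assumes "Im \<tau> > 0"
  shows "elem_sym_lattice k \<tau> = newton (limit_power_sum \<tau>) k"
  unfolding elem_sym_lattice_def by (rule tendsto_Lim[OF _ tendsto_elem_sym_recip[OF assms]]) simp

lemma elem_sym_lattice_eq:
  assumes "Im \<tau> > 0"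
  shows "elem_sym_lattice k \<tau> = (\<Sum>j\<le>k. (- of_real (pi / (2 * Im \<tau>))) ^ j / fact j * hol_coeff \<tau> (k - j))"
  unfolding elem_sym_lattice_eq_newton[OF assms] hol_coeff_def
  by (rule newton_shift) (auto simp: limit_power_sum_def hol_power_sum_def)

lemma summable_norm_hol_coeff:
  assumes "Im \<tau> > 0"
  shows "summable (\<lambda>k. norm ((-1) ^ k * hol_coeff \<tau> k * x ^ k))"
proof (cases "x = 0")
  case True
  have "summable (\<lambda>k. norm ((-1) ^ k * hol_coeff \<tau> k * 0 ^ k))"
    by (rule summable_finite[of "{0}"]) auto
  then show ?thesis using True by simp
next
  case False
  \<comment> \<open>Here \<open>z^2 = 4 x\<close>: convergence at a point of larger modulus gives
    absolute convergence at \<open>x\<close>.\<close>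
  define z where "z = 2 * csqrt x"
  have z: "z \<noteq> 0" using False by (simp add: z_def)
  have "summable (\<lambda>k. (-1) ^ k * hol_coeff \<tau> k * z ^ (2 * k + 1) / z)"
    by (rule summable_divide[OF sums_summable[OF jacobi_phi_sums[OF assms]]])
  then have "summable (\<lambda>k. (-1) ^ k * hol_coeff \<tau> k * (4 * x) ^ k)"
    using z by (simp add: power_mult z_def power_mult_distrib mult.assoc)
  then show ?thesis
    using powser_insidea[of "\<lambda>k. (-1) ^ k * hol_coeff \<tau> k" "4 * x" x] False by (simp add: norm_mult mult.assoc)
qed

text \<open>The formula \<open>elem_sym_lattice_eq\<close> is the Cauchy product of the exponential
  series in \<open>pi z^2 / (2 Im \<tau>)\<close> with the Taylor series of
  \<open>jacobi_phi\<close>; the alternating signs absorb the minus sign of the shift.\<close>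

lemma elem_sym_lattice_sums:
  assumes v: "Im \<tau> > 0"
  shows "(\<lambda>k. (-1) ^ k * elem_sym_lattice k \<tau> * z ^ (2 * k + 1)) sums (exp (of_real pi * z\<^sup>2 / (2 * of_real
    (Im \<tau>))) * jacobi_phi z \<tau>)"
proof -
  let ?t = "of_real pi * z\<^sup>2 / (2 * of_real (Im \<tau>)) :: complex"
  let ?a = "\<lambda>j. ?t ^ j / fact j" and ?b = "\<lambda>k. (-1) ^ k * hol_coeff \<tau> k * (z\<^sup>2) ^ k"
  have e: "x /\<^sub>R fact j = x / fact j" for x :: complex and j
    by (simp add: scaleR_conv_of_real field_simps)
  have a: "summable (\<lambda>j. norm (?a j))" "?a sums exp ?t"
    using summable_norm_exp[of ?t] exp_converges[of ?t] unfolding e by auto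
  have "(\<lambda>k. \<Sum>j\<le>k. ?a j * ?b (k - j)) sums ((\<Sum>j. ?a j) * (\<Sum>k. ?b k))"
    by (rule Cauchy_product_sums[OF a(1) summable_norm_hol_coeff[OF v]])
  then have "(\<lambda>k. z * (\<Sum>j\<le>k. ?a j * ?b (k - j))) sums (z * ((\<Sum>j. ?a j) * (\<Sum>k. ?b k)))"
    by (rule sums_mult)
  moreover have "z * (\<Sum>j\<le>k. ?a j * ?b (k - j)) = (-1) ^ k * elem_sym_lattice k \<tau> * z ^ (2 * k + 1)" for k
  proof -
    have "?a j * ?b (k - j) = (-1) ^ k * ((- of_real (pi / (2 * Im \<tau>))) ^ j / fact j * hol_coeff \<tau> (k - j))
      * (z\<^sup>2) ^ k"
      if "j \<le> k" for j
    proof -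
      have 1: "(-1 :: complex) ^ k = (-1) ^ j * (-1) ^ (k - j)" "(z\<^sup>2) ^ k = (z\<^sup>2) ^ j * (z\<^sup>2) ^ (k - j)"
        by (simp_all only: power_add[symmetric] le_add_diff_inverse[OF that])
      have 2: "?t ^ j = (-1) ^ j * (- of_real (pi / (2 * Im \<tau>))) ^ j * (z\<^sup>2) ^ j"
        unfolding power_mult_distrib[symmetric] by (rule arg_cong[of _ _ "\<lambda>x. x ^ j"]) simp
      show ?thesis unfolding 1 2 by simp
    qed
    then have "(\<Sum>j\<le>k. ?a j * ?b (k - j)) = (-1) ^ k * elem_sym_lattice k \<tau> * (z\<^sup>2) ^ k"
      unfolding elem_sym_lattice_eq[OF v] sum_distrib_left sum_distrib_right by (intro sum.cong) auto
    then show ?thesis by (simp add: power_mult)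
  qed
  moreover have "z * ((\<Sum>j. ?a j) * (\<Sum>k. ?b k)) = exp ?t * jacobi_phi z \<tau>"
  proof -
    have "(\<lambda>k. z * ?b k) sums (z * (\<Sum>k. ?b k))"
      by (intro sums_mult summable_sums summable_norm_cancel[OF summable_norm_hol_coeff[OF v]])
    then have "(\<lambda>k. (-1) ^ k * hol_coeff \<tau> k * z ^ (2 * k + 1)) sums (z * (\<Sum>k. ?b k))"
      by (rule sums_cong[THEN iffD1, rotated]) (simp add: power_mult)
    then have "z * (\<Sum>k. ?b k) = jacobi_phi z \<tau>" using jacobi_phi_sums[OF v] sums_unique2 by blast
    moreover have "(\<Sum>j. ?a j) = exp ?t" using a(2) by (simp add: sums_iff)
    ultimately show ?thesis by (simp add: mult.left_commute)
  qed
  ultimately show ?thesis by (simp only:)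
qed

lemma lattice_jacobi_eq_jacobi_phi:
  assumes "Im \<tau> > 0"
  shows "lattice_jacobi z \<tau> = jacobi_phi z \<tau>"
proof -
  have "lattice_jacobi z \<tau> = exp (- (of_real pi * z\<^sup>2) / (2 * of_real (Im \<tau>))) * (exp (of_real pi * z\<^sup>2 / (2
    * of_real (Im \<tau>))) * jacobi_phi z \<tau>)"
    unfolding lattice_jacobi_def using elem_sym_lattice_sums[OF assms, of z] by (simp add: sums_iff)
  also have "\<dots> = (exp (- (of_real pi * z\<^sup>2) / (2 * of_real (Im \<tau>))) * exp (of_real pi * z\<^sup>2 / (2 * of_real
    (Im \<tau>)))) * jacobi_phi z \<tau>"
    by simp
  also have "exp (- (of_real pi * z\<^sup>2) / (2 * of_real (Im \<tau>))) * exp (of_real pi * z\<^sup>2 / (2 * of_real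
    (Im \<tau>)) :: complex) = 1"
    by (simp flip: exp_add)
  finally show ?thesis by simp
qed

subsection \<open>Holomorphy\<close>

lemma holomorphic_lambert_power_sum:
  assumes "j \<ge> 1"
  shows "(\<lambda>q. \<Sum>\<^sub>\<infinity>m\<in>{1..}. lambert q m ^ j) holomorphic_on ball 0 1"
proof (rule holomorphic_infsum[OF open_ball])
  fix m :: nat assume m: "m \<in> {1..}"
  have "1 - q ^ m \<noteq> 0" if "norm q < 1" for q :: complex
    using that m power_less_one_iff[of "norm q" m]
      by (metis atLeast_iff eq_iff_diff_eq_0 less_irrefl norm_ge_zero norm_one norm_power not_one_le_zero zero_less_iff_neq_zero)
  then show "(\<lambda>q. lambert q m ^ j) holomorphic_on ball 0 1"
    unfolding lambert_def by (intro holomorphic_intros) auto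
next
  fix z :: complex assume z: "z \<in> ball 0 1"
  define r where "r = (1 - norm z) / 2"
  define \<rho> where "\<rho> = norm z + r"
  have r: "r > 0" "\<rho> < 1" "\<rho> \<ge> 0" using z by (auto simp: r_def \<rho>_def field_simps)
  have w: "norm w \<le> \<rho>" if "w \<in> cball z r" for w
    using that norm_triangle_sub[of w z] by (simp add: dist_norm norm_minus_commute \<rho>_def)
  let ?f = "\<lambda>m. complex_of_real (\<rho> ^ m / (1 - \<rho>)\<^sup>2)"
  have "(\<lambda>m. norm (?f m)) summable_on {1..}"
    using summable_on_geometric_from_1[OF r(3,2), of "(1 - \<rho>)\<^sup>2"] r(3) unfolding norm_of_real by simp
  then have s: "(\<lambda>m. norm (?f m ^ j)) summable_on {1..}" by (rule power_abs_summable[OF _ assms])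
  show "\<exists>r>0. \<exists>M. cball z r \<subseteq> ball 0 1 \<and> M summable_on {1..}
    \<and> (\<forall>m\<in>{1..}. \<forall>w\<in>cball z r. norm (lambert w m ^ j) \<le> M m)"
  proof (intro exI conjI ballI)
    fix m w assume "m \<in> {1::nat..}" "w \<in> cball z r"
    then have "norm (lambert w m) ^ j \<le> (\<rho> ^ m / (1 - \<rho>)\<^sup>2) ^ j"
      by (intro power_mono norm_lambert_le w r) auto
    also have "\<dots> = norm (?f m ^ j)" using r(3) unfolding norm_power norm_of_real by simp
    finally show "norm (lambert w m ^ j) \<le> norm (?f m ^ j)" by (simp only: norm_power)
  next
    show "cball z r \<subseteq> ball 0 1" using w r(2) by force
  qed (use r s in auto)
qed

text \<open>Newton's identities reduce the sum over subsets to the power sums, which are dominated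
  series on compact subsets of the disc.\<close>

lemma holomorphic_esym_lambert: "(\<lambda>q. esym k (lambert q) {1..}) holomorphic_on ball 0 1"
proof -
  have "(\<lambda>q. newton (\<lambda>j. \<Sum>\<^sub>\<infinity>m\<in>{1..}. lambert q m ^ j) k) holomorphic_on ball 0 1"
    by (rule holomorphic_newton[OF holomorphic_lambert_power_sum])
  then show ?thesis
    by (rule holomorphic_transform) (rule newton_esym[OF lambert_abs_summable, symmetric], simp)
qed

lemma esym_1: "esym 1 f I = (\<Sum>\<^sub>\<infinity>i\<in>I. f i)"
proof -
  have "bij_betw (\<lambda>i. {i}) I (k_subsets 1 I)"
    by (auto simp: bij_betw_def inj_on_def k_subsets_def card_1_singleton_iff)
  from infsum_reindex_bij_betw[OF this, of "\<lambda>A. \<Prod>i\<in>A. f i"] show ?thesis by (simp add: esym_def)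
qed

text \<open>Comparison of the coefficients of \<open>z^3\<close> in the two expansions of
  \<open>jacobi_phi\<close>, from the sine product and from the exponential. The value is
  \<open>pi^2 / 6\<close> times the quasimodular Eisenstein series of weight two.\<close>

lemma eisenstein_term_eq:
  assumes v: "Im \<tau> > 0"
  shows "eisenstein_term \<tau> = of_real (pi\<^sup>2 / 6) - 4 * of_real (pi\<^sup>2) * (\<Sum>\<^sub>\<infinity>m\<in>{1..}. lambert (nome \<tau>) m)"
proof -
  let ?E = "Abs_fps (\<lambda>k. esym k (lambert (nome \<tau>)) {1..})" and ?S = "fps_sin (of_real pi) :: complex fps"
  have 1: "(\<lambda>y. lambert_gen y (nome \<tau>)) has_fps_expansion ?E"
    using eval_fps_has_fps_expansion[of ?E] esym_lambert_conv_radius[OF norm_nome_less_1[OF v]]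
    by (simp add: eval_fps_def[abs_def] lambert_gen_def[abs_def])
  have 2: "(\<lambda>z. sinpi z) has_fps_expansion ?S" by (rule has_fps_expansion_sin)
  have 3: "(\<lambda>z. 4 * (sinpi z)\<^sup>2) has_fps_expansion fps_const 4 * ?S ^ 2"
    by (intro has_fps_expansion_cmult_left has_fps_expansion_power 2)
  have "((\<lambda>y. lambert_gen y (nome \<tau>)) \<circ> (\<lambda>z. 4 * (sinpi z)\<^sup>2)) has_fps_expansion (?E oo (fps_const 4 * ?S ^ 2))"
    by (rule has_fps_expansion_compose[OF 1 3]) (simp add: power2_eq_square)
  then have "(\<lambda>z. jacobi_phi z \<tau>) has_fps_expansion fps_const (1 / of_real pi) * (?S * (?E oo (fps_const 4
    * ?S ^ 2)))"
    using has_fps_expansion_cmult_left[OF has_fps_expansion_mult[OF 2], of _ _ "1 / of_real pi"]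
    by (simp add: jacobi_phi_def o_def)
  from fps_nth_fps_expansion[OF this, of 3] fps_nth_fps_expansion[OF jacobi_phi_expansion[OF v], of 3]
  have "fps_nth (fps_const (1 / of_real pi) * (?S * (?E oo (fps_const 4 * ?S ^ 2)))) 3 =
      fps_nth (fps_X * (Abs_fps (\<lambda>k. (-1) ^ k * hol_coeff \<tau> k) oo fps_X ^ 2)) 3" by simp
  moreover have "fps_nth (fps_X * (Abs_fps (\<lambda>k. (-1) ^ k * hol_coeff \<tau> k) oo fps_X ^ 2)) 3 = - eisenstein_term \<tau>"
  proof -
    have "hol_coeff \<tau> 1 = eisenstein_term \<tau>"
      using newton_Suc[of 0 "hol_power_sum \<tau>"] by (simp add: hol_coeff_def newton.simps(1) hol_power_sum_def)
    then show ?thesis by (simp add: fps_nth_compose_X_power)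
  qed
  moreover have "fps_nth (fps_const (1 / of_real pi) * (?S * (?E oo (fps_const 4 * ?S ^ 2)))) 3 =
     - of_real (pi\<^sup>2) / 6 + 4 * of_real (pi\<^sup>2) * esym 1 (lambert (nome \<tau>)) {1..}"
  proof -
    have S: "fps_nth ?S 0 = 0" "fps_nth ?S 1 = of_real pi" "fps_nth ?S 2 = 0" "fps_nth ?S 3
      = - (of_real pi ^ 3 / 6)"
      by (simp_all add: fps_sin_def fact_numeral)
    have S2: "fps_nth (fps_const 4 * ?S ^ 2) 0 = 0" "fps_nth (fps_const 4 * ?S ^ 2) 1
      = 0" "fps_nth (fps_const 4 * ?S ^ 2) 2 = 4 * of_real pi ^ 2"
      using S by (simp_all add: power2_eq_square fps_mult_nth numeral_2_eq_2)
    define G where "G = fps_const 4 * ?S ^ 2"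
    have c0: "fps_nth (?E oo G) 0 = 1" by (simp add: fps_compose_nth esym_0)
    have G2: "fps_nth (G ^ 2) 2 = 0" using S2 unfolding G_def[symmetric]
      by (simp add: power2_eq_square fps_mult_nth numeral_2_eq_2)
    have c2: "fps_nth (?E oo G) 2 = 4 * of_real pi ^ 2 * esym 1 (lambert (nome \<tau>)) {1..}"
      using S2 G2 unfolding G_def[symmetric] by (simp add: fps_compose_nth numeral_2_eq_2)
    have c3: "fps_nth (?S * (?E oo G)) 3 = of_real pi * fps_nth (?E oo G) 2 + fps_nth ?S 3 * fps_nth (?E oo G) 0"
      using S by (simp add: fps_mult_nth numeral_3_eq_3 numeral_2_eq_2)
    then show ?thesis
      unfolding G_def[symmetric] fps_mult_left_const_nth c3 c0 c2 S
        by (simp add: field_simps power2_eq_square power3_eq_cube)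
  qed
  ultimately have "- eisenstein_term \<tau> = - of_real (pi\<^sup>2) / 6 + 4 * of_real (pi\<^sup>2) * esym 1 (lambert
    (nome \<tau>)) {1..}"
    by simp
  then show ?thesis unfolding esym_1 by (simp add: algebra_simps minus_equation_iff[of "eisenstein_term \<tau>"])
qed

lemma holomorphic_comp_nome:
  assumes "f holomorphic_on ball 0 1"
  shows "(\<lambda>\<tau>. f (nome \<tau>)) holomorphic_on upper_half_plane"
proof -
  have "nome holomorphic_on upper_half_plane" unfolding nome_def by (intro holomorphic_intros)
  then have "(f \<circ> nome) holomorphic_on upper_half_plane"
    by (rule holomorphic_on_compose) (auto intro!: holomorphic_on_subset[OF assms] norm_nome_less_1)
  then show ?thesis by (simp add: o_def)
qed

lemma holomorphic_eisenstein_term: "eisenstein_term holomorphic_on upper_half_plane"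
proof -
  have "(\<lambda>q. \<Sum>\<^sub>\<infinity>m\<in>{1..}. lambert q m) holomorphic_on ball 0 1"
    using holomorphic_lambert_power_sum[of 1] by simp
  from holomorphic_comp_nome[OF this]
  have "(\<lambda>\<tau>. of_real (pi\<^sup>2 / 6) - 4 * of_real (pi\<^sup>2) * (\<Sum>\<^sub>\<infinity>m\<in>{1..}. lambert
    (nome \<tau>) m)) holomorphic_on upper_half_plane"
    by (intro holomorphic_intros)
  then show ?thesis by (rule holomorphic_transform) (simp add: eisenstein_term_eq)
qed

lemma holomorphic_hol_coeff: "(\<lambda>\<tau>. hol_coeff \<tau> k) holomorphic_on upper_half_plane"
  unfolding hol_coeff_def
proof (rule holomorphic_newton)
  fix i :: nat assume "i \<ge> 1"
  then show "(\<lambda>\<tau>. hol_power_sum \<tau> i) holomorphic_on upper_half_plane"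
    using holomorphic_eisenstein_term holomorphic_power_sum[of i]
    by (cases "i = 1") (auto simp: hol_power_sum_def)
qed

section \<open>Joint holomorphy in two variables\<close>

lemma holomorphic2_on_separate:
  assumes "A holomorphic_on UNIV" "B holomorphic_on T" "open T"
  shows "holomorphic2_on (\<lambda>z \<tau>. A z * B \<tau>) (UNIV \<times> T)"
  unfolding holomorphic2_on_def
proof
  fix p :: "complex \<times> complex" assume "p \<in> UNIV \<times> T"
  then obtain z \<tau> where p: "p = (z, \<tau>)" and \<tau>: "\<tau> \<in> T" by auto
  have A: "(A has_derivative (*) (deriv A z)) (at z)"
    using holomorphic_derivI[OF assms(1) open_UNIV, of z] by (simp add: has_field_derivative_def)
  have B: "(B has_derivative (*) (deriv B \<tau>)) (at \<tau>)"
    using holomorphic_derivI[OF assms(2,3) \<tau>] by (simp add: has_field_derivative_def)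
  have A': "((\<lambda>x. A (fst x)) has_derivative (\<lambda>h. deriv A z * fst h)) (at p)"
    using has_derivative_compose[OF has_derivative_fst[OF has_derivative_ident], of A "(*)
      (deriv A z)" p UNIV] A by (simp add: p)
  have B': "((\<lambda>x. B (snd x)) has_derivative (\<lambda>h. deriv B \<tau> * snd h)) (at p)"
    using has_derivative_compose[OF has_derivative_snd[OF has_derivative_ident], of B "(*)
      (deriv B \<tau>)" p UNIV] B by (simp add: p)
  have "((\<lambda>x. A (fst x) * B (snd x)) has_derivative (\<lambda>h. A (fst p) * (deriv B \<tau> * snd h) + (deriv A z
    * fst h) * B (snd p))) (at p)"
    by (rule has_derivative_mult[OF A' B'])
  also have "(\<lambda>h. A (fst p) * (deriv B \<tau> * snd h) + (deriv A z * fst h) * B (snd p))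
    = (\<lambda>(x, y). (deriv A z * B \<tau>) * x + (A z * deriv B \<tau>) * y)"
    by (auto simp: p fun_eq_iff algebra_simps)
  finally show "\<exists>a b. ((\<lambda>(z, \<tau>). A z * B \<tau>) has_derivative (\<lambda>(x, y). a * x + b * y)) (at p within UNIV \<times> T)"
    using has_derivative_at_withinI by (fastforce simp: case_prod_unfold)
qed

lemma holomorphic2_on_sum:
  assumes "finite K" "\<And>k. k \<in> K \<Longrightarrow> holomorphic2_on (f k) S"
  shows "holomorphic2_on (\<lambda>z \<tau>. \<Sum>k\<in>K. f k z \<tau>) S"
  unfolding holomorphic2_on_def
proof
  fix p assume p: "p \<in> S"
  have "\<forall>k\<in>K. \<exists>a b. ((\<lambda>(z, \<tau>). f k z \<tau>) has_derivative (\<lambda>(x, y). a * x + b * y)) (at p within S)"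
    using assms(2) p unfolding holomorphic2_on_def by blast
  then obtain a b where ab: "\<And>k. k \<in> K \<Longrightarrow> ((\<lambda>(z, \<tau>). f k z \<tau>) has_derivative (\<lambda>(x, y). a k * x + b k * y))
    (at p within S)"
    by metis
  have "((\<lambda>x. \<Sum>k\<in>K. (\<lambda>(z, \<tau>). f k z \<tau>) x) has_derivative (\<lambda>h. \<Sum>k\<in>K. (\<lambda>(x, y). a k * x + b k * y) h))
    (at p within S)"
    by (rule has_derivative_sum) (rule ab)
  also have "(\<lambda>x. \<Sum>k\<in>K. (\<lambda>(z, \<tau>). f k z \<tau>) x) = (\<lambda>(z, \<tau>). \<Sum>k\<in>K. f k z \<tau>)" by auto
  also have "(\<lambda>h. \<Sum>k\<in>K. (\<lambda>(x, y). a k * x + b k * y) h) = (\<lambda>(x, y). (\<Sum>k\<in>K. a k) * x + (\<Sum>k\<in>K. b k) * y)"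
    by (auto simp: sum.distrib sum_distrib_right)
  finally show "\<exists>a b. ((\<lambda>(z, \<tau>). \<Sum>k\<in>K. f k z \<tau>) has_derivative (\<lambda>(x, y). a * x + b * y)) (at p within S)" by blast
qed

text \<open>Cauchy's inequality for the difference, applied below in one variable at a time.\<close>

lemma norm_deriv_diff_le:
  fixes f g :: "complex \<Rightarrow> complex"
  assumes "r > 0" and f: "\<And>w. w \<in> cball z r \<Longrightarrow> (f has_field_derivative f' w) (at w)"
    and g: "\<And>w. w \<in> cball z r \<Longrightarrow> (g has_field_derivative g' w) (at w)"
    and le: "\<And>w. w \<in> cball z r \<Longrightarrow> norm (f w - g w) \<le> B"
  shows "norm (f' z - g' z) \<le> B / r"
proof -
  have d: "((\<lambda>w. f w - g w) has_field_derivative f' w - g' w) (at w)" if "w \<in> cball z r" for w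
    by (rule DERIV_diff[OF f[OF that] g[OF that]])
  have "norm ((deriv ^^ 1) (\<lambda>w. f w - g w) z) \<le> fact 1 * B / r ^ 1"
  proof (rule Cauchy_inequality)
    show "(\<lambda>w. f w - g w) holomorphic_on ball z r"
      unfolding holomorphic_on_open[OF open_ball] using d ball_subset_cball by blast
    show "continuous_on (cball z r) (\<lambda>w. f w - g w)"
      using d DERIV_isCont by (intro continuous_at_imp_continuous_on) blast
  qed (use assms in \<open>auto simp: dist_norm\<close>)
  moreover have "deriv (\<lambda>w. f w - g w) z = f' z - g' z"
    by (rule DERIV_imp_deriv[OF d]) (use assms in auto)
  ultimately show ?thesis by simp
qed

text \<open>Weierstrass' theorem in two variables. Cauchy's inequality in each variable makes the
  partial derivatives of the sequence uniformly Cauchy on a smaller polydisc; on this convex set the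
  sequence may then be differentiated termwise, and the limit derivative is again complex
  linear.\<close>

lemma holomorphic2_on_uniform_limit:
  fixes f :: "nat \<Rightarrow> complex \<Rightarrow> complex \<Rightarrow> complex"
  assumes "open T" and hol: "\<And>n. holomorphic2_on (f n) (UNIV \<times> T)"
    and lim: "\<And>z \<tau>. \<tau> \<in> T \<Longrightarrow> \<exists>r>0. cball \<tau> r \<subseteq> T \<and>
      uniform_limit (cball z r \<times> cball \<tau> r) (\<lambda>n (z, \<tau>). f n z \<tau>) (\<lambda>(z, \<tau>). g z \<tau>) sequentially"
  shows "holomorphic2_on g (UNIV \<times> T)"
  unfolding holomorphic2_on_def
proof
  fix p :: "complex \<times> complex" assume "p \<in> UNIV \<times> T"
  then obtain z0 \<tau>0 where p: "p = (z0, \<tau>0)" and \<tau>0: "\<tau>0 \<in> T" by auto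
  obtain r where r: "r > 0" "cball \<tau>0 r \<subseteq> T"
    and ul: "uniform_limit (cball z0 r \<times> cball \<tau>0 r) (\<lambda>n (z, \<tau>). f n z \<tau>) (\<lambda>(z, \<tau>). g z \<tau>) sequentially"
    using lim[OF \<tau>0] by blast
  \<comment> \<open>Half the radius leaves room for discs of radius \<open>r / 2\<close> around each
    point, as Cauchy's inequality requires.\<close>
  define B where "B = ball z0 (r / 2) \<times> ball \<tau>0 (r / 2)"
  have oB: "open B" "convex B" "p \<in> B" using r by (auto simp: B_def open_Times convex_Times p)
  have oS: "open (UNIV \<times> T)" using assms(1) by (intro open_Times) auto
  have "\<forall>n x. \<exists>ab. x \<in> UNIV \<times> T \<longrightarrow> ((\<lambda>(z, \<tau>). f n z \<tau>) has_derivative (\<lambda>(h, k). fst ab * h + snd ab * k)) (at x)"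
  proof (intro allI)
    fix n and x :: "complex \<times> complex"
    show "\<exists>ab. x \<in> UNIV \<times> T \<longrightarrow> ((\<lambda>(z, \<tau>). f n z \<tau>) has_derivative (\<lambda>(h, k). fst ab * h + snd ab * k)) (at x)"
    proof (cases "x \<in> UNIV \<times> T")
      case True
      then obtain a b where "((\<lambda>(z, \<tau>). f n z \<tau>) has_derivative (\<lambda>(h, k). a * h + b * k)) (at x within UNIV \<times> T)"
        using hol[of n] unfolding holomorphic2_on_def by blast
      then show ?thesis using at_within_open[OF True oS] by (intro exI[of _ "(a, b)"]) simp
    qed auto
  qed
  then obtain ab where ab: "\<And>n x. x \<in> UNIV \<times> T \<Longrightarrow>
      ((\<lambda>(z, \<tau>). f n z \<tau>) has_derivative (\<lambda>(h, k). fst (ab n x) * h + snd (ab n x) * k)) (at x)"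
    by metis
  have da: "((\<lambda>z. f n z \<tau>) has_field_derivative fst (ab n (z, \<tau>))) (at z)" if "\<tau> \<in> T" for n z \<tau>
  proof -
    have i: "((\<lambda>z. (z, \<tau>)) has_derivative (\<lambda>h. (h, 0))) (at z)" by (intro derivative_intros)
    have x: "(z, \<tau>) \<in> UNIV \<times> T" using that by simp
    have "((\<lambda>z. (\<lambda>(z, \<tau>). f n z \<tau>) (z, \<tau>)) has_derivative (\<lambda>h. (\<lambda>(h, k). fst (ab n (z, \<tau>)) * h + snd (ab n
      (z, \<tau>)) * k) (h, 0))) (at z)"
      by (rule has_derivative_compose[OF i ab[OF x]])
    then show ?thesis by (simp add: has_field_derivative_def)
  qed
  have db: "((\<lambda>\<tau>. f n z \<tau>) has_field_derivative snd (ab n (z, \<tau>))) (at \<tau>)" if "\<tau> \<in> T" for n z \<tau>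
  proof -
    have i: "((\<lambda>\<tau>. (z, \<tau>)) has_derivative (\<lambda>h. (0, h))) (at \<tau>)" by (intro derivative_intros)
    have x: "(z, \<tau>) \<in> UNIV \<times> T" using that by simp
    have "((\<lambda>\<tau>. (\<lambda>(z, \<tau>). f n z \<tau>) (z, \<tau>)) has_derivative (\<lambda>h. (\<lambda>(h, k). fst (ab n (z, \<tau>)) * h + snd (ab n
      (z, \<tau>)) * k) (0, h))) (at \<tau>)"
      by (rule has_derivative_compose[OF i ab[OF x]])
    then show ?thesis by (simp add: has_field_derivative_def)
  qed
  have cauchy: "\<exists>N. \<forall>m\<ge>N. \<forall>n\<ge>N. \<forall>x\<in>B. norm (ab m x - ab n x) \<le> e" if e: "e > 0" for e
  proof -
    have "\<forall>\<^sub>F n in sequentially. \<forall>x\<in>cball z0 r \<times> cball \<tau>0 r. dist ((\<lambda>(z, \<tau>). f n z \<tau>) x) ((\<lambda>(z,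
      \<tau>). g z \<tau>) x) < e * r / 8"
      using e r by (intro uniform_limitD[OF ul]) simp
    then obtain N where N: "\<And>n x. n \<ge> N \<Longrightarrow> x \<in> cball z0 r \<times> cball \<tau>0 r \<Longrightarrow> dist ((\<lambda>(z, \<tau>). f n z \<tau>) x) ((\<lambda>(z,
      \<tau>). g z \<tau>) x) < e * r / 8"
      unfolding eventually_sequentially by blast
    \<comment> \<open>Two errors of \<open>e * r / 8\<close> make \<open>e * r / 4\<close>; division
      by the radius \<open>r / 2\<close> will leave \<open>e / 2\<close> for each of the two partial
      derivatives.\<close>
    have diff: "norm (f m z \<tau> - f n z \<tau>) \<le> e * r / 4" if "m \<ge> N" "n \<ge> N" "z \<in> cball z0 r" "\<tau> \<in> cball \<tau>0 r"
      for m n z \<tau>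
      using N[OF that(1), of "(z, \<tau>)"] N[OF that(2), of "(z,
        \<tau>)"] that(3,4) dist_triangle2[of "f m z \<tau>" "f n z \<tau>" "g z \<tau>"]
      by (simp add: dist_norm)
    have "norm (ab m x - ab n x) \<le> e" if mn: "m \<ge> N" "n \<ge> N" and x: "x \<in> B" for m n x
    proof -
 have half: "cball a (r / 2) \<subseteq> cball b r" if "dist b a < r / 2" for a b :: complex
      proof
        fix w assume "w \<in> cball a (r / 2)"
        then show "w \<in> cball b r" using that dist_triangle[of b w a] by simp
      qed
      obtain z \<tau> where x': "x = (z, \<tau>)" "dist z0 z < r / 2" "dist \<tau>0 \<tau> < r / 2" using x by (auto simp: B_def)
      have sub: "cball z (r / 2) \<subseteq> cball z0 r" "cball \<tau> (r / 2) \<subseteq> cball \<tau>0 r"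
        using x'(2,3) by (auto intro!: half)
      have T: "\<tau> \<in> T" "\<And>w. w \<in> cball \<tau> (r / 2) \<Longrightarrow> w \<in> T" using sub r x'(3) by auto
      have zin: "z \<in> cball z0 r" "\<tau> \<in> cball \<tau>0 r" using sub r by (auto simp: subset_iff)
      have a: "norm (fst (ab m (z, \<tau>)) - fst (ab n (z, \<tau>))) \<le> (e * r / 4) / (r / 2)"
        by (rule norm_deriv_diff_le[where f = "\<lambda>z. f m z \<tau>" and g = "\<lambda>z. f n z \<tau>"])
           (use r da T diff mn sub zin in auto)
      have b: "norm (snd (ab m (z, \<tau>)) - snd (ab n (z, \<tau>))) \<le> (e * r / 4) / (r / 2)"
        by (rule norm_deriv_diff_le[where f = "\<lambda>\<tau>. f m z \<tau>" and g = "\<lambda>\<tau>. f n z \<tau>"])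
           (use r db T diff mn sub zin in auto)
      have "norm (ab m x - ab n x) \<le> norm (fst (ab m x - ab n x)) + norm (snd (ab m x - ab n x))"
        by (metis norm_Pair_le prod.collapse)
      also have "\<dots> \<le> e" using a b r x'(1) by simp
      finally show ?thesis .
    qed
    then show ?thesis by blast
  qed
  have "uniformly_Cauchy_on B ab"
    unfolding uniformly_Cauchy_on_def
  proof (intro allI impI)
    fix e :: real assume "e > 0"
    then obtain N where "\<forall>m\<ge>N. \<forall>n\<ge>N. \<forall>x\<in>B. norm (ab m x - ab n x) \<le> e / 2" using cauchy[of "e / 2"] by auto
    then show "\<exists>M. \<forall>x\<in>B. \<forall>m\<ge>M. \<forall>n\<ge>M. dist (ab m x) (ab n x) < e"
      using \<open>e > 0\<close> by (intro exI[of _ N]) (fastforce simp: dist_norm)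
  qed
  then have "uniformly_convergent_on B ab" by (rule Cauchy_uniformly_convergent)
  then obtain AB where AB: "uniform_limit B ab AB sequentially" unfolding uniformly_convergent_on_def by blast
  have "\<exists>G. \<forall>x\<in>B. (\<lambda>n. (\<lambda>(z, \<tau>). f n z \<tau>) x) \<longlonglongrightarrow> G x \<and> (G has_derivative (\<lambda>(h, k). fst (AB x) * h + snd (AB x)
    * k)) (at x within B)"
  proof (rule has_derivative_sequence[OF oB(2) _ _ oB(3)])
    have BT: "x \<in> UNIV \<times> T" if "x \<in> B" for x
      using that r by (auto simp: B_def subset_iff)
    show "((\<lambda>(z, \<tau>). f n z \<tau>) has_derivative (\<lambda>(h, k). fst (ab n x) * h + snd (ab n x) * k))
      (at x within B)" if "x \<in> B" for n x
      by (rule has_derivative_at_withinI[OF ab[OF BT[OF that]]])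
    fix e :: real assume e: "e > 0"
    have "\<forall>\<^sub>F n in sequentially. \<forall>x\<in>B. dist (ab n x) (AB x) < e / 2"
      using AB e unfolding uniform_limit_iff by (meson half_gt_zero)
    then show "\<forall>\<^sub>F n in sequentially. \<forall>x\<in>B. \<forall>h. norm ((\<lambda>(h, k). fst (ab n x) * h + snd (ab n x) * k) h -
      (\<lambda>(h, k). fst (AB x) * h + snd (AB x) * k) h) \<le> e * norm h"
    proof eventually_elim
      case (elim n)
      show ?case
      proof (intro ballI allI)
        fix x and h :: "complex \<times> complex" assume "x \<in> B"
        then have d: "norm (ab n x - AB x) < e / 2" using elim by (simp add: dist_norm)
        have d1: "norm (fst (ab n x) - fst (AB x)) \<le> e / 2" "norm (snd (ab n x) - snd (AB x)) \<le> e / 2"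
          using d norm_fst_le[of "fst (ab n x - AB x)" "snd (ab n x - AB x)"]
            norm_snd_le[of "snd (ab n x - AB x)" "fst (ab n x - AB x)"] by (simp_all only: prod.collapse) auto
        have h: "norm (fst h) \<le> norm h" "norm (snd h) \<le> norm h"
          using norm_fst_le[of "fst h" "snd h"] norm_snd_le[of "snd h" "fst h"] by simp_all
        have "norm ((fst (ab n x) - fst (AB x)) * fst h) \<le> e / 2 * norm h"
          unfolding norm_mult using e by (intro mult_mono d1 h) auto
        moreover have "norm ((snd (ab n x) - snd (AB x)) * snd h) \<le> e / 2 * norm h"
          unfolding norm_mult using e by (intro mult_mono d1 h) auto
        ultimately have "norm ((fst (ab n x) - fst (AB x)) * fst h + (snd (ab n x) - snd (AB x)) * snd h)
          \<le> e / 2 * norm h + e / 2 * norm h"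
          by (rule norm_triangle_mono)
        then show "norm ((\<lambda>(h, k). fst (ab n x) * h + snd (ab n x) * k) h - (\<lambda>(h, k). fst (AB x) * h + snd
          (AB x) * k) h) \<le> e * norm h"
          by (simp add: case_prod_unfold algebra_simps)
      qed
    qed
  next
    show "(\<lambda>n. (\<lambda>(z, \<tau>). f n z \<tau>) p) \<longlonglongrightarrow> (\<lambda>(z, \<tau>). g z \<tau>) p"
      by (rule tendsto_uniform_limitI[OF ul]) (use r in \<open>auto simp: p\<close>)
  qed
  then obtain G where G: "\<And>x. x \<in> B \<Longrightarrow> (\<lambda>n. (\<lambda>(z, \<tau>). f n z \<tau>) x) \<longlonglongrightarrow> G x"
      "\<And>x. x \<in> B \<Longrightarrow> (G has_derivative (\<lambda>(h, k). fst (AB x) * h + snd (AB x) * k)) (at x within B)" by blast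
  have Gg: "G x = (\<lambda>(z, \<tau>). g z \<tau>) x" if "x \<in> B" for x
  proof (rule LIMSEQ_unique[OF G(1)[OF that]])
    show "(\<lambda>n. (\<lambda>(z, \<tau>). f n z \<tau>) x) \<longlonglongrightarrow> (\<lambda>(z, \<tau>). g z \<tau>) x"
      by (rule tendsto_uniform_limitI[OF ul]) (use that r in \<open>auto simp: B_def\<close>)
  qed
  have "(G has_derivative (\<lambda>(h, k). fst (AB p) * h + snd (AB p) * k)) (at p)"
    using G(2)[OF oB(3)] at_within_open[OF oB(3,1)] by simp
  then have "((\<lambda>(z, \<tau>). g z \<tau>) has_derivative (\<lambda>(h, k). fst (AB p) * h + snd (AB p) * k)) (at p)"
    by (rule has_derivative_transform_within_open[OF _ oB(1,3) Gg])
  then show "\<exists>a b. ((\<lambda>(z, \<tau>). g z \<tau>) has_derivative (\<lambda>(x, y). a * x + b * y)) (at p within UNIV \<times> T)"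
    using has_derivative_at_withinI by blast
qed

text \<open>In powers of \<open>sin^2 (pi z)\<close> the variables separate: every term is a
  function of \<open>z\<close> times a function of \<open>\<tau>\<close>. On a product of balls the
  sine is bounded by \<open>D\<close> and the sum of the Lambert norms by \<open>C\<close>, so the
  geometric bound is uniform.\<close>

lemma holomorphic2_jacobi_phi: "holomorphic2_on jacobi_phi (UNIV \<times> upper_half_plane)"
proof (rule holomorphic2_on_uniform_limit[OF open_upper_half_plane])
  let ?A = "\<lambda>k z. sinpi z / of_real pi * (4 * (sinpi z)\<^sup>2) ^ k :: complex"
  let ?B = "\<lambda>k \<tau>. esym k (lambert (nome \<tau>)) {1..}"
  let ?f = "\<lambda>n z \<tau>. \<Sum>k<n. ?A k z * ?B k \<tau>"
  show "holomorphic2_on (?f n) (UNIV \<times> upper_half_plane)" for n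
  proof (rule holomorphic2_on_sum, simp, rule holomorphic2_on_separate[OF _ _ open_upper_half_plane])
    fix k show "?A k holomorphic_on UNIV" by (intro holomorphic_intros) auto
    show "?B k holomorphic_on upper_half_plane" by (rule holomorphic_comp_nome[OF holomorphic_esym_lambert])
  qed
  fix z \<tau> :: complex assume \<tau>: "\<tau> \<in> upper_half_plane"
  define r where "r = Im \<tau> / 2"
  have r: "r > 0" using \<tau> by (simp add: r_def)
  have im: "Im w \<ge> r" if "w \<in> cball \<tau> r" for w
  proof -
    have "\<bar>Im (\<tau> - w)\<bar> \<le> r" using that abs_Im_le_cmod[of "\<tau> - w"] by (simp add: dist_norm)
    then show ?thesis unfolding r_def minus_complex.sel by linarith
  qed
  define \<rho> where "\<rho> = exp (- 2 * pi * r)"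
  have \<rho>: "0 \<le> \<rho>" "\<rho> < 1" using r by (auto simp: \<rho>_def)
  have q: "norm (nome w) \<le> \<rho>" if "w \<in> cball \<tau> r" for w
    using im[OF that] by (simp add: nome_def \<rho>_def)
  define C where "C = (\<Sum>\<^sub>\<infinity>m\<in>{1..}. \<rho> ^ m / (1 - \<rho>)\<^sup>2)"
  have C: "(\<Sum>\<^sub>\<infinity>m\<in>{1..}. norm (lambert (nome w) m)) \<le> C" if "w \<in> cball \<tau> r" for w
    unfolding C_def using q[OF that] \<rho>
    by (intro infsum_mono lambert_abs_summable summable_on_geometric_from_1 norm_lambert_le) auto
  have "compact (cball z r)" by simp
  moreover have "continuous_on (cball z r) (\<lambda>w. sinpi w :: complex)" by (intro continuous_intros)
  ultimately have "bounded ((\<lambda>w. sinpi w) ` cball z r)" by (intro compact_imp_bounded compact_continuous_image)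
  then obtain D where D: "\<And>w. w \<in> cball z r \<Longrightarrow> norm (sinpi w) \<le> D"
    unfolding bounded_iff by (auto simp del: mem_cball)
  have D0: "D \<ge> 0" using order.trans[OF norm_ge_zero D[of z]] r by simp
  have "uniform_limit (cball z r \<times> cball \<tau> r) (\<lambda>n x. \<Sum>k<n. ?A k (fst x) * ?B k (snd x)) (\<lambda>x. \<Sum>k. ?A k
    (fst x) * ?B k (snd x)) sequentially"
  proof (rule Weierstrass_m_test[where M = "\<lambda>k. D / pi * (exp (2 * (4 * D\<^sup>2) * C) * (1/2) ^ k)"])
    show "summable (\<lambda>k. D / pi * (exp (2 * (4 * D\<^sup>2) * C) * (1/2) ^ k))"
      by (intro summable_mult summable_geometric) auto
    fix k x assume x: "x \<in> cball z r \<times> cball \<tau> r"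
    let ?s = "sin (of_real pi * fst x)" and ?q = "nome (snd x)"
    have s: "norm ?s \<le> D" and x2: "snd x \<in> cball \<tau> r" using D x by auto
    have qq: "norm ?q < 1" using q[OF x2] \<rho> by linarith
    have "norm (esym k (lambert ?q) {1..} * (4 * ?s\<^sup>2) ^ k) \<le> exp (2 * (4 * D\<^sup>2) * (\<Sum>\<^sub>\<infinity>m\<in>{1..}. norm
      (lambert ?q m))) * (1/2) ^ k"
      using s by (intro norm_esym_power_le_geometric lambert_abs_summable qq)
        (auto simp: norm_mult norm_power power_mono)
    also have "\<dots> \<le> exp (2 * (4 * D\<^sup>2) * C) * (1/2) ^ k"
      using C[OF x2] by (intro mult_right_mono) (auto intro!: mult_left_mono)
    finally have 1: "norm (esym k (lambert ?q) {1..} * (4 * ?s\<^sup>2) ^ k) \<le> exp (2 * (4 * D\<^sup>2) * C) * (1/2) ^ k" .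
    have "norm (?A k (fst x) * ?B k (snd x)) = norm (?s / of_real pi) * norm (esym k (lambert ?q) {1..} * (4
      * ?s\<^sup>2) ^ k)"
      by (simp only: norm_mult[symmetric]) (simp add: mult_ac)
    also have "\<dots> \<le> D / pi * (exp (2 * (4 * D\<^sup>2) * C) * (1/2) ^ k)"
      using s D0 by (intro mult_mono 1) (auto simp: norm_divide divide_right_mono)
    finally show "norm (?A k (fst x) * ?B k (snd x)) \<le> D / pi * (exp (2 * (4 * D\<^sup>2) * C) * (1/2) ^ k)" .
  qed
  moreover have "(\<Sum>k. ?A k (fst x) * ?B k (snd x)) = (\<lambda>(z, \<tau>). jacobi_phi z \<tau>) x"
    if x: "x \<in> cball z r \<times> cball \<tau> r" for x
  proof -
    have qq: "norm (nome (snd x)) < 1" using q[of "snd x"] \<rho> x by auto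
    have "summable (\<lambda>k. esym k (lambert (nome (snd x))) {1..} * (4 * (sin (of_real pi * fst x))\<^sup>2) ^ k)"
      using summable_fps[of "4 * (sin (of_real pi * fst x))\<^sup>2" "Abs_fps (\<lambda>k. esym k (lambert (nome
        (snd x))) {1..})"] esym_lambert_conv_radius[OF qq] by simp
    from suminf_mult[OF this, of "sin (of_real pi * fst x) / of_real pi"]
    show ?thesis by (simp add: jacobi_phi_def lambert_gen_def case_prod_unfold mult_ac)
  qed
  ultimately have "uniform_limit (cball z r \<times> cball \<tau> r) (\<lambda>n (z, \<tau>). ?f n z \<tau>) (\<lambda>(z,
    \<tau>). jacobi_phi z \<tau>) sequentially"
    by (simp add: case_prod_unfold cong: uniform_limit_cong')
  then show "\<exists>r>0. cball \<tau> r \<subseteq> upper_half_plane \<and>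
     uniform_limit (cball z r \<times> cball \<tau> r) (\<lambda>n (z, \<tau>). ?f n z \<tau>) (\<lambda>(z, \<tau>). jacobi_phi z \<tau>) sequentially"
    using r im by (intro exI[of _ r]) force
qed

subsection \<open>Fourier expansion\<close>

text \<open>Different indices below may have the same exponents of \<open>q\<close> and
  \<open>zeta\<close>; an unconditional sum may be regrouped along them.\<close>

lemma has_sum_fibres:
  fixes f :: "'a \<Rightarrow> complex"
  assumes "(f has_sum s) I" "\<nu> ` I \<subseteq> T"
  shows "((\<lambda>p. \<Sum>\<^sub>\<infinity>i\<in>{i\<in>I. \<nu> i = p}. f i) has_sum s) T"
proof (rule has_sum_Sigma'[where B = "\<lambda>p. {i\<in>I. \<nu> i = p}" and f = "f \<circ> snd"])
  have "bij_betw (\<lambda>i. (\<nu> i, i)) I (Sigma T (\<lambda>p. {i\<in>I. \<nu> i = p}))"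
    by (rule bij_betwI[of _ _ _ snd]) (use assms(2) in auto)
  from has_sum_reindex_bij_betw[OF this, of "f \<circ> snd" s] assms(1)
  show "(f \<circ> snd has_sum s) (Sigma T (\<lambda>p. {i\<in>I. \<nu> i = p}))" by simp
  fix p
  have "f summable_on {i\<in>I. \<nu> i = p}"
    by (rule summable_on_subset_banach[OF has_sum_imp_summable[OF assms(1)]]) auto
  then show "((\<lambda>i. (f \<circ> snd) (p, i)) has_sum (\<Sum>\<^sub>\<infinity>i\<in>{i\<in>I. \<nu> i = p}. f i)) {i\<in>I. \<nu> i = p}" by simp
qed

definition lambert_coeff :: "nat \<Rightarrow> nat \<Rightarrow> complex" where
  "lambert_coeff k n = (deriv ^^ n) (\<lambda>q. esym k (lambert q) {1..}) 0 / fact n"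

lemma lambert_coeff_sums:
  assumes "norm q < 1"
  shows "(\<lambda>n. lambert_coeff k n * q ^ n) sums esym k (lambert q) {1..}"
  using holomorphic_power_series[OF holomorphic_esym_lambert, of q k] assms by (simp add: lambert_coeff_def)

text \<open>Cauchy's inequality on the circle \<open>|q| = \<rho>\<close>, where the Lambert terms
  have a real majorant. The decay in \<open>k\<close> stems from the geometric bound for
  \<open>esym\<close>, which allows any \<open>Y\<close>.\<close>

lemma lambert_coeff_bound:
  assumes \<rho>: "0 < \<rho>" "\<rho> < 1" and Y: "Y \<ge> 0"
  obtains C where "\<And>k n. norm (lambert_coeff k n) * \<rho> ^ n * Y ^ k \<le> C * (1/2) ^ k"
proof
  let ?g = "\<lambda>m. \<rho> ^ m / (1 - \<rho>)\<^sup>2"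
  let ?G = "\<lambda>m. complex_of_real (?g m)"
  have g: "?g summable_on {1..}" using \<rho> by (intro summable_on_geometric_from_1) auto
  then have G: "(\<lambda>m. norm (?G m)) summable_on {1..}" using \<rho> unfolding norm_of_real by simp
  fix k n
  let ?f = "\<lambda>q. esym k (lambert q) {1..}"
  have "norm ((deriv ^^ n) ?f 0) \<le> fact n * norm (esym k ?G {1..}) / \<rho> ^ n"
  proof (rule Cauchy_inequality[OF _ _ \<rho>(1)])
    show "?f holomorphic_on ball 0 \<rho>"
      by (rule holomorphic_on_subset[OF holomorphic_esym_lambert]) (use \<rho> in auto)
    show "continuous_on (cball 0 \<rho>) ?f"
      by (rule continuous_on_subset[OF holomorphic_on_imp_continuous_on[OF holomorphic_esym_lambert]])
        (use \<rho> in auto)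
    fix x :: complex assume x: "norm (0 - x) = \<rho>"
    show "norm (?f x) \<le> norm (esym k ?G {1..})"
      by (rule norm_esym_le_esym_norm[OF _ g], rule norm_lambert_le) (use x \<rho> in auto)
  qed
  then have "norm (lambert_coeff k n) * \<rho> ^ n \<le> norm (esym k ?G {1..})"
    using \<rho> by (simp add: lambert_coeff_def norm_divide field_simps)
  then have "norm (lambert_coeff k n) * \<rho> ^ n * Y ^ k \<le> norm (esym k ?G {1..}) * Y ^ k"
    using Y by (intro mult_right_mono) auto
  also have "\<dots> = norm (esym k ?G {1..} * of_real Y ^ k)"
    using Y by (simp only: norm_mult norm_power norm_of_real abs_of_nonneg)
  also have "\<dots> \<le> exp (2 * Y * (\<Sum>\<^sub>\<infinity>i\<in>{1..}. norm (?G i))) * (1/2) ^ k"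
    by (rule norm_esym_power_le_geometric[OF G]) (use Y in simp)
  finally show "norm (lambert_coeff k n) * \<rho> ^ n * Y ^ k \<le> exp (2 * Y * (\<Sum>\<^sub>\<infinity>i\<in>{1..}. norm (?G i))) * (1/2) ^ k" .
qed

lemma summable_on_power_UNIV: "0 \<le> x \<Longrightarrow> x < 1 \<Longrightarrow> (\<lambda>n. x ^ n) summable_on UNIV" for x :: real
  by (subst summable_on_UNIV_nonneg_real_iff) (auto intro: summable_geometric)

lemma lambert_coeff_summable:
  assumes q: "norm (q::complex) < 1" and Y: "Y \<ge> 0"
  shows "(\<lambda>(k, n). norm (lambert_coeff k n) * norm q ^ n * Y ^ k) summable_on UNIV \<times> UNIV"
proof -
  \<comment> \<open>A radius between \<open>norm q\<close> and 1, so that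
    \<open>norm q / \<rho>\<close> gives decay in \<open>n\<close> next to the decay in
    \<open>k\<close>.\<close>
  define \<rho> where "\<rho> = (1 + norm q) / 2"
  have \<rho>: "0 < \<rho>" "\<rho> < 1" "norm q < \<rho>" using q by (auto simp: \<rho>_def add_pos_nonneg)
  obtain C where C: "\<And>k n. norm (lambert_coeff k n) * \<rho> ^ n * Y ^ k \<le> C * (1/2) ^ k"
    using lambert_coeff_bound[OF \<rho>(1,2) Y] by blast
  show ?thesis
  proof (rule summable_on_comparison_test)
    show "(\<lambda>(k, n). C * (1/2) ^ k * (norm q / \<rho>) ^ n) summable_on UNIV \<times> UNIV"
    proof (rule summable_on_SigmaI)
      show "((\<lambda>n. case (k, n) of (k, n) \<Rightarrow> C * (1/2) ^ k * (norm q / \<rho>) ^ n)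
        has_sum C * (1/2) ^ k * (\<Sum>\<^sub>\<infinity>n. (norm q / \<rho>) ^ n)) UNIV" for k
        unfolding prod.case using \<rho> by (intro has_sum_cmult_right has_sum_infsum summable_on_power_UNIV) auto
      show "(\<lambda>k. C * (1/2) ^ k * (\<Sum>\<^sub>\<infinity>n. (norm q / \<rho>) ^ n)) summable_on UNIV"
        by (intro summable_on_cmult_left summable_on_cmult_right summable_on_power_UNIV) auto
      have "0 \<le> norm (lambert_coeff 0 0) * \<rho> ^ 0 * Y ^ 0" by simp
      also have "\<dots> \<le> C" using C[of 0 0] by simp
      finally show "0 \<le> (case (k, n) of (k, n) \<Rightarrow> C * (1/2) ^ k * (norm q / \<rho>) ^ n)" for k n
        using \<rho> by simp
    qed
    fix p :: "nat \<times> nat"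
    obtain k n where p: "p = (k, n)" by force
    have "norm (lambert_coeff k n) * norm q ^ n * Y ^ k = (norm (lambert_coeff k n) * \<rho> ^ n * Y ^ k) *
      (norm q / \<rho>) ^ n"
      using \<rho> by (simp add: power_divide)
    also have "\<dots> \<le> C * (1/2) ^ k * (norm q / \<rho>) ^ n"
      using \<rho> by (intro mult_right_mono C) auto
    finally show "(case p of (k, n) \<Rightarrow> norm (lambert_coeff k n) * norm q ^ n * Y ^ k)
      \<le> (case p of (k, n) \<Rightarrow> C * (1/2) ^ k * (norm q / \<rho>) ^ n)"
      by (simp add: p)
  qed (use Y in auto)
qed

text \<open>
  The index \<open>((k, n), j)\<close> stands for the \<open>q\<^sup>n\<close>-term of the coefficient of \<open>(4 sin\<^sup>2 (\<pi> z))\<^sup>k\<close> and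
  the \<open>j\<close>-th term of the binomial expansion of \<open>(\<zeta>\<^sup>1\<^sup>/\<^sup>2 - \<zeta>\<^sup>-\<^sup>1\<^sup>/\<^sup>2)\<^sup>2\<^sup>k\<^sup>+\<^sup>1\<close>.
\<close>

definition fourier_index :: "((nat \<times> nat) \<times> nat) set" where
  "fourier_index = Sigma (UNIV \<times> UNIV) (\<lambda>(k, n). {..2 * k + 1})"

definition fourier_exponent :: "(nat \<times> nat) \<times> nat \<Rightarrow> int \<times> real" where
  "fourier_exponent = (\<lambda>((k, n), j). (int n, real k + 1 / 2 - real j))"

definition fourier_weight :: "(nat \<times> nat) \<times> nat \<Rightarrow> complex" where
  "fourier_weight = (\<lambda>((k, n), j). lambert_coeff k n * ((-1) ^ k / (2 * of_real pi * \<i>)) * (of_nat ((2 * k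
    + 1) choose j) * (-1) ^ j))"

lemma has_sum_fourier_index:
  assumes v: "Im \<tau> > 0"
  shows "((\<lambda>i. fourier_weight i * (case fourier_exponent i of (n, r) \<Rightarrow> exp (2 * of_real pi * \<i> * (of_int n
    * \<tau> + of_real r * z))))
     has_sum jacobi_phi z \<tau>) fourier_index"
proof -
  define X where "X = exp (\<i> * of_real pi * z)"
  define X' where "X' = exp (- (\<i> * of_real pi * z))"
  define q where "q = nome \<tau>"
  have q: "norm q < 1" unfolding q_def by (rule norm_nome_less_1[OF v])
  define S where "S = sinpi z"
  have S: "S = (X - X') / (2 * \<i>)" unfolding S_def X_def X'_def by (simp add: sin_exp_eq mult.assoc)
  define t where "t = (\<lambda>((k, n), j). lambert_coeff k n * q ^ n * ((-1) ^ k / (2 * of_real pi * \<i>)) * (of_nat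
    ((2 * k + 1) choose j) * (- X') ^ j * X ^ (2 * k + 1 - j)))"
  have eq: "fourier_weight i * (case fourier_exponent i of (n, r) \<Rightarrow> exp (2 * of_real pi * \<i> * (of_int n * \<tau>
    + of_real r * z))) = t i"
    if i: "i \<in> fourier_index" for i
  proof -
    obtain k n j where kn: "i = ((k, n), j)" "j \<le> 2 * k + 1" using i by (auto simp: fourier_index_def)
    have "q ^ n * X' ^ j * X ^ (2 * k + 1 - j) = exp (of_nat n * (2 * of_real pi * \<i> * \<tau>) + of_nat j * (- (\<i>
      * of_real pi * z)) + of_nat (2 * k + 1 - j) * (\<i> * of_real pi * z))"
      unfolding q_def nome_def X_def X'_def exp_add exp_of_nat_mult ..
    also have "of_nat n * (2 * of_real pi * \<i> * \<tau>) + of_nat j * (- (\<i> * of_real pi * z)) + of_nat (2 * k + 1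
      - j) * (\<i> * of_real pi * z)
        = 2 * of_real pi * \<i> * (of_int (int n) * \<tau> + of_real (real k + 1 / 2 - real j) * z)"
      using kn(2) by (simp add: of_nat_diff algebra_simps)
    finally have "exp (2 * of_real pi * \<i> * (of_int (int n) * \<tau> + of_real (real k + 1 / 2 - real j) * z))
      = q ^ n * X' ^ j * X ^ (2 * k + 1 - j)" by simp
    moreover have "(- X') ^ j = (-1) ^ j * X' ^ j" by (rule power_minus)
    ultimately show ?thesis by (simp add: kn fourier_weight_def fourier_exponent_def t_def)
  qed
  let ?u = "\<lambda>(k, n). lambert_coeff k n * q ^ n * (S / of_real pi * (4 * S\<^sup>2) ^ k)"
  have inner: "((\<lambda>j. t (p, j)) has_sum ?u p) (case p of (k, n) \<Rightarrow> {..2 * k + 1})" for p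
  proof -
    obtain k n where p: "p = (k, n)" by force
    have "(\<Sum>j\<le>2 * k + 1. t (p, j)) = lambert_coeff k n * q ^ n * ((-1) ^ k / (2 * of_real pi * \<i>)) * (- X'
      + X) ^ (2 * k + 1)"
      unfolding binomial_ring sum_distrib_left p t_def prod.case by (rule refl)
    also have "\<dots> = lambert_coeff k n * q ^ n * (((-1) ^ k / (2 * of_real pi * \<i>)) * (- X' + X) ^ (2 * k + 1))"
      by (simp only: mult.assoc)
    \<comment> \<open>With \<open>S = (X - X') / (2 i)\<close> one has
      \<open>4 S^2 = - (X - X')^2\<close>, the source of the factor
      \<open>(-1) ^ k / (2 pi i)\<close> in \<open>fourier_weight\<close>.\<close>
    also have "((-1) ^ k / (2 * of_real pi * \<i>)) * (- X' + X) ^ (2 * k + 1) = S / of_real pi * (4 * S\<^sup>2) ^ k"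
    proof -
      have "4 * S\<^sup>2 = - ((X - X')\<^sup>2)" unfolding S by (simp add: power_divide power_mult_distrib)
      then have e1: "(4 * S\<^sup>2) ^ k = (-1) ^ k * ((X - X') ^ 2) ^ k" by (metis power_minus)
      have e2: "(- X' + X) ^ (2 * k + 1) = (X - X') * ((X - X') ^ 2) ^ k" by (simp add: power_mult)
      have "u / (2 * p * \<i>) * (x * w) = x / (2 * \<i>) / p * (u * w)" for u w x p :: complex
        by (simp only: divide_inverse inverse_mult_distrib mult_ac)
      then show ?thesis unfolding e1 e2 unfolding S .
    qed
    finally show ?thesis by (intro has_sum_finiteI) (simp_all add: p)
  qed
  \<comment> \<open>The moduli of the binomial terms add up to
    \<open>(norm X' + norm X) ^ (2 k + 1)\<close>, that is \<open>Y ^ k\<close> times a factor free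
    of \<open>k\<close>; summability in \<open>(k, n)\<close> is available for every such
    \<open>Y\<close>.\<close>
  define Y where "Y = (norm X' + norm X)\<^sup>2"
  have norm_inner: "((\<lambda>j. norm (t (p, j))) has_sum (case p of (k, n) \<Rightarrow> (norm (lambert_coeff k n)
    * norm q ^ n * Y ^ k) * ((norm X' + norm X) / (2 * pi))))
      (case p of (k, n) \<Rightarrow> {..2 * k + 1})" for p
  proof -
    obtain k n where p: "p = (k, n)" by force
    have "(\<Sum>j\<le>2 * k + 1. norm (t (p, j))) = norm (lambert_coeff k n) * norm q ^ n / (2 * pi) * (norm X'
      + norm X) ^ (2 * k + 1)"
      unfolding binomial_ring sum_distrib_left
      by (intro sum.cong refl) (simp add: p t_def norm_mult norm_power norm_divide del: binomial_Suc_Suc power_Suc)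
    also have "\<dots> = (norm (lambert_coeff k n) * norm q ^ n * Y ^ k) * ((norm X' + norm X) / (2 * pi))"
      by (simp add: Y_def power_mult)
    finally show ?thesis by (intro has_sum_finiteI) (simp_all add: p)
  qed
  have "(\<lambda>i. norm (t i)) summable_on Sigma (UNIV \<times> UNIV) (\<lambda>p. case p of (k, n) \<Rightarrow> {..2 * k + 1})"
  proof (rule summable_on_SigmaI[OF norm_inner])
    have "(\<lambda>p. (case p of (k, n) \<Rightarrow> norm (lambert_coeff k n) * norm q ^ n * Y ^ k) * ((norm X' + norm X) / (2
      * pi))) summable_on UNIV \<times> UNIV"
      by (intro summable_on_cmult_left lambert_coeff_summable q) (simp add: Y_def)
    then show "(\<lambda>p. case p of (k, n) \<Rightarrow> (norm (lambert_coeff k n) * norm q ^ n * Y ^ k) * ((norm X'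
      + norm X) / (2 * pi))) summable_on UNIV \<times> UNIV"
      by (simp add: case_prod_unfold)
  qed auto
  then have ts: "t summable_on fourier_index" unfolding fourier_index_def by (rule abs_summable_summable)
  have outer: "(?u has_sum jacobi_phi z \<tau>) (UNIV \<times> UNIV)"
  proof (rule has_sum_SigmaI)
    let ?c = "\<lambda>k. S / of_real pi * (4 * S\<^sup>2) ^ k"
    have Ls: "(\<lambda>(k, n). norm (lambert_coeff k n) * norm q ^ n * norm (4 * S\<^sup>2) ^ k) summable_on UNIV \<times> UNIV"
      by (rule lambert_coeff_summable[OF q]) simp
    then have "(\<lambda>p. norm (S / of_real pi) * (case p of (k, n) \<Rightarrow> norm (lambert_coeff k n) * norm q ^ n * norm
      (4 * S\<^sup>2) ^ k)) summable_on UNIV \<times> UNIV"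
      by (rule summable_on_cmult_right)
    then have "(\<lambda>p. norm (?u p)) summable_on UNIV \<times> UNIV"
      by (rule summable_on_cong[THEN iffD1, rotated]) (simp only: case_prod_unfold norm_mult norm_power mult_ac)
    then show us: "?u summable_on UNIV \<times> UNIV" by (rule abs_summable_summable)
    show "((\<lambda>n. ?u (k, n)) has_sum esym k (lambert q) {1..} * ?c k) UNIV" for k
    proof -
      have "(\<lambda>n. norm (lambert_coeff k n * q ^ n)) summable_on UNIV"
        using summable_on_SigmaD1[OF lambert_coeff_summable[OF q, of 1], of k] by (simp add: norm_mult norm_power)
      then have "((\<lambda>n. lambert_coeff k n * q ^ n) has_sum esym k (lambert q) {1..}) UNIV"
        using lambert_coeff_sums[OF q, of k] by (intro norm_summable_imp_has_sum)
          (auto dest: summable_on_imp_summable)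
      from has_sum_cmult_left[OF this, of "?c k"] show ?thesis by simp
    qed
    have sums: "(\<lambda>k. esym k (lambert q) {1..} * (4 * S\<^sup>2) ^ k) sums lambert_gen (4 * S\<^sup>2) q"
      unfolding lambert_gen_def
      using summable_fps[of "4 * S\<^sup>2" "Abs_fps (\<lambda>k. esym k (lambert q) {1..})"] esym_lambert_conv_radius[OF q]
      by (intro summable_sums) simp
    have ns: "summable (\<lambda>k. norm (esym k (lambert q) {1..} * (4 * S\<^sup>2) ^ k))"
    proof (rule summable_comparison_test)
      let ?g = "\<lambda>k. exp (2 * norm (4 * S\<^sup>2) * (\<Sum>\<^sub>\<infinity>i\<in>{1..}. norm (lambert q i))) * (1/2) ^ k"
      show "\<exists>N. \<forall>k\<ge>N. norm (norm (esym k (lambert q) {1..} * (4 * S\<^sup>2) ^ k)) \<le> ?g k"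
        unfolding real_norm_def abs_norm_cancel
        by (intro exI allI impI norm_esym_power_le_geometric lambert_abs_summable q order.refl)
      show "summable ?g" by (intro summable_mult summable_geometric) auto
    qed
    have "((\<lambda>k. esym k (lambert q) {1..} * (4 * S\<^sup>2) ^ k) has_sum lambert_gen (4 * S\<^sup>2) q) UNIV"
      by (rule norm_summable_imp_has_sum[OF ns sums])
    from has_sum_cmult_right[OF this, of "S / of_real pi"]
    show "((\<lambda>k. esym k (lambert q) {1..} * ?c k) has_sum jacobi_phi z \<tau>) UNIV"
      by (simp add: jacobi_phi_def S_def q_def mult_ac)
  qed
  have "(t has_sum jacobi_phi z \<tau>) fourier_index"
    unfolding fourier_index_def
    by (rule has_sum_SigmaI[OF inner outer]) (use ts in \<open>simp add: fourier_index_def\<close>)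
  then show ?thesis by (rule has_sum_cong[THEN iffD2, rotated]) (rule eq)
qed

lemma jacobi_phi_fourier:
  "\<exists>c :: int \<Rightarrow> real \<Rightarrow> complex. \<forall>z. \<forall>\<tau>\<in>upper_half_plane.
     ((\<lambda>(n, r). c n r * exp (2 * of_real pi * \<i> * (of_int n * \<tau> + of_real r * z))) has_sum jacobi_phi z \<tau>)
       ({0..} \<times> {r. r - 1 / 2 \<in> \<int>})"
\<comment> \<open>The witness is fixed by the last step: the sum of \<open>fourier_weight\<close>
  over a fibre of \<open>fourier_exponent\<close>, which depends on neither \<open>z\<close> nor
  \<open>\<tau>\<close>.\<close>
proof (intro exI allI ballI)
  fix z \<tau> assume "\<tau> \<in> upper_half_plane"
  then have v: "Im \<tau> > 0" by simp
  let ?e = "\<lambda>(n, r). exp (2 * of_real pi * \<i> * (of_int n * \<tau> + of_real r * z)) :: complex"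
  have "fourier_exponent ` fourier_index \<subseteq> {0..} \<times> {r. r - 1 / 2 \<in> \<int>}"
    by (auto simp: fourier_exponent_def split: prod.splits)
  from has_sum_fibres[OF has_sum_fourier_index[OF v] this, of z]
  have "((\<lambda>p. \<Sum>\<^sub>\<infinity>i\<in>{i\<in>fourier_index. fourier_exponent i = p}. fourier_weight i * ?e (fourier_exponent i))
    has_sum jacobi_phi z \<tau>)
     ({0..} \<times> {r. r - 1 / 2 \<in> \<int>})" .
  also have "(\<lambda>p. \<Sum>\<^sub>\<infinity>i\<in>{i\<in>fourier_index. fourier_exponent i = p}. fourier_weight i * ?e (fourier_exponent i)) =
     (\<lambda>(n, r). (\<Sum>\<^sub>\<infinity>i\<in>{i\<in>fourier_index. fourier_exponent i = (n, r)}. fourier_weight i) * exp (2 * of_real pi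
       * \<i> * (of_int n * \<tau> + of_real r * z)))"
  proof (rule ext, safe)
    fix n r
    have "(\<Sum>\<^sub>\<infinity>i\<in>{i\<in>fourier_index. fourier_exponent i = (n, r)}. fourier_weight i * ?e (fourier_exponent i)) =
      (\<Sum>\<^sub>\<infinity>i\<in>{i\<in>fourier_index. fourier_exponent i = (n, r)}. fourier_weight i * ?e (n, r))"
      by (rule infsum_cong) auto
    then show "(\<Sum>\<^sub>\<infinity>i\<in>{i\<in>fourier_index. fourier_exponent i = (n, r)}. fourier_weight i * ?e (fourier_exponent i)) =
      (\<Sum>\<^sub>\<infinity>i\<in>{i\<in>fourier_index. fourier_exponent i = (n, r)}. fourier_weight i) * exp (2 * of_real pi * \<i> *
        (of_int n * \<tau> + of_real r * z))"
      by (simp only: infsum_cmult_left' prod.case)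
  qed
  finally show "((\<lambda>(n, r). (\<Sum>\<^sub>\<infinity>i\<in>{i\<in>fourier_index. fourier_exponent i = (n, r)}. fourier_weight i) * exp (2
    * of_real pi * \<i> * (of_int n * \<tau> + of_real r * z)))
     has_sum jacobi_phi z \<tau>) ({0..} \<times> {r. r - 1 / 2 \<in> \<int>})" .
qed

subsection \<open>Modularity and the lowering operator\<close>

lemma esym_reindex:
  assumes "inj_on g I"
  shows "esym k f (g ` I) = esym k (f \<circ> g) I"
proof -
  have "bij_betw (\<lambda>A. g ` A) (k_subsets k I) (k_subsets k (g ` I))"
    unfolding bij_betw_def
  proof
    show "inj_on ((`) g) (k_subsets k I)"
      by (rule inj_on_subset[OF inj_on_image_Pow[OF assms]]) (auto simp: k_subsets_def)
    show "(`) g ` k_subsets k I = k_subsets k (g ` I)"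
    proof (intro equalityI subsetI)
      fix B assume "B \<in> k_subsets k (g ` I)"
      then have B: "B \<subseteq> g ` I" "finite B" "card B = k" by (auto simp: k_subsets_def)
      then obtain A where A: "A \<subseteq> I" "finite A" "B = g ` A" by (meson finite_subset_image)
      then have "card A = k" using B card_image inj_on_subset[OF assms] by metis
      then show "B \<in> (`) g ` k_subsets k I" using A by (auto simp: k_subsets_def)
    qed (auto simp: k_subsets_def card_image inj_on_subset[OF assms])
  qed
  from infsum_reindex_bij_betw[OF this, of "\<lambda>A. \<Prod>i\<in>A. f i"]
  have "esym k f (g ` I) = (\<Sum>\<^sub>\<infinity>A\<in>k_subsets k I. \<Prod>i\<in>g ` A. f i)" by (simp add: esym_def)
  also have "\<dots> = esym k (f \<circ> g) I"
    unfolding esym_def by (intro infsum_cong prod.reindex inj_on_subset[OF assms]) (auto simp: k_subsets_def)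
  finally show ?thesis .
qed

lemma elem_sym_recip_divide:
  assumes "c \<noteq> 0"
  shows "elem_sym_recip k ((\<lambda>x. x / c) ` X) = c ^ k * elem_sym_recip k X"
proof -
  have "elem_sym_recip k ((\<lambda>x. x / c) ` X) = esym k (\<lambda>x. c * (1 / x)) X"
    unfolding elem_sym_recip_eq_esym using assms by (subst esym_reindex) (auto simp: inj_on_def o_def)
  then show ?thesis by (simp only: esym_scale elem_sym_recip_eq_esym)
qed

text \<open>Multiplicativity of the deformation: homothetic lattices have homothetic deformed
  lattices for every \<open>s\<close>, not only in the limit.\<close>

lemma deform_divide: "deform s (w / j) = deform s w / deform s j"
  by (simp add: deform_def norm_divide power_divide powr_divide)

definition automorphy_denom :: "int \<Rightarrow> int \<Rightarrow> complex \<Rightarrow> complex" where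
  "automorphy_denom c d \<tau> = of_int c * \<tau> + of_int d"

definition moebius :: "int \<Rightarrow> int \<Rightarrow> int \<Rightarrow> int \<Rightarrow> complex \<Rightarrow> complex" where
  "moebius a b c d \<tau> = (of_int a * \<tau> + of_int b) / automorphy_denom c d \<tau>"

context
  fixes a b c d :: int and \<tau> :: complex
  assumes det: "a * d - b * c = 1" and v: "Im \<tau> > 0"
begin

abbreviation "moebius_denom \<equiv> automorphy_denom c d \<tau>"
abbreviation "moebius_image \<equiv> moebius a b c d \<tau>"

lemma moebius_denom_nonzero: "moebius_denom \<noteq> 0"
proof
  assume "moebius_denom = 0"
  then have "lattice_point \<tau> (c, d) = 0" by (simp add: automorphy_denom_def lattice_point_def)
  then have "c = 0" "d = 0" using v by (auto simp: lattice_point_eq_0_iff)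
  then show False using det by simp
qed

lemma Im_moebius_image: "Im moebius_image = Im \<tau> / (cmod moebius_denom)\<^sup>2"
proof -
  have "real_of_int (a * d - b * c) = 1" using det by simp
  then have det': "real_of_int a * real_of_int d - real_of_int b * real_of_int c = 1" by simp
  have "Im (of_int a * \<tau> + of_int b) * Re moebius_denom - Re (of_int a * \<tau> + of_int b) * Im moebius_denom =
      (real_of_int a * real_of_int d - real_of_int b * real_of_int c) * Im \<tau>"
    by (simp add: automorphy_denom_def algebra_simps)
  then show ?thesis
    unfolding moebius_def Im_divide det' by (simp add: cmod_power2)
qed

lemma Im_moebius_image_pos: "Im moebius_image > 0"
  using v moebius_denom_nonzero by (simp add: Im_moebius_image)

lemma period_lattice_moebius: "period_lattice moebius_image = (\<lambda>w. w / moebius_denom) ` period_lattice \<tau>"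
proof (intro equalityI subsetI)
  fix x assume "x \<in> period_lattice moebius_image"
  then obtain m n :: int where "x = of_int m + of_int n * moebius_image" by (auto simp: period_lattice_def)
  then have "x = (of_int (m * d + n * b) + of_int (m * c + n * a) * \<tau>) / moebius_denom"
    using moebius_denom_nonzero unfolding moebius_def
    by (simp add: field_simps) (simp add: automorphy_denom_def algebra_simps)
  then show "x \<in> (\<lambda>w. w / moebius_denom) ` period_lattice \<tau>" unfolding period_lattice_def by blast
next
  fix x assume "x \<in> (\<lambda>w. w / moebius_denom) ` period_lattice \<tau>"
  then obtain m n :: int where x: "x = (of_int m + of_int n * \<tau>) / moebius_denom"
    by (auto simp: period_lattice_def)
  \<comment> \<open>The coordinates under the inverse matrix, which is integral since the
    determinant is 1.\<close>
  define m' where "m' = a * m - b * n" define n' where "n' = d * n - c * m"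
  have "m' * d + n' * b = (a * d - b * c) * m" "m' * c + n' * a = (a * d - b * c) * n"
    by (simp_all add: m'_def n'_def algebra_simps)
  then have mn: "m' * d + n' * b = m" "m' * c + n' * a = n" using det by simp_all
  have "of_int m' + of_int n' * moebius_image = (of_int (m' * d + n' * b) + of_int (m' * c + n' * a)
    * \<tau>) / moebius_denom"
    using moebius_denom_nonzero unfolding moebius_def
    by (simp add: field_simps) (simp add: automorphy_denom_def algebra_simps)
  then have "x = of_int m' + of_int n' * moebius_image" unfolding mn x by simp
  then show "x \<in> period_lattice moebius_image" unfolding period_lattice_def by blast
qed

text \<open>The lattice of the image point is that of \<open>\<tau>\<close> divided by
  \<open>J = c \<tau> + d\<close>, so the symmetric functions of the deformed lattices scale by
  \<open>deform s J ^ k\<close>, which tends to \<open>J ^ (2 * k)\<close>.\<close>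

lemma elem_sym_lattice_moebius:
  "elem_sym_lattice k moebius_image = moebius_denom ^ (2 * k) * elem_sym_lattice k \<tau>"
proof (rule tendsto_unique)
  let ?J = moebius_denom
  have "deformed_lattice moebius_image s = (\<lambda>x. x / deform s ?J) ` deformed_lattice \<tau> s" for s
  proof -
    have "period_lattice moebius_image - {0} = (\<lambda>w. w / ?J) ` (period_lattice \<tau> - {0})"
      unfolding period_lattice_moebius using moebius_denom_nonzero by auto
    then show ?thesis unfolding deformed_lattice_eq by (simp add: image_image deform_divide)
  qed
  moreover have "deform s ?J \<noteq> 0" for s using moebius_denom_nonzero by (simp add: deform_def)
  ultimately have eq: "elem_sym_recip k (deformed_lattice moebius_image s)
    = deform s ?J ^ k * elem_sym_recip k (deformed_lattice \<tau> s)" for s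
    by (simp add: elem_sym_recip_divide)
  have "((\<lambda>s. deform s ?J ^ k * elem_sym_recip k (deformed_lattice \<tau> s))
    \<longlongrightarrow> (?J\<^sup>2) ^ k * elem_sym_lattice k \<tau>) (at_right 0)"
    unfolding elem_sym_lattice_eq_newton[OF v]
    by (intro tendsto_intros tendsto_deform moebius_denom_nonzero tendsto_elem_sym_recip v)
  then show "((\<lambda>s. elem_sym_recip k (deformed_lattice moebius_image s))
    \<longlongrightarrow> ?J ^ (2 * k) * elem_sym_lattice k \<tau>) (at_right 0)"
    by (simp add: eq power_mult)
  show "((\<lambda>s. elem_sym_recip k (deformed_lattice moebius_image s)) \<longlongrightarrow> elem_sym_lattice k moebius_image)
    (at_right 0)"
    unfolding elem_sym_lattice_eq_newton[OF Im_moebius_image_pos]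
      by (rule tendsto_elem_sym_recip[OF Im_moebius_image_pos])
qed simp

text \<open>The series scales by \<open>1 / J\<close>, as each term has degree
  \<open>2 k + 1\<close> in \<open>z\<close> and a coefficient of weight \<open>2 k\<close>. In the
  exponential prefactor \<open>Im \<tau>\<close> is divided by \<open>|J|^2\<close>, and the
  conjugate of \<open>J = c \<tau> + d\<close> is \<open>J - 2 i c Im \<tau>\<close>; the correction
  gives the exponent \<open>pi i c z^2 / J\<close> of index 1/2.\<close>

lemma lattice_jacobi_moebius:
  "lattice_jacobi (z / moebius_denom) moebius_image =
     moebius_denom powi (- 1) * exp (2 * of_real pi * \<i> * of_real (1 / 2) * of_int c * z\<^sup>2 / moebius_denom)
       * lattice_jacobi z \<tau>"
proof -
  let ?J = moebius_denom
  have J: "?J \<noteq> 0" by (rule moebius_denom_nonzero)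
  have "(-1) ^ k * elem_sym_lattice k moebius_image * (z / ?J) ^ (2 * k + 1)
    = (1 / ?J) * ((-1) ^ k * elem_sym_lattice k \<tau> * z ^ (2 * k + 1))" for k
    unfolding elem_sym_lattice_moebius using J by (simp add: power_divide)
  moreover have "(\<Sum>k. (1 / ?J) * ((-1) ^ k * elem_sym_lattice k \<tau> * z ^ (2 * k + 1)))
    = (1 / ?J) * (\<Sum>k. (-1) ^ k * elem_sym_lattice k \<tau> * z ^ (2 * k + 1))"
    by (rule suminf_mult[OF sums_summable[OF elem_sym_lattice_sums[OF v]]])
  ultimately have ser: "(\<Sum>k. (-1) ^ k * elem_sym_lattice k moebius_image * (z / ?J) ^ (2 * k + 1))
    = (1 / ?J) * (\<Sum>k. (-1) ^ k * elem_sym_lattice k \<tau> * z ^ (2 * k + 1))"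
    by (simp only:)
  have v0: "of_real (Im \<tau>) \<noteq> (0::complex)" using v by simp
  have cn: "cnj ?J = ?J - 2 * \<i> * of_int c * of_real (Im \<tau>)"
    by (simp add: complex_eq_iff automorphy_denom_def)
  have cm: "?J * cnj ?J = of_real ((cmod ?J)\<^sup>2)"
    by (simp add: complex_mult_cnj cmod_power2)
  have "- (of_real pi * (z / ?J)\<^sup>2) / (2 * of_real (Im moebius_image))
    = - (of_real pi * z\<^sup>2 * (?J * cnj ?J)) / (2 * ?J\<^sup>2 * of_real (Im \<tau>))"
    unfolding Im_moebius_image cm by (simp add: power_divide)
  also have "\<dots> = - (of_real pi * z\<^sup>2 * cnj ?J) / (2 * ?J * of_real (Im \<tau>))"
    using J by (simp add: power2_eq_square mult_ac)
  also have "\<dots> = 2 * of_real pi * \<i> * of_real (1 / 2) * of_int c * z\<^sup>2 / ?J + - (of_real pi * z\<^sup>2) / (2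
    * of_real (Im \<tau>))"
    unfolding cn using J v0 by (simp add: field_simps)
  finally have ex: "exp (- (of_real pi * (z / ?J)\<^sup>2) / (2 * of_real (Im moebius_image))) =
      exp (2 * of_real pi * \<i> * of_real (1 / 2) * of_int c * z\<^sup>2 / ?J) * exp (- (of_real pi * z\<^sup>2) / (2
        * of_real (Im \<tau>)))"
    by (simp only: exp_add)
  have inv: "?J powi (- 1) = 1 / ?J" by (simp add: power_int_minus divide_inverse)
  show ?thesis
    unfolding lattice_jacobi_def ser ex inv by (simp only: mult_ac)
qed

end

section \<open>Depth and the lowering operator\<close>

text \<open>The coefficient of \<open>(1 / Im \<tau>) ^ j\<close>. For \<open>j = k\<close> it is
  the constant \<open>(- pi / 2) ^ k / fact k\<close>, so the depth is exactly
  \<open>k\<close>.\<close>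

definition qm_coeff :: "nat \<Rightarrow> nat \<Rightarrow> complex \<Rightarrow> complex" where
  "qm_coeff k j \<tau> = (- of_real (pi / 2)) ^ j / fact j * hol_coeff \<tau> (k - j)"

lemma holomorphic_qm_coeff: "qm_coeff k j holomorphic_on upper_half_plane"
  unfolding qm_coeff_def[abs_def] by (intro holomorphic_intros holomorphic_hol_coeff) auto

lemma elem_sym_lattice_eq_sum_qm_coeff:
  assumes "Im \<tau> > 0"
  shows "elem_sym_lattice k \<tau> = (\<Sum>j\<le>k. qm_coeff k j \<tau> * (1 / of_real (Im \<tau>)) ^ j)"
proof -
  have "(- of_real (pi / (2 * Im \<tau>))) ^ j = (- of_real (pi / 2)) ^ j * (1 / of_real (Im \<tau>) :: complex) ^ j" for j
    unfolding power_mult_distrib[symmetric] by (rule arg_cong[of _ _ "\<lambda>x. x ^ j"]) simp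
  then show ?thesis unfolding elem_sym_lattice_eq[OF assms] qm_coeff_def by (intro sum.cong) auto
qed

lemma almost_holomorphic_elem_sym_lattice:
  "almost_holomorphic_modular_form (2 * int k) k (elem_sym_lattice k)"
  unfolding almost_holomorphic_modular_form_def
proof (intro conjI allI impI ballI exI[of _ "qm_coeff k"])
  fix a b c d :: int and \<tau> :: complex assume det: "a * d - b * c = 1" and "\<tau> \<in> upper_half_plane"
  then have v: "Im \<tau> > 0" by simp
  have "(of_int c * \<tau> + of_int d) powi (2 * int k) = (of_int c * \<tau> + of_int d) ^ (2 * k)"
    by (metis of_nat_mult of_nat_numeral power_int_of_nat)
  then show "elem_sym_lattice k ((of_int a * \<tau> + of_int b) / (of_int c * \<tau> + of_int d)) =
      (of_int c * \<tau> + of_int d) powi (2 * int k) * elem_sym_lattice k \<tau>"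
    using elem_sym_lattice_moebius[OF det v, of k]
    by (simp add: moebius_def automorphy_denom_def)
next
  show "elem_sym_lattice k \<tau> = (\<Sum>j\<le>k. qm_coeff k j \<tau> * (1 / of_real (Im \<tau>)) ^ j)" if "\<tau> \<in> upper_half_plane" for \<tau>
    using that by (simp add: elem_sym_lattice_eq_sum_qm_coeff)
  show "\<exists>\<tau>\<in>upper_half_plane. qm_coeff k k \<tau> \<noteq> 0"
    by (intro bexI[of _ \<i>]) (auto simp: qm_coeff_def hol_coeff_def newton.simps(1))
qed (rule holomorphic_qm_coeff)

text \<open>The operator is linear over holomorphic functions and maps \<open>v^(-j)\<close> to
  \<open>- j v^(1-j)\<close>; the factorial in \<open>qm_coeff\<close> gives
  \<open>- (j + 1) * qm_coeff k (j + 1) = pi / 2 * qm_coeff (k - 1) j\<close>.\<close>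

lemma lowering_operator_elem_sym_lattice:
  assumes v: "Im \<tau> > 0" and k: "k \<ge> 1"
  shows "lowering_operator (elem_sym_lattice k) \<tau> = of_real pi / 2 * elem_sym_lattice (k - 1) \<tau>"
proof -
  let ?w = "inverse (Im \<tau>)"
  define D where "D h = (\<Sum>j\<le>k. qm_coeff k j \<tau> * of_real (- (real j * (Im h * ?w ^ (j + 1)))) + deriv
    (qm_coeff k j) \<tau> * h * of_real (?w ^ j))" for h
  have G: "((\<lambda>x. of_real (inverse (Im x) ^ j) :: complex) has_derivative (\<lambda>h. of_real (- (real j * (Im h
    * ?w ^ (j + 1)))))) (at \<tau>)" for j
  proof -
    have "((\<lambda>x. inverse (Im x) ^ j) has_derivative (\<lambda>h. - (real j * (Im h * ?w ^ (j + 1))))) (at \<tau>)"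
    proof -
      have "((\<lambda>y. inverse y ^ j) has_real_derivative - (real j * ?w ^ (j + 1))) (at (Im \<tau>))"
      proof (cases j)
        case (Suc i)
        have "((\<lambda>y. inverse y ^ Suc i) has_real_derivative (1 + real i) * (- (?w ^ Suc (Suc 0)) * ?w ^ i))
          (at (Im \<tau>))"
          by (rule DERIV_power_Suc[OF DERIV_inverse]) (use v in simp)
        then show ?thesis unfolding Suc by (rule DERIV_cong) (simp add: algebra_simps)
      qed simp
      from DERIV_compose_FDERIV[OF this bounded_linear_imp_has_derivative[OF bounded_linear_Im]]
      show ?thesis by (simp add: mult_ac)
    qed
    then show ?thesis by (rule has_derivative_of_real)
  qed
  have Q: "(qm_coeff k j has_derivative (\<lambda>h. deriv (qm_coeff k j) \<tau> * h)) (at \<tau>)" for j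
    using holomorphic_derivI[OF holomorphic_qm_coeff open_upper_half_plane, of \<tau> k j] v
      by (simp add: has_field_derivative_def)
  have "((\<lambda>x. \<Sum>j\<le>k. qm_coeff k j x * of_real (inverse (Im x) ^ j)) has_derivative D) (at \<tau>)"
    unfolding D_def by (intro has_derivative_sum has_derivative_mult Q G)
  then have "(elem_sym_lattice k has_derivative D) (at \<tau>)"
  proof (rule has_derivative_transform_within_open[OF _ open_upper_half_plane])
    show "\<tau> \<in> upper_half_plane" using v by simp
    fix x assume "x \<in> upper_half_plane"
    then show "(\<Sum>j\<le>k. qm_coeff k j x * of_real (inverse (Im x) ^ j)) = elem_sym_lattice k x"
      by (simp add: elem_sym_lattice_eq_sum_qm_coeff divide_inverse)
  qed
  then have fd: "frechet_derivative (elem_sym_lattice k) (at \<tau>) = D" by (rule frechet_derivative_at[symmetric])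
  \<comment> \<open>The holomorphic derivatives drop out since \<open>1 + i^2 = 0\<close>, and only
    the direction \<open>i\<close> moves \<open>Im \<tau>\<close>.\<close>
  have "D 1 + \<i> * D \<i> = (\<Sum>j\<le>k. qm_coeff k j \<tau> * (\<i> * of_real (- (real j * ?w ^ (j + 1)))))"
    unfolding D_def sum_distrib_left sum.distrib[symmetric] by (intro sum.cong refl) (simp add: algebra_simps)
  then have "lowering_operator (elem_sym_lattice k) \<tau> =
      - 2 * \<i> * of_real (Im \<tau>) ^ 2 * ((\<Sum>j\<le>k. qm_coeff k j \<tau> * (\<i> * of_real (- (real j * ?w ^ (j + 1))))) / 2)"
    unfolding lowering_operator_def wirtinger_bar_def fd by simp
  also have "\<dots> = (\<Sum>j\<le>k. - (of_nat j * qm_coeff k j \<tau>) * (of_real (Im \<tau>) ^ 2 * of_real (?w ^ (j + 1))))"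
    unfolding sum_divide_distrib sum_distrib_left by (intro sum.cong refl) (simp add: algebra_simps)
  \<comment> \<open>The term \<open>j = 0\<close> vanishes, and the index moves down by one.\<close>
  also have "\<dots> = (\<Sum>j<k. - (of_nat (Suc j) * qm_coeff k (Suc j) \<tau>) * (of_real (Im \<tau>) ^ 2 * of_real (?w ^ (j + 2))))"
  proof -
    have "{..k} = {..<Suc k}" by auto
    then show ?thesis by (simp only: sum.lessThan_Suc_shift) simp
  qed
  also have "\<dots> = (\<Sum>j<k. of_real pi / 2 * (qm_coeff (k - 1) j \<tau> * (1 / of_real (Im \<tau>)) ^ j))"
  proof (intro sum.cong refl)
    fix j assume "j \<in> {..<k}"
    have w: "of_real (Im \<tau>) ^ 2 * of_real (?w ^ (j + 2)) = (1 / of_real (Im \<tau>) :: complex) ^ j"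
      using v by (simp add: power_add power_divide power2_eq_square field_simps)
    have e: "- (of_nat (Suc j) * qm_coeff k (Suc j) \<tau>) = of_real pi / 2 * qm_coeff (k - 1) j \<tau>"
      by (simp add: qm_coeff_def field_simps del: of_nat_Suc)
    show "- (of_nat (Suc j) * qm_coeff k (Suc j) \<tau>) * (of_real (Im \<tau>) ^ 2 * of_real (?w ^ (j + 2))) =
        of_real pi / 2 * (qm_coeff (k - 1) j \<tau> * (1 / of_real (Im \<tau>)) ^ j)"
      unfolding w e by (simp only: mult.assoc)
  qed
  also have "\<dots> = of_real pi / 2 * elem_sym_lattice (k - 1) \<tau>"
  proof -
    have "{..<k} = {..k - 1}" using k by auto
    then show ?thesis by (simp add: elem_sym_lattice_eq_sum_qm_coeff[OF v] sum_distrib_left)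
  qed
  finally show ?thesis .
qed

lemma lattice_jacobi_elliptic:
  assumes v: "Im \<tau> > 0"
  shows "lattice_jacobi (z + of_int l * \<tau> + of_int \<mu>) \<tau> =
     (- 1) powi (\<lfloor>2 * (1 / 2 :: real)\<rfloor> * \<mu> + l * 1) *
     exp (- 2 * of_real pi * \<i> * of_real (1 / 2) * ((of_int l)\<^sup>2 * \<tau> + 2 * of_int l * z)) * lattice_jacobi z \<tau>"
proof -
  have f: "\<lfloor>2 * (1 / 2 :: real)\<rfloor> = 1" by simp
  have "(- 1 :: complex) powi (\<mu> + l) = (- 1) powi \<mu> * (- 1) powi l" by (rule power_int_add) simp
  then show ?thesis
    unfolding lattice_jacobi_eq_jacobi_phi[OF v] jacobi_phi_elliptic_int jacobi_phi_elliptic_tau[OF v] f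
    by (simp add: mult_ac)
qed

text \<open>Two descriptions share the work: the modular law is read off the defining series, the
  other axioms off the product \<open>jacobi_phi\<close>. The sign parameter is
  \<open>\<epsilon> = 1\<close>, and the Fourier expansion starts at \<open>n = 0\<close>.\<close>

lemma jacobi_form_lattice_jacobi: "jacobi_form (- 1) (1 / 2) lattice_jacobi"
  unfolding jacobi_form_def
proof (intro conjI allI impI ballI)
  show "2 * (1 / 2 :: real) \<in> \<nat>" by simp
  have eq: "(\<lambda>(z, \<tau>). jacobi_phi z \<tau>) x = (\<lambda>(z, \<tau>). lattice_jacobi z \<tau>) x" if "x \<in> UNIV \<times> upper_half_plane" for x
    using that by (auto simp: lattice_jacobi_eq_jacobi_phi)
  show "holomorphic2_on lattice_jacobi (UNIV \<times> upper_half_plane)"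
    unfolding holomorphic2_on_def
  proof
    fix p :: "complex \<times> complex" assume p: "p \<in> UNIV \<times> upper_half_plane"
    then obtain a b where "((\<lambda>(z, \<tau>). jacobi_phi z \<tau>) has_derivative (\<lambda>(x, y). a * x + b * y))
      (at p within UNIV \<times> upper_half_plane)"
      using holomorphic2_jacobi_phi unfolding holomorphic2_on_def by blast
    from has_derivative_transform[OF p _ this] eq
    show "\<exists>a b. ((\<lambda>(z, \<tau>). lattice_jacobi z \<tau>) has_derivative (\<lambda>(x, y). a * x + b * y))
      (at p within UNIV \<times> upper_half_plane)"
      by (metis (no_types, lifting))
  qed
next
  fix a b c d :: int and z \<tau> :: complex assume det: "a * d - b * c = 1" and "\<tau> \<in> upper_half_plane"
  then have v: "Im \<tau> > 0" by simp
  show "lattice_jacobi (z / (of_int c * \<tau> + of_int d)) ((of_int a * \<tau> + of_int b) / (of_int c * \<tau> + of_int d)) =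
     (of_int c * \<tau> + of_int d) powi - 1 *
     exp (2 * of_real pi * \<i> * of_real (1 / 2) * of_int c * z\<^sup>2 / (of_int c * \<tau> + of_int d)) * lattice_jacobi z \<tau>"
    using lattice_jacobi_moebius[OF det v, of z] by (simp only: moebius_def automorphy_denom_def)
next
  show "\<exists>\<epsilon>\<in>{0, 1 :: int}. \<forall>l \<mu> :: int. \<forall>z. \<forall>\<tau>\<in>upper_half_plane.
        lattice_jacobi (z + of_int l * \<tau> + of_int \<mu>) \<tau> =
          (- 1) powi (\<lfloor>2 * (1 / 2 :: real)\<rfloor> * \<mu> + l * \<epsilon>) *
          exp (- 2 * of_real pi * \<i> * of_real (1 / 2) * ((of_int l)\<^sup>2 * \<tau> + 2 * of_int l * z))
            * lattice_jacobi z \<tau>"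
    by (intro bexI[of _ 1] allI ballI lattice_jacobi_elliptic) auto
next
  obtain c where c: "\<And>z \<tau>. \<tau> \<in> upper_half_plane \<Longrightarrow>
     ((\<lambda>(n, r). c n r * exp (2 * of_real pi * \<i> * (of_int n * \<tau> + of_real r * z))) has_sum jacobi_phi z \<tau>)
       ({0..} \<times> {r. r - 1 / 2 \<in> \<int>})" using jacobi_phi_fourier by blast
  show "\<exists>(c :: int \<Rightarrow> real \<Rightarrow> complex) n\<^sub>0. \<forall>z. \<forall>\<tau>\<in>upper_half_plane.
        ((\<lambda>(n, r). c n r * exp (2 * of_real pi * \<i> * (of_int n * \<tau> + of_real r * z)))
           has_sum lattice_jacobi z \<tau>) ({n\<^sub>0..} \<times> {r. r - 1 / 2 \<in> \<int>})"
    using c by (intro exI[of _ c] exI[of _ 0] allI ballI) (simp add: lattice_jacobi_eq_jacobi_phi)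
qed simp

text \<open>\<open>infsum\<close>, \<open>Lim\<close> and \<open>suminf\<close> have values also
  where nothing converges. The first conjuncts therefore assert the convergence behind
  \<open>elem_sym_recip\<close>, \<open>elem_sym_lattice\<close> and \<open>lattice_jacobi\<close>,
  so that the remaining ones speak of the intended functions.\<close>

theorem theorem1p1:
  fixes k :: nat
  assumes "k \<ge> 1"
  shows
    "(\<forall>\<tau>\<in>upper_half_plane.
        (\<forall>j. (\<forall>s>0. (\<lambda>A. \<Prod>\<omega>\<in>A. 1 / \<omega>) summable_on recip_subsets j (deformed_lattice \<tau> s)) \<and>
             ((\<lambda>s. elem_sym_recip j (deformed_lattice \<tau> s))
                \<longlongrightarrow> elem_sym_lattice j \<tau>) (at_right 0)) \<and>
        (\<forall>z. summable (\<lambda>j. (- 1) ^ j * elem_sym_lattice j \<tau> * z ^ (2 * j + 1)))) \<and>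
     almost_holomorphic_modular_form (2 * int k) k (elem_sym_lattice k) \<and>
     (\<forall>\<tau>\<in>upper_half_plane.
        lowering_operator (elem_sym_lattice k) \<tau> = of_real pi / 2 * elem_sym_lattice (k - 1) \<tau>) \<and>
     jacobi_form (- 1) (1 / 2) lattice_jacobi"
proof (intro conjI ballI allI impI)
  fix \<tau> assume "\<tau> \<in> upper_half_plane"
  then have v: "Im \<tau> > 0" by simp
  show "(\<lambda>A. \<Prod>\<omega>\<in>A. 1 / \<omega>) summable_on recip_subsets j (deformed_lattice \<tau> s)" if "s > 0" for j s
    unfolding recip_subsets_eq_k_subsets
    by (rule abs_summable_summable[OF k_subsets_abs_summable[OF deformed_lattice_abs_summable[OF v that]]])
  show "((\<lambda>s. elem_sym_recip j (deformed_lattice \<tau> s)) \<longlongrightarrow> elem_sym_lattice j \<tau>) (at_right 0)" for j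
    unfolding elem_sym_lattice_eq_newton[OF v] by (rule tendsto_elem_sym_recip[OF v])
  show "summable (\<lambda>j. (- 1) ^ j * elem_sym_lattice j \<tau> * z ^ (2 * j + 1))" for z
    by (rule sums_summable[OF elem_sym_lattice_sums[OF v]])
  show "lowering_operator (elem_sym_lattice k) \<tau> = of_real pi / 2 * elem_sym_lattice (k - 1) \<tau>"
    by (rule lowering_operator_elem_sym_lattice[OF v assms])
qed (rule almost_holomorphic_elem_sym_lattice jacobi_form_lattice_jacobi)+

end
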